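(* Let $A$ be an $n\times n$ binary matrix with zero diagonal. If the seal space $Q^n_{\mathcal{F}_A}$ is a closed manifold, then (i) $\mathcal{F}_A$ is a strong facets-pairing structure on $\mathcal{C}^n$, and (ii) $Q^n_{\mathcal{F}_A}$ is homeomorphic to a generalized real Bott manifold.
   Context: A generalized real Bott manifold is a manifold $M^n=B_m$ admitting a sequence of fiber bundles $B_m\to B_{m-1}\to\dots\to B_1\to B_0=\{\mathrm{pt}\}$ where each $B_i$ is the projectivization of a Whitney sum of finitely many real line bundles over $B_{i-1}$. $\mathcal{C}^n=\{x\in\mathbb{R}^n: -\tfrac14\le x_i\le\tfrac14\}$; $\mathbf{F}(i)$, $\mathbf{F}(-i)$ ($1\le i\le n$) are the facets in $\{x_i=\tfrac14\}$, $\{x_i=-\tfrac14\}$. Binary matrices have entries in $\mathbb{Z}_2$; $A^i_k$ denotes the $(i,k)$ entry as $0$ or $1$. $\mathcal{F}_A$ pairs $\mathbf{F}(j)$ with $\mathbf{F}(-j)$ via $\tau^A_j:\mathbf{F}(j)\to\mathbf{F}(-j)$, $\tau^A_j(x)=y$ with $y_{|j|}=-x_{|j|}$ and $y_k=(-1)^{A^{|j|}_k}x_k$ for $k\ne|j|$. $Q^n_{\mathcal{F}_A}$ is the quotient of $\mathcal{C}^n$ by the equivalence relation generated by $x\sim\tau^A_j(x)$. A composition $\tau^A_{k_m}\circ\dots\circ\tau^A_{k_1}$ applied to a proper face $f$ is valid if $f\subset\mathbf{F}(k_1)$ and $\tau^A_{k_i}\circ\dots\circ\tau^A_{k_1}(f)\subset\mathbf{F}(k_{i+1})$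 for $1\le i<m$ ($m=0$ allowed). For a proper face $f$ let $\Xi(f)$ be the set of facets containing $f$; if $f\subset\mathbf{F}(k)$ and $f'=\tau^A_k(f)$, define $\Psi^f_k:\Xi(f)\to\Xi(f')$ by $\Psi^f_k(\mathbf{F}(k))=\mathbf{F}(-k)$ and, for other $F'\in\Xi(f)$, $\Psi^f_k(F')$ is the facet $G$ with $G\cap\mathbf{F}(-k)=\tau^A_k(F'\cap\mathbf{F}(k))$. $\mathcal{F}_A$ is strong if for every proper face $f$ and any two valid compositions mapping $f$ onto the same face $\widetilde f$: (a) they agree at every point of $f$; and (b) the corresponding composites of the maps $\Psi$ coincide as maps $\Xi(f)\to\Xi(\widetilde f)$. *)

theory Defs
  imports "HOL-Analysis.Analysis"
begin

definition eq_class :: "'a topology \<Rightarrow> ('a \<Rightarrow> 'a \<Rightarrow> bool) \<Rightarrow> 'a \<Rightarrow> 'a set" where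
  "eq_class X R x = {y \<in> topspace X. R x y}"

definition quotient_top :: "'a topology \<Rightarrow> ('a \<Rightarrow> 'a \<Rightarrow> bool) \<Rightarrow> 'a set topology" where
  "quotient_top X R = topology (\<lambda>U. U \<subseteq> eq_class X R ` topspace X \<and>
        openin X {x \<in> topspace X. eq_class X R x \<in> U})"

definition closed_manifold :: "'a topology \<Rightarrow> bool" where
  "closed_manifold X \<longleftrightarrow> compact_space X \<and> Hausdorff_space X \<and> second_countable X \<and>
     (\<exists>d. \<forall>x\<in>topspace X. \<exists>U. openin X U \<and> x \<in> U \<and>
        (\<exists>V. openin (Euclidean_space d) V \<and>
             subtopology X U homeomorphic_space subtopology (Euclidean_space d) V))"

definition real_line_bundle ::
  "'b topology \<Rightarrow> 'e topology \<Rightarrow> ('e \<Rightarrow> 'b) \<Rightarrow> ('e \<Rightarrow> 'e \<Rightarrow> 'e) \<Rightarrow> (real \<Rightarrow> 'e \<Rightarrow> 'e) \<Rightarrow> bool" where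
  "real_line_bundle B E p add smul \<longleftrightarrow>
     continuous_map E B p \<and> p ` topspace E = topspace B \<and>
     (\<forall>e\<in>topspace E. \<forall>e'\<in>topspace E. p e = p e' \<longrightarrow> add e e' \<in> topspace E \<and> p (add e e') = p e) \<and>
     (\<forall>e\<in>topspace E. \<forall>c. smul c e \<in> topspace E \<and> p (smul c e) = p e) \<and>
     (\<forall>b\<in>topspace B. \<exists>U. openin B U \<and> b \<in> U \<and>
        (\<exists>\<phi>. homeomorphic_map (subtopology E {e \<in> topspace E. p e \<in> U})
                 (prod_topology (subtopology B U) euclideanreal) \<phi> \<and>
             (\<forall>e\<in>topspace E. p e \<in> U \<longrightarrow>
                 fst (\<phi> e) = p e \<and>
                 (\<forall>c. snd (\<phi> (smul c e)) = c * snd (\<phi> e)) \<and>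
                 (\<forall>e'\<in>topspace E. p e' = p e \<longrightarrow> snd (\<phi> (add e e')) = snd (\<phi> e) + snd (\<phi> e')))))"

definition whitney_sum ::
  "'b topology \<Rightarrow> nat \<Rightarrow> (nat \<Rightarrow> 'e topology) \<Rightarrow> (nat \<Rightarrow> 'e \<Rightarrow> 'b) \<Rightarrow> (nat \<Rightarrow> 'e) topology" where
  "whitney_sum B k E p = subtopology (product_topology E {..<k})
      {e. \<exists>b\<in>topspace B. \<forall>j<k. p j (e j) = b}"

definition proj_whitney_sum ::
  "'b topology \<Rightarrow> nat \<Rightarrow> (nat \<Rightarrow> 'e topology) \<Rightarrow> (nat \<Rightarrow> 'e \<Rightarrow> 'b) \<Rightarrow> (nat \<Rightarrow> real \<Rightarrow> 'e \<Rightarrow> 'e)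
     \<Rightarrow> (nat \<Rightarrow> 'e) set topology" where
  "proj_whitney_sum B k E p smul =
     quotient_top
       (subtopology (whitney_sum B k E p) {e. \<exists>j<k. e j \<noteq> smul j 0 (e j)})
       (\<lambda>e e'. \<exists>c. c \<noteq> 0 \<and> (\<forall>j<k. e' j = smul j c (e j)))"

definition is_proj_line_sum :: "'a topology \<Rightarrow> 'b topology \<Rightarrow> bool" where
  "is_proj_line_sum Y B \<longleftrightarrow>
     (\<exists>k (E :: nat \<Rightarrow> real topology) p add smul. k \<ge> 1 \<and>
        (\<forall>j<k. real_line_bundle B (E j) (p j) (add j) (smul j)) \<and>
        Y homeomorphic_space proj_whitney_sum B k E p smul)"

text \<open>X is homeomorphic to a generalized real Bott manifold B_m, where
  B_0 is a point and B_(i+1) is the projectivization of a Whitney sum of real line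
  bundles over B_i.  (All stages are realised, up to homeomorphism, as topologies on
  the type real, which has the cardinality of the continuum.)\<close>
definition homeomorphic_to_gen_real_bott :: "'a topology \<Rightarrow> bool" where
  "homeomorphic_to_gen_real_bott X \<longleftrightarrow>
     (\<exists>m (B :: nat \<Rightarrow> real topology).
        (\<exists>b. topspace (B 0) = {b}) \<and>
        (\<forall>i<m. is_proj_line_sum (B (Suc i)) (B i)) \<and>
        X homeomorphic_space B m)"

text \<open>Coordinates are indexed by a finite type 'n (n = CARD('n)). A facet label (i, True)
  stands for F(i) = {x_i = 1/4}, (i, False) for F(-i) = {x_i = -1/4}.
  A binary matrix is A :: 'n => 'n => bool, A i k = True meaning entry 1.\<close>
definition cube :: "(real^'n) set" where
  "cube = {x. \<forall>i. - (1/4) \<le> x$i \<and> x$i \<le> 1/4}"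

definition facet :: "'n::finite \<times> bool \<Rightarrow> (real^'n) set" where
  "facet j = {x \<in> cube. x $ fst j = (if snd j then 1/4 else - (1/4))}"

definition neg_label :: "'n::finite \<times> bool \<Rightarrow> 'n \<times> bool" where
  "neg_label j = (fst j, \<not> snd j)"

definition tau :: "('n::finite \<Rightarrow> 'n \<Rightarrow> bool) \<Rightarrow> 'n \<times> bool \<Rightarrow> real^'n \<Rightarrow> real^'n" where
  "tau A j x = (\<chi> k. if k = fst j then - x$k else if A (fst j) k then - x$k else x$k)"

definition seal_step :: "('n::finite \<Rightarrow> 'n \<Rightarrow> bool) \<Rightarrow> real^'n \<Rightarrow> real^'n \<Rightarrow> bool" where
  "seal_step A x y \<longleftrightarrow> (\<exists>j. x \<in> facet j \<and> y = tau A j x)"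

definition seal_rel :: "('n::finite \<Rightarrow> 'n \<Rightarrow> bool) \<Rightarrow> real^'n \<Rightarrow> real^'n \<Rightarrow> bool" where
  "seal_rel A = (\<lambda>x y. seal_step A x y \<or> seal_step A y x)\<^sup>*\<^sup>*"

definition seal_space :: "('n::finite \<Rightarrow> 'n \<Rightarrow> bool) \<Rightarrow> (real^'n) set topology" where
  "seal_space A = quotient_top (subtopology euclidean cube) (seal_rel A)"

definition proper_face :: "(real^'n::finite) set \<Rightarrow> bool" where
  "proper_face f \<longleftrightarrow> f face_of cube \<and> f \<noteq> {} \<and> f \<noteq> cube"

definition Xi :: "(real^'n::finite) set \<Rightarrow> ('n \<times> bool) set" where
  "Xi f = {j. f \<subseteq> facet j}"

fun comp_tau :: "('n::finite \<Rightarrow> 'n \<Rightarrow> bool) \<Rightarrow> ('n \<times> bool) list \<Rightarrow> real^'n \<Rightarrow> real^'n" where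
  "comp_tau A [] = id"
| "comp_tau A (k # ks) = comp_tau A ks \<circ> tau A k"

fun valid_comp :: "('n::finite \<Rightarrow> 'n \<Rightarrow> bool) \<Rightarrow> (real^'n) set \<Rightarrow> ('n \<times> bool) list \<Rightarrow> bool" where
  "valid_comp A f [] = True"
| "valid_comp A f (k # ks) \<longleftrightarrow> f \<subseteq> facet k \<and> valid_comp A (tau A k ` f) ks"

text \<open>Psi^f_k : Xi(f) -> Xi(tau_k f) (f is only used through its domain Xi(f)).\<close>
definition Psi :: "('n::finite \<Rightarrow> 'n \<Rightarrow> bool) \<Rightarrow> 'n \<times> bool \<Rightarrow> 'n \<times> bool \<Rightarrow> 'n \<times> bool" where
  "Psi A k F' = (if F' = k then neg_label k
       else (THE G. facet G \<inter> facet (neg_label k) = tau A k ` (facet F' \<inter> facet k)))"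

fun comp_Psi :: "('n::finite \<Rightarrow> 'n \<Rightarrow> bool) \<Rightarrow> ('n \<times> bool) list \<Rightarrow> 'n \<times> bool \<Rightarrow> 'n \<times> bool" where
  "comp_Psi A [] = id"
| "comp_Psi A (k # ks) = comp_Psi A ks \<circ> Psi A k"

definition strong_pairing :: "('n::finite \<Rightarrow> 'n \<Rightarrow> bool) \<Rightarrow> bool" where
  "strong_pairing A \<longleftrightarrow>
     (\<forall>f ks ks'. proper_face f \<and> valid_comp A f ks \<and> valid_comp A f ks' \<and>
        comp_tau A ks ` f = comp_tau A ks' ` f \<longrightarrow>
          (\<forall>x\<in>f. comp_tau A ks x = comp_tau A ks' x) \<and>
          (\<forall>F\<in>Xi f. comp_Psi A ks F = comp_Psi A ks' F))"

end

theory Submission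
  imports Defs "HOL-Homology.Homology"
begin

text \<open>
  The walls met by a point act on it through the sums modulo 2 of the corresponding rows of \<open>A + I\<close>.
  Take a minimal nonempty set \<open>h\<close> of rows whose sum vanishes on \<open>h\<close>. At the point with coordinates
  \<open>1/4\<close> on \<open>h\<close> and \<open>0\<close> elsewhere the seal space looks like the quotient of Euclidean space by \<open>-1\<close> on
  \<open>r\<close> coordinates, where \<open>r\<close> counts \<open>h\<close> and the coordinates off \<open>h\<close> on which the sum is nonzero.
  If \<open>r \<ge> 3\<close> this is not a manifold: in a chart the branch set is closed and injects into a space
  of codimension at least 3, so its complement has no first homology, yet it carries a nontrivial
  double cover. Hence \<open>h\<close> is a pair of equal rows. It follows that every set of rows whose sum
  vanishes on the set has sum zero, which gives strongness, and that the classes of equal rows form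
  an acyclic graph. Removing a sink class \<open>P\<close> exhibits the seal space as the projectivization of
  the sum of a trivial bundle and one line bundle for each coordinate in \<open>P\<close>.
\<close>

section \<open>Homology of complements in Euclidean space\<close>

text \<open>The threshold 3 is sharp: the plane modulo -1 is again a plane, so a pair of equal rows
  is harmless and survives as the source of projective fibres. Minimality of \<open>h\<close> leaves
  a stabiliser of order two, hence a double cover off the branch set. Charts are only topological
  and the branch set may sit wildly in them, so no link or tubular neighbourhood can be used; the
  homology of the complement, however, depends only on the homeomorphism type of a closed set. The
  dimension of a chart is not given in advance and is compared with the number of coordinates by
  invariance of domain. On the constructive side, each wall in a class \<open>P\<close> acts on the
  coordinates in \<open>P\<close> by the antipodal map, so the fibre is a cube with antipodal
  boundary points identified, a projective space; the trivial summand carries the extra homogeneous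
  coordinate. The line bundles are well defined because an element that fixes a point acts trivially
  on the fibres over it.\<close>

lemma trivial_homology_Euclidean_complement:
  assumes "closedin (Euclidean_space n) T" "T \<noteq> topspace (Euclidean_space n)"
  shows "trivial_group (homology_group 1 (subtopology (Euclidean_space (n+2)) (topspace (Euclidean_space (n+2)) - T)))"
proof -
  let ?E = "Euclidean_space (n+2)"
  let ?C = "topspace ?E - T"
  have sub: "topspace (Euclidean_space n) \<subseteq> topspace ?E" by simp
  have ne: "topspace ?E \<inter> ?C \<noteq> {}"
    using assms closedin_subset sub by fastforce
  \<comment> \<open>\<open>T\<close> misses a point, so relative homology in degree 0 vanishes. Two
    further dimensions shift this to degree 2, and contractibility of the ambient space turns it
    into degree 1 of the complement.\<close>
  have 0: "trivial_group (relative_homology_group 0 (Euclidean_space n) (topspace (Euclidean_space n) - T))"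
  proof -
    obtain a where a: "a \<in> topspace (Euclidean_space n) - T"
      using assms closedin_subset by blast
    have "relative_homology_group 0 (Euclidean_space n) (topspace (Euclidean_space n) - T)
       \<cong> reduced_homology_group (0 - 1) (subtopology (Euclidean_space n) (topspace (Euclidean_space n) - T))"
      by (rule isomorphic_group_relative_homology_of_contractible) (use a in auto)
    then show ?thesis
      using isomorphic_group_triviality trivial_reduced_homology_group
      by (metis diff_0 group_reduced_homology_group group_relative_homology_group neg_less_0_iff_less zero_less_one)
  qed
  have "relative_homology_group 0 (Euclidean_space n) (topspace (Euclidean_space n) - T)
      \<cong> relative_homology_group (0 + int 2) ?E ?C"
    using relative_homology_group_Euclidean_complement_step[OF assms(1), of 0 2] by simp
  then have 2: "trivial_group (relative_homology_group 2 ?E ?C)"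
    using 0 isomorphic_group_triviality
    by (metis add_0 group_relative_homology_group of_nat_numeral)
  have "relative_homology_group 2 ?E ?C \<cong> reduced_homology_group (2 - 1) (subtopology ?E ?C)"
    by (rule isomorphic_group_relative_homology_of_contractible) (use ne in auto)
  then have "relative_homology_group 2 ?E ?C \<cong> homology_group 1 (subtopology ?E ?C)"
    by (simp add: un_reduced_homology_group)
  then show ?thesis
    using 2 isomorphic_group_triviality group_relative_homology_group by blast
qed

lemma compactin_Euclidean_space:
  "compactin (Euclidean_space n) S \<longleftrightarrow> compact S \<and> S \<subseteq> topspace (Euclidean_space n)"
  by (simp add: Euclidean_space_def compactin_subtopology euclidean_product_topology topspace_Euclidean_space[unfolded Euclidean_space_def])

lemma k_space_Euclidean_space: "k_space (Euclidean_space n)"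
  by (simp add: Euclidean_space_def euclidean_product_topology metrizable_imp_k_space
      metrizable_space_euclidean metrizable_space_subtopology)

lemma continuous_map_Euclidean_space_projection:
  "continuous_map (Euclidean_space n) euclideanreal (\<lambda>x. x i)"
  unfolding Euclidean_space_def
  by (rule continuous_map_from_subtopology[OF continuous_map_product_projection[of i UNIV "\<lambda>i. euclideanreal"]]) simp

lemma compact_bounded_Euclidean_space:
  assumes "closedin (Euclidean_space n) S" "\<And>x i. x \<in> S \<Longrightarrow> \<bar>x i\<bar> \<le> R"
  shows "compactin (Euclidean_space n) S"
proof -
  have "compactin (powertop_real UNIV) (PiE UNIV (\<lambda>i::nat. {-R..R}))"
    by (simp add: compactin_PiE)
  then have "compact (PiE UNIV (\<lambda>i::nat. {-R..R}))"
    by (simp add: euclidean_product_topology)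
  then have "compact (PiE UNIV (\<lambda>i::nat. {-R..R}) \<inter> S)"
    using closedin_Euclidean_imp_closed[OF assms(1)] by (rule compact_Int_closed)
  moreover have "PiE UNIV (\<lambda>i::nat. {-R..R}) \<inter> S = S"
    using assms(2) by (auto simp: abs_le_iff PiE_iff) (metis minus_le_iff)
  ultimately show ?thesis
    using closedin_subset[OF assms(1)] by (simp add: compactin_Euclidean_space)
qed

text \<open>Adding the norm as a further coordinate makes an injection proper, hence a closed embedding.\<close>
lemma trivial_homology_complement_of_injection:
  assumes S: "closedin (Euclidean_space d) S"
    and f: "continuous_map (subtopology (Euclidean_space d) S) (Euclidean_space m) f"
    and inj: "inj_on f S" and md: "m + 3 \<le> d"
  shows "trivial_group (homology_group 1 (subtopology (Euclidean_space d) (topspace (Euclidean_space d) - S)))"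
proof -
  let ?X = "subtopology (Euclidean_space d) S"
  let ?Y = "Euclidean_space (m+1)"
  define \<nu> :: "(nat \<Rightarrow> real) \<Rightarrow> real" where "\<nu> x = (\<Sum>i<d. \<bar>x i\<bar>)" for x
  define F :: "(nat \<Rightarrow> real) \<Rightarrow> nat \<Rightarrow> real"
    where "F x = (\<lambda>i. if i < m+1 then (if i = m then \<nu> x else f x i) else 0)" for x
  have topX: "topspace ?X = S" using closedin_subset[OF S] by auto
  have fext: "f x i = 0" if "x \<in> S" "i \<ge> m" for x i
    using continuous_map_funspace[OF f] that topX by (force simp: topspace_Euclidean_space)
  have fi: "continuous_map ?X euclideanreal (\<lambda>x. f x i)" for i
  proof -
    from continuous_map_compose[OF f continuous_map_Euclidean_space_projection] show ?thesis by (simp add: o_def)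
  qed
  have ci: "continuous_map ?X euclideanreal (\<lambda>x. x i)" for i
      by (simp add: continuous_map_from_subtopology continuous_map_Euclidean_space_projection)
  have F: "continuous_map ?X ?Y F"
    unfolding F_def continuous_map_componentwise_Euclidean_space
    by (auto simp: \<nu>_def intro!: fi continuous_map_sum ci continuous_map_real_abs)
  have injF: "inj_on F S"
  proof (rule inj_onI)
    fix x y assume xy: "x \<in> S" "y \<in> S" "F x = F y"
    have "f x i = f y i" for i
    proof (cases "i < m")
      case True then show ?thesis using fun_cong[OF xy(3), of i] by (simp add: F_def)
    next
      case False then show ?thesis using fext xy by simp
    qed
    then show "x = y" using inj xy by (metis inj_onD ext)
  qed
  have prpr: "proper_map ?X ?Y F"
  proof (rule compact_imp_proper_map)
    show "k_space ?Y" by (rule k_space_Euclidean_space)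
    show "kc_space ?Y" by (simp add: Hausdorff_imp_kc_space Hausdorff_Euclidean_space)
    show "F \<in> topspace ?X \<rightarrow> topspace ?Y" using F continuous_map_funspace by blast
    show "continuous_map ?X ?Y F \<or> kc_space ?X" using F by blast
    fix K assume K: "compactin ?Y K"
    have "compactin euclideanreal ((\<lambda>x. x m) ` K)"
      by (rule image_compactin[OF K continuous_map_Euclidean_space_projection])
    then have "bounded ((\<lambda>x. x m) ` K)" by (simp add: compact_imp_bounded)
    then obtain R where R: "\<And>x. x \<in> K \<Longrightarrow> \<bar>x m\<bar> \<le> R" by (auto simp: bounded_iff)
    let ?P = "{x \<in> topspace ?X. F x \<in> K}"
    have "closedin ?X ?P"
      by (rule closedin_continuous_map_preimage[OF F compactin_imp_closedin[OF Hausdorff_Euclidean_space K]])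
    then have "closedin (Euclidean_space d) ?P"
      by (rule closedin_closed_subtopology[OF S, THEN iffD1, THEN conjunct1])
    moreover have "\<bar>x i\<bar> \<le> max R 0" if "x \<in> ?P" for x i
    proof (cases "i < d")
      case True
      have "\<bar>x i\<bar> \<le> \<nu> x" unfolding \<nu>_def by (rule member_le_sum) (use True in auto)
      moreover have "F x m = \<nu> x" by (simp add: F_def)
      ultimately show ?thesis using R[of "F x"] that by auto
    next
      case False
      then have "x i = 0" using that by (auto simp: topspace_Euclidean_space)
      then show ?thesis by simp
    qed
    ultimately have "compactin (Euclidean_space d) ?P"
      by (rule compact_bounded_Euclidean_space)
    then show "compactin ?X ?P" by (auto simp: compactin_subtopology)
  qed
  let ?T = "F ` S"
  have closedT: "closedin ?Y ?T"
    using prpr closedin_topspace[of ?X] unfolding proper_map_def closed_map_def topX by blast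
  have emb: "embedding_map ?X ?Y F"
    by (rule injective_closed_imp_embedding_map[OF F proper_imp_closed_map[OF prpr]]) (simp only: topX injF)
  then have hom: "?X homeomorphic_space subtopology ?Y ?T"
    unfolding embedding_map_def topX using homeomorphic_map_imp_homeomorphic_space by blast
  have up: "closedin (Euclidean_space n') ?T" if "m+1 \<le> n'" for n'
    using closedT that by (auto simp: closedin_Euclidean_space_iff topspace_Euclidean_space)
  have sub: "subtopology (Euclidean_space n') ?T = subtopology ?Y ?T" if "m+1 \<le> n'" for n'
    using closedin_subset[OF closedT] that
    by (auto simp: Euclidean_space_def subtopology_subtopology topspace_Euclidean_space intro!: arg_cong[of _ _ "subtopology _"])
  \<comment> \<open>Codimension 3 is spent here: one dimension goes to the norm coordinate and two
    to the shift from degree 0 to degree 2.\<close>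
  obtain e where e: "d = e + 2" "m + 1 \<le> e" using md by (metis le_iff_add add.assoc add.commute one_plus_numeral semiring_norm(3))
  \<comment> \<open>The norm coordinate is nonnegative on the image, so a point with -1 there is
    missed.\<close>
  have "?T \<noteq> topspace (Euclidean_space e)"
  proof
    assume eq: "?T = topspace (Euclidean_space e)"
    have "(\<lambda>i. if i = m then -1 else 0) \<in> topspace (Euclidean_space e)"
      using e by (auto simp: topspace_Euclidean_space)
    then obtain x where "x \<in> S" "F x = (\<lambda>i. if i = m then -1 else 0)" using eq by (metis imageE)
    then have "F x m = -1" by simp
    then have "\<nu> x = -1" by (simp add: F_def)
    moreover have "\<nu> x \<ge> 0" by (simp add: \<nu>_def sum_nonneg)
    ultimately show False by simp
  qed
  from trivial_homology_Euclidean_complement[OF up[OF e(2)] this]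
  have "trivial_group (homology_group 1 (subtopology (Euclidean_space d) (topspace (Euclidean_space d) - ?T)))"
    by (simp add: e)
  \<comment> \<open>Complements of homeomorphic closed sets have isomorphic homology, so the
    possibly wild position of \<open>S\<close> may be exchanged for that of
    \<open>?T\<close>.\<close>
  moreover have "homology_group 1 (subtopology (Euclidean_space d) (topspace (Euclidean_space d) - S))
     \<cong> homology_group 1 (subtopology (Euclidean_space d) (topspace (Euclidean_space d) - ?T))"
    by (rule isomorphic_homology_groups_Euclidean_complements[OF S up]) (use md hom sub[of d] in auto)
  ultimately show ?thesis
    using isomorphic_group_triviality group_relative_homology_group by blast
qed

section \<open>Double covers over spaces without first homology\<close>

lemma trivial_homology_imp_boundary:
  assumes "trivial_group (homology_group (int n) Z)" "singular_relcycle n Z {} c"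
  shows "singular_relboundary n Z {} c"
proof -
  have "homologous_rel_set n Z {} c \<in> carrier (homology_group (int n) Z)"
    using assms(2) by (auto simp: carrier_relative_homology_group)
  then have "homologous_rel_set n Z {} c = singular_relboundary_set n Z {}"
    using assms(1) by (simp add: trivial_group_def)
  then have "homologous_rel n Z {} c = singular_relboundary n Z {}"
    by (simp add: set_eq_iff fun_eq_iff)
  then show ?thesis by (simp add: homologous_rel_eq_relboundary)
qed

text \<open>The double cover defines a mod 2 cocycle: a singular edge counts as odd if its lift
  leaves the image of a fixed (discontinuous) section at exactly one end. A loop that is a
  boundary has even count, so it lifts to a loop.\<close>
lemma double_cover_lift_closed:
  fixes p :: "'a::real_normed_vector \<Rightarrow> 'b::real_normed_vector" and Z :: "'z topology"
  assumes cov: "covering_space C p B"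
    and two: "\<And>x y z. \<lbrakk>x \<in> C; y \<in> C; z \<in> C; p x = p y; p y = p z\<rbrakk> \<Longrightarrow> x = y \<or> y = z \<or> x = z"
    and triv: "trivial_group (homology_group 1 Z)"
    and G: "continuous_map Z (top_of_set B) G"
    and \<gamma>: "continuous_map (top_of_set {0..1::real}) Z \<gamma>" "\<gamma> 0 = \<gamma> 1"
    and t: "continuous_on {0..1} t" "t \<in> {0..1} \<rightarrow> C" "\<And>s. s \<in> {0..1} \<Longrightarrow> p (t s) = G (\<gamma> s)"
  shows "t 0 = t 1"
proof -
  define \<sigma> where "\<sigma> b = (SOME a. a \<in> C \<and> p a = b)" for b
  have \<sigma>: "\<sigma> (p a) \<in> C" "p (\<sigma> (p a)) = p a" if "a \<in> C" for a
    using someI[of "\<lambda>a'. a' \<in> C \<and> p a' = p a" a] that by (auto simp: \<sigma>_def)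
  define m where "m a \<longleftrightarrow> a = \<sigma> (p a)" for a
  have m_two: "m a \<longleftrightarrow> \<not> m b" if "a \<in> C" "b \<in> C" "p a = p b" "a \<noteq> b" for a b
  proof -
    have "b = \<sigma> (p a) \<or> a = \<sigma> (p a)"
      using two[OF that(1,2) \<sigma>(1)[OF that(1)] that(3)] \<sigma>(2)[OF that(1)] that(3,4) by simp
    then show ?thesis using that(3,4) by (metis m_def)
  qed
  define seg :: "real \<Rightarrow> nat \<Rightarrow> real" where "seg s = (\<lambda>i. if i = 0 then 1 - s else if i = 1 then s else 0)" for s
  have seg: "seg s \<in> standard_simplex 1" if "s \<in> {0..1}" for s
    using that by (auto simp: seg_def standard_simplex_def)
  define islift where "islift c g \<longleftrightarrow> continuous_on {0..1} g \<and> g \<in> {0..1} \<rightarrow> C \<and> (\<forall>s\<in>{0..1}. p (g s) = G (c (seg s)))"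
    for c :: "(nat \<Rightarrow> real) \<Rightarrow> 'z" and g :: "real \<Rightarrow> 'a"
  define flips where "flips c \<longleftrightarrow> (\<exists>g. islift c g \<and> m (g 0) \<noteq> m (g 1))" for c
  \<comment> \<open>Two lifts of one edge agree everywhere or nowhere. In the second case the marks
    at both ends are exchanged, so comparing them gives the same answer.\<close>
  have flips_iff: "flips c \<longleftrightarrow> m (g 0) \<noteq> m (g 1)" if g: "islift c g" for c g
  proof -
    have "(m (h 0) \<noteq> m (h 1)) \<longleftrightarrow> (m (g 0) \<noteq> m (g 1))" if h: "islift c h" for h
    proof -
      have gc: "continuous_on {0..1} (\<lambda>s. p (g s))" "(\<lambda>s. p (g s)) \<in> {0..1} \<rightarrow> B"
        using g covering_space_imp_continuous[OF cov] covering_space_imp_surjective[OF cov]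
        by (auto simp: islift_def intro!: continuous_on_compose2[of C p])
      have u: "g a = h a \<Longrightarrow> x \<in> {0..1} \<Longrightarrow> g x = h x" if "a \<in> {0..1}" for a x
        by (rule covering_space_lift_unique[OF cov, where ?g1.0=g and ?g2.0=h and a=a and f="\<lambda>s. p (g s)" and T="{0..1}"])
          (use gc g h that in \<open>auto simp: islift_def\<close>)
      show ?thesis
      proof (cases "g 0 = h 0")
        case True
        then show ?thesis using u[of 0 1] by simp
      next
        case False
        then have "g 1 \<noteq> h 1" using u[of 1 0] by auto
        moreover have "g 0 \<in> C" "g 1 \<in> C" "h 0 \<in> C" "h 1 \<in> C" "p (g 0) = p (h 0)" "p (g 1) = p (h 1)"
          using g h by (auto simp: islift_def)
        ultimately show ?thesis using m_two False by blast
      qed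
    qed
    then show ?thesis using g unfolding flips_def by blast
  qed
  define cnt where "cnt c = Poly_Mapping.lookup (frag_extend (\<lambda>s. if flips s then frag_of () else 0) c) ()"
    for c :: "'z chain"
  have cnt_of: "cnt (frag_of c) = (if flips c then 1 else 0)" for c
    by (simp add: cnt_def)
  have cnt_diff: "cnt (a - b) = cnt a - cnt b" for a b
    by (simp add: cnt_def frag_extend_diff lookup_minus)
  have cnt_add: "cnt (a + b) = cnt a + cnt b" for a b
    by (simp add: cnt_def frag_extend_add lookup_add)
  have simplex: "even (cnt (chain_boundary 2 (frag_of f)))" if f: "singular_simplex 2 Z f" for f
  proof -
    \<comment> \<open>A flat copy of the standard 2-simplex in the plane; its convexity supplies the
      simple and local path connectedness that lifting needs.\<close>
    define T :: "(real \<times> real) set" where "T = {(a,b). 0 \<le> a \<and> 0 \<le> b \<and> a + b \<le> 1}"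
    define q :: "real \<times> real \<Rightarrow> nat \<Rightarrow> real"
      where "q z = (\<lambda>i. if i = 0 then 1 - fst z - snd z else if i = 1 then fst z else if i = 2 then snd z else 0)" for z
    have cT: "convex T"
    proof -
      have "T = {x. (1,0) \<bullet> x \<ge> 0} \<inter> {x. (0,1) \<bullet> x \<ge> 0} \<inter> {x. (1,1) \<bullet> x \<le> 1}"
        by (auto simp: T_def)
      then show ?thesis
        by (simp only:) (intro convex_Int convex_halfspace_ge convex_halfspace_le)
    qed
    have "sum (q z) {..2} = 1" for z
      by (simp add: q_def numeral_2_eq_2)
    then have qS: "q z \<in> standard_simplex 2" if "z \<in> T" for z
      using that by (auto simp: T_def q_def standard_simplex_def)
    have "continuous_on T (\<lambda>z. q z i)" for i
      by (cases "i = 0"; cases "i = 1"; cases "i = 2") (auto simp: q_def intro!: continuous_intros)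
    then have "continuous_map (top_of_set T) (powertop_real UNIV) q"
      by (simp add: continuous_map_componentwise_UNIV)
    then have "continuous_map (top_of_set T) (subtopology (powertop_real UNIV) (standard_simplex 2)) q"
      using qS by (auto simp: continuous_map_in_subtopology)
    then have "continuous_map (top_of_set T) (top_of_set B) (G \<circ> (f \<circ> q))"
      using f G unfolding singular_simplex_def by (meson continuous_map_compose)
    then have c: "continuous_on T (G \<circ> (f \<circ> q))" "G \<circ> (f \<circ> q) \<in> T \<rightarrow> B"
      by (auto simp: continuous_map_in_subtopology)
    obtain H where H: "continuous_on T H" "H \<in> T \<rightarrow> C" "\<And>y. y \<in> T \<Longrightarrow> p (H y) = (G \<circ> (f \<circ> q)) y"
      using covering_space_lift[OF cov convex_imp_simply_connected[OF cT] convex_imp_locally_path_connected[OF cT] c]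
      by metis
    have fl: "flips (singular_face 2 k f) \<longleftrightarrow> m (H (r 0)) \<noteq> m (H (r 1))"
      if r: "continuous_on {0..1} r" "\<And>s. s \<in> {0..1} \<Longrightarrow> r s \<in> T" "\<And>s. s \<in> {0..1} \<Longrightarrow> simplical_face k (seg s) = q (r s)" for k r
    proof (rule flips_iff)
      show "islift (singular_face 2 k f) (\<lambda>s. H (r s))"
        unfolding islift_def
      proof (intro conjI ballI)
        show "continuous_on {0..1} (\<lambda>s. H (r s))"
          by (rule continuous_on_compose2[OF H(1) r(1)]) (use r in auto)
        show "(\<lambda>s. H (r s)) \<in> {0..1} \<rightarrow> C" using H r by auto
        fix s :: real assume s: "s \<in> {0..1}"
        then show "p (H (r s)) = G (singular_face 2 k f (seg s))"
          using H(3)[OF r(2)[OF s]] r(3)[OF s] seg[OF s] by (simp add: singular_face_def)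
      qed
    qed
    have 0: "flips (singular_face 2 0 f) \<longleftrightarrow> m (H (1,0)) \<noteq> m (H (0,1))"
    proof -
      have "flips (singular_face 2 0 f) \<longleftrightarrow> m (H ((\<lambda>s. (1-s,s)) 0)) \<noteq> m (H ((\<lambda>s. (1-s,s)) 1))"
        by (rule fl) (auto simp: T_def q_def seg_def simplical_face_def fun_eq_iff intro!: continuous_intros)
      then show ?thesis by simp
    qed
    have 1: "flips (singular_face 2 1 f) \<longleftrightarrow> m (H (0,0)) \<noteq> m (H (0,1))"
    proof -
      have "flips (singular_face 2 1 f) \<longleftrightarrow> m (H ((\<lambda>s. (0,s)) 0)) \<noteq> m (H ((\<lambda>s. (0,s)) 1))"
        by (rule fl) (auto simp: T_def q_def seg_def simplical_face_def fun_eq_iff intro!: continuous_intros)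
      then show ?thesis by simp
    qed
    have 2: "flips (singular_face 2 2 f) \<longleftrightarrow> m (H (0,0)) \<noteq> m (H (1,0))"
    proof -
      have "flips (singular_face 2 2 f) \<longleftrightarrow> m (H ((\<lambda>s. (s,0)) 0)) \<noteq> m (H ((\<lambda>s. (s,0)) 1))"
        by (rule fl) (auto simp: T_def q_def seg_def simplical_face_def fun_eq_iff intro!: continuous_intros)
      then show ?thesis by simp
    qed
    have "chain_boundary 2 (frag_of f) =
        frag_of (singular_face 2 0 f) - frag_of (singular_face 2 1 f) + frag_of (singular_face 2 2 f)"
      by (simp add: chain_boundary_of numeral_2_eq_2)
    \<comment> \<open>Each corner lies on two edges, so the three comparisons of marks cancel modulo
      2, whatever the signs in the boundary.\<close>
    then show ?thesis
      by (simp add: cnt_add cnt_diff cnt_of 0 1[simplified] 2)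
  qed
  have even: "even (cnt (chain_boundary 2 d))" if "singular_chain 2 Z d" for d
    using that unfolding singular_chain_def
  proof (induction d rule: frag_induction)
    case zero then show ?case by (simp add: cnt_def)
  next
    case (one x) then show ?case using simplex by simp
  next
    case (diff a b) then show ?case by (simp add: chain_boundary_diff cnt_diff)
  qed
  define c where "c = restrict (\<lambda>x. \<gamma> (x 1)) (standard_simplex 1)"
  have csimp: "singular_simplex 1 Z c"
  proof -
    have "continuous_map (subtopology (powertop_real UNIV) (standard_simplex 1)) euclideanreal (\<lambda>x. x 1)"
      by (rule continuous_map_from_subtopology[OF continuous_map_product_projection[of _ UNIV "\<lambda>i. euclideanreal"]]) simp
    then have "continuous_map (subtopology (powertop_real UNIV) (standard_simplex 1)) (top_of_set {0..1}) (\<lambda>x. x 1)"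
      by (auto simp: continuous_map_in_subtopology standard_simplex_def)
    from continuous_map_compose[OF this \<gamma>(1)]
    show ?thesis
      by (auto simp: singular_simplex_def c_def o_def elim: continuous_map_eq)
  qed
  \<comment> \<open>Both faces are the base point of the loop, so this single edge is a
    cycle.\<close>
  have "singular_face 1 0 c = singular_face 1 1 c"
    using \<gamma>(2)
    by (auto simp: singular_face_def c_def fun_eq_iff standard_simplex_0 simplical_face_def standard_simplex_def restrict_def numeral_eq_Suc)
  then have "chain_boundary 1 (frag_of c) = 0"
    by (simp add: chain_boundary_of)
  then have "singular_relcycle 1 Z {} (frag_of c)"
    using csimp by (simp add: singular_cycle singular_chain_of)
  then have "singular_relboundary 1 Z {} (frag_of c)"
    using trivial_homology_imp_boundary[of 1 Z] triv by simp
  then obtain d where "singular_chain 2 Z d" "chain_boundary 2 d = frag_of c"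
    by (auto simp: singular_boundary numeral_2_eq_2)
  then have "even (cnt (frag_of c))" using even by metis
  then have nf: "\<not> flips c" by (auto simp: cnt_of split: if_splits)
  have "islift c t"
    using t seg by (auto simp: islift_def c_def seg_def)
  then have "m (t 0) = m (t 1)" using nf flips_iff by blast
  moreover have "p (t 0) = p (t 1)" "t 0 \<in> C" "t 1 \<in> C"
    using t \<gamma>(2) by auto
  ultimately show ?thesis using m_two by blast
qed

section \<open>Branch points have no charts\<close>

text \<open>The vanishing of homology concerns complements in a whole Euclidean space, so the target
  of a chart is shrunk to an open box that is itself a copy of Euclidean space.\<close>

lemma Euclidean_ball_embedding:
  assumes V: "openin (Euclidean_space d) V" and v: "v \<in> V"
  obtains w where "continuous_map (Euclidean_space d) (Euclidean_space d) w"
    "inj_on w (topspace (Euclidean_space d))" "w ` topspace (Euclidean_space d) \<subseteq> V"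
    "openin (Euclidean_space d) (w ` topspace (Euclidean_space d))" "v \<in> w ` topspace (Euclidean_space d)"
proof -
  obtain V' where V': "openin (powertop_real UNIV) V'" "V = V' \<inter> {x. \<forall>i\<ge>d. x i = 0}"
    using V unfolding Euclidean_space_def openin_subtopology by blast
  then obtain U where U: "finite {i. U i \<noteq> UNIV}" "\<And>i. open (U i)" "v \<in> PiE UNIV U" "PiE UNIV U \<subseteq> V'"
    using v by (auto simp: openin_product_topology_alt)
  have "\<exists>e>0. \<forall>y. \<bar>y - v i\<bar> < e \<longrightarrow> y \<in> U i" for i
  proof -
    have "v i \<in> U i" using U(3) by auto
    then show ?thesis
      using U(2)[of i] unfolding open_dist dist_real_def by blast
  qed
  then obtain e where e: "\<And>i. e i > 0" "\<And>i y. \<bar>y - v i\<bar> < e i \<Longrightarrow> y \<in> U i" by metis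
  \<comment> \<open>The function \<open>r / (1 + \<bar>r\<bar>)\<close> maps the line injectively
    into (-1,1); scaled by \<open>e i\<close> and centred at \<open>v i\<close> it stays inside
    \<open>U i\<close>.\<close>
  define w :: "(nat \<Rightarrow> real) \<Rightarrow> nat \<Rightarrow> real"
    where "w z = (\<lambda>i. if i < d then v i + e i * (z i / (1 + \<bar>z i\<bar>)) else 0)" for z
  have lt1: "\<bar>r / (1 + \<bar>r\<bar>)\<bar> < 1" for r :: real by (simp add: abs_divide divide_less_eq)
  have vtop: "v \<in> topspace (Euclidean_space d)" using V v openin_subset by blast
  have cw: "continuous_map (Euclidean_space d) (Euclidean_space d) w"
    unfolding w_def continuous_map_componentwise_Euclidean_space
    by (auto intro!: continuous_intros continuous_map_Euclidean_space_projection continuous_map_real_divide)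
  have injw: "inj_on w (topspace (Euclidean_space d))"
  proof (rule inj_onI)
    fix x y assume xy: "x \<in> topspace (Euclidean_space d)" "y \<in> topspace (Euclidean_space d)" "w x = w y"
    have "x i = y i" for i
    proof (cases "i < d")
      case True
      then have "x i / (1 + \<bar>x i\<bar>) = y i / (1 + \<bar>y i\<bar>)"
        using fun_cong[OF xy(3), of i] e(1)[of i] by (simp add: w_def del: times_divide_eq_right)
      moreover have "r = (r / (1 + \<bar>r\<bar>)) / (1 - \<bar>r / (1 + \<bar>r\<bar>)\<bar>)" for r :: real
      proof -
        have "1 - \<bar>r / (1 + \<bar>r\<bar>)\<bar> = 1 / (1 + \<bar>r\<bar>)" by (simp add: abs_divide field_simps)
        then show ?thesis by simp
      qed
      ultimately show ?thesis by metis
    next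
      case False
      then show ?thesis using xy by (simp add: topspace_Euclidean_space)
    qed
    then show "x = y" by blast
  qed
  show thesis
  proof (rule that[OF cw injw])
    show "w ` topspace (Euclidean_space d) \<subseteq> V"
    proof clarify
      fix z assume z: "z \<in> topspace (Euclidean_space d)"
      have "w z i \<in> U i" for i
      proof (cases "i < d")
        case True
        have "\<bar>e i * (z i / (1 + \<bar>z i\<bar>))\<bar> < e i"
          using lt1[of "z i"] e(1)[of i] by (simp add: abs_mult del: times_divide_eq_right)
        then show ?thesis using True e(2) by (simp add: w_def)
      next
        case False
        then show ?thesis using e(1)[of i] e(2)[of 0 i] vtop by (simp add: w_def topspace_Euclidean_space)
      qed
      then have "w z \<in> V'" using U(4) by auto
      then show "w z \<in> V" using V' by (simp add: w_def)
    qed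
    show "openin (Euclidean_space d) (w ` topspace (Euclidean_space d))"
      by (rule invariance_of_domain_Euclidean_space) (use cw injw in auto)
    have "w (\<lambda>_. 0) = v" using vtop by (auto simp: w_def topspace_Euclidean_space)
    then show "v \<in> w ` topspace (Euclidean_space d)"
      by (intro image_eqI[of _ _ "\<lambda>_. 0"]) (auto simp: topspace_Euclidean_space)
  qed
qed

text \<open>Off the branch set \<open>S\<close> the chart carries a double cover, and near \<open>q\<close> some loop
  lifts to a path that is not closed. As \<open>S\<close> injects into a space of codimension at least 3,
  this contradicts the vanishing of the first homology of its complement.\<close>
lemma no_chart_at_branch_point:
  fixes p :: "'a::real_normed_vector \<Rightarrow> 'b::real_normed_vector" and Q :: "'q topology"
  assumes cov: "covering_space C p B"
    and two: "\<And>x y z. \<lbrakk>x \<in> C; y \<in> C; z \<in> C; p x = p y; p y = p z\<rbrakk> \<Longrightarrow> x = y \<or> y = z \<or> x = z"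
    and U: "openin Q U" "q \<in> U" and V: "openin (Euclidean_space d) V"
    and hom: "subtopology Q U homeomorphic_space subtopology (Euclidean_space d) V"
    and N: "continuous_map (subtopology Q U) euclidean N" "\<And>x. x \<in> U - S \<Longrightarrow> N x \<in> B"
    and S: "closedin (subtopology Q U) S"
    and f: "continuous_map (subtopology Q S) (Euclidean_space m) f" "inj_on f S" "m + 3 \<le> d"
    and loop: "\<And>W. openin Q W \<Longrightarrow> q \<in> W \<Longrightarrow> W \<subseteq> U \<Longrightarrow>
       \<exists>\<gamma> t. continuous_map (top_of_set {0..1::real}) (subtopology Q (W - S)) \<gamma> \<and> \<gamma> 0 = \<gamma> 1 \<and>
         continuous_on {0..1} t \<and> t \<in> {0..1} \<rightarrow> C \<and> (\<forall>s\<in>{0..1}. p (t s) = N (\<gamma> s)) \<and> t 0 \<noteq> t 1"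
  shows False
proof -
  let ?E = "Euclidean_space d"
  obtain h k where hk: "homeomorphic_maps (subtopology Q U) (subtopology ?E V) h k"
    using hom unfolding homeomorphic_space_def by blast
  have topU: "topspace (subtopology Q U) = U" using openin_subset[OF U(1)] by auto
  have topV: "topspace (subtopology ?E V) = V" using openin_subset[OF V] by auto
  have h: "continuous_map (subtopology Q U) (subtopology ?E V) h" "\<And>x. x \<in> U \<Longrightarrow> k (h x) = x"
    and k: "continuous_map (subtopology ?E V) (subtopology Q U) k" "\<And>x. x \<in> V \<Longrightarrow> h (k x) = x"
    using hk unfolding homeomorphic_maps_def topU topV by auto
  have hU: "h x \<in> V" if "x \<in> U" for x
    using continuous_map_funspace[OF h(1)] that unfolding topU topV by auto
  have kV: "k x \<in> U" if "x \<in> V" for x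
    using continuous_map_funspace[OF k(1)] that unfolding topU topV by auto
  obtain w where w: "continuous_map ?E ?E w" "inj_on w (topspace ?E)" "w ` topspace ?E \<subseteq> V"
    "openin ?E (w ` topspace ?E)" "h q \<in> w ` topspace ?E"
    using Euclidean_ball_embedding[OF V hU[OF U(2)]] by blast
  define u where "u = inv_into (topspace ?E) w"
  have uw: "u (w z) = z" if "z \<in> topspace ?E" for z
    using that w(2) by (simp add: u_def)
  have wu: "w (u y) = y" "u y \<in> topspace ?E" if "y \<in> w ` topspace ?E" for y
    using that by (auto simp: u_def f_inv_into_f inv_into_into)
  have wV: "continuous_map ?E (subtopology ?E V) w"
    using w by (auto simp: continuous_map_in_subtopology)
  have cu: "continuous_map (subtopology ?E (w ` topspace ?E)) ?E u"
  proof -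
    have "embedding_map ?E ?E w"
      using invariance_of_domain_Euclidean_space_embedding_map[of d "topspace ?E" w] w by simp
    then have "homeomorphic_map ?E (subtopology ?E (w ` topspace ?E)) w"
      by (simp add: embedding_map_def)
    then obtain g where g: "homeomorphic_maps ?E (subtopology ?E (w ` topspace ?E)) w g"
      using homeomorphic_map_maps by blast
    then have "continuous_map (subtopology ?E (w ` topspace ?E)) ?E g"
      by (simp add: homeomorphic_maps_def)
    then show ?thesis
    proof (rule continuous_map_eq)
      fix y assume "y \<in> topspace (subtopology ?E (w ` topspace ?E))"
      then show "g y = u y"
        using g uw by (force simp: homeomorphic_maps_def)
    qed
  qed
  \<comment> \<open>An inverse chart on all of Euclidean space, so that the branch set pulls back to
    a closed subset of it.\<close>
  define j where "j = k \<circ> w"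
  have j: "continuous_map ?E (subtopology Q U) j"
    unfolding j_def by (rule continuous_map_compose[OF wV k(1)])
  have injj: "inj_on j (topspace ?E)"
    using w(2,3) k(2) unfolding j_def by (intro inj_onI) (metis comp_apply image_subset_iff inj_onD)
  have jU: "j z \<in> U" if "z \<in> topspace ?E" for z using that w kV by (auto simp: j_def)
  define W where "W = j ` topspace ?E"
  have W: "openin Q W" "q \<in> W" "W \<subseteq> U"
  proof -
    have "W = {x \<in> topspace (subtopology Q U). h x \<in> w ` topspace ?E}"
    proof -
      have "x \<in> W" if x: "x \<in> U" "h x \<in> w ` topspace ?E" for x
      proof -
        obtain z where "z \<in> topspace ?E" "h x = w z" using x(2) by blast
        then have "j z = x" using h(2)[OF x(1)] by (simp add: j_def)
        then show ?thesis using \<open>z \<in> topspace ?E\<close> unfolding W_def by blast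
      qed
      moreover have "x \<in> U \<and> h x \<in> w ` topspace ?E" if "x \<in> W" for x
        using that jU k(2) w(3) unfolding W_def j_def by (auto simp: image_subset_iff)
      ultimately show ?thesis unfolding topU by blast
    qed
    moreover have "openin (subtopology Q U) {x \<in> topspace (subtopology Q U). h x \<in> w ` topspace ?E}"
      using openin_continuous_map_preimage[OF h(1)] w(3,4) by (simp add: openin_open_subtopology V)
    ultimately show "openin Q W" using U(1) by (simp add: openin_open_subtopology)
    show "W \<subseteq> U" using jU by (auto simp: W_def)
    obtain z where "z \<in> topspace ?E" "h q = w z" using w(5) by blast
    then have "j z = q" using h(2)[OF U(2)] by (simp add: j_def)
    then show "q \<in> W" using \<open>z \<in> topspace ?E\<close> unfolding W_def by blast
  qed
  define S' where "S' = {z \<in> topspace ?E. j z \<in> S}"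
  have S': "closedin ?E S'"
    unfolding S'_def by (rule closedin_continuous_map_preimage[OF j S])
  have f': "continuous_map (subtopology ?E S') (Euclidean_space m) (f \<circ> j)"
  proof (rule continuous_map_compose[OF _ f(1)])
    have "continuous_map (subtopology ?E S') Q j"
      using j by (simp add: continuous_map_from_subtopology continuous_map_in_subtopology)
    then show "continuous_map (subtopology ?E S') (subtopology Q S) j"
      by (auto simp: continuous_map_in_subtopology S'_def)
  qed
  have inj': "inj_on (f \<circ> j) S'"
    by (rule comp_inj_on[OF inj_on_subset[OF injj] inj_on_subset[OF f(2)]]) (auto simp: S'_def)
  let ?Z = "subtopology ?E (topspace ?E - S')"
  have triv: "trivial_group (homology_group 1 ?Z)"
    by (rule trivial_homology_complement_of_injection[OF S' f' inj' f(3)])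
  have G: "continuous_map ?Z (top_of_set B) (N \<circ> j)"
  proof -
    have "continuous_map ?Z euclidean (N \<circ> j)"
      by (rule continuous_map_compose[OF continuous_map_from_subtopology[OF j] N(1)])
    moreover have "(N \<circ> j) z \<in> B" if "z \<in> topspace ?E - S'" for z
      using that N(2) jU by (auto simp: S'_def)
    ultimately show ?thesis by (auto simp: continuous_map_in_subtopology)
  qed
  obtain \<gamma> t where \<gamma>: "continuous_map (top_of_set {0..1::real}) (subtopology Q (W - S)) \<gamma>" "\<gamma> 0 = \<gamma> 1"
    and t: "continuous_on {0..1} t" "t \<in> {0..1} \<rightarrow> C" "\<And>s. s \<in> {0..1} \<Longrightarrow> p (t s) = N (\<gamma> s)" "t 0 \<noteq> t 1"
    using loop[OF W] by blast
  have \<gamma>W: "\<gamma> s \<in> W - S" if "s \<in> {0..1}" for s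
    using continuous_map_funspace[OF \<gamma>(1)] that by auto
  have ju: "j (u (h x)) = x" "u (h x) \<in> topspace ?E" "h x \<in> w ` topspace ?E" if x: "x \<in> W" for x
  proof -
    obtain z where z: "z \<in> topspace ?E" "x = k (w z)" using x by (auto simp: W_def j_def)
    then have "h x = w z" using k(2) w(3) by auto
    then show "j (u (h x)) = x" "u (h x) \<in> topspace ?E" "h x \<in> w ` topspace ?E"
      using z uw by (auto simp: j_def)
  qed
  have \<gamma>': "continuous_map (top_of_set {0..1::real}) ?Z (u \<circ> (h \<circ> \<gamma>))"
  proof -
    have "continuous_map (top_of_set {0..1::real}) (subtopology Q U) \<gamma>"
      using \<gamma>(1) W(3) by (auto simp: continuous_map_in_subtopology)
    then have "continuous_map (top_of_set {0..1::real}) (subtopology ?E V) (h \<circ> \<gamma>)"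
      using h(1) continuous_map_compose by blast
    then have "continuous_map (top_of_set {0..1::real}) (subtopology ?E (w ` topspace ?E)) (h \<circ> \<gamma>)"
      using ju(3) \<gamma>W by (auto simp: continuous_map_in_subtopology)
    then have "continuous_map (top_of_set {0..1::real}) ?E (u \<circ> (h \<circ> \<gamma>))"
      using cu continuous_map_compose by blast
    moreover have "u (h (\<gamma> s)) \<in> topspace ?E - S'" if "s \<in> {0..1}" for s
      using ju[of "\<gamma> s"] \<gamma>W[OF that] by (auto simp: S'_def)
    ultimately show ?thesis by (auto simp: continuous_map_in_subtopology)
  qed
  have "t 0 = t 1"
    by (rule double_cover_lift_closed[OF cov two triv G \<gamma>' _ t(1,2)])
      (use \<gamma>(2) t(3) ju(1) \<gamma>W in auto)
  then show False using t(4) by blast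
qed

section \<open>The quotient by reversing a set of coordinates\<close>

definition flip :: "'n set \<Rightarrow> real^'n \<Rightarrow> real^'n" where
  "flip J x = (\<chi> k. if k \<in> J then - x$k else x$k)"

text \<open>The products of the coordinates in \<open>J\<close>, together with the other coordinates, embed the quotient
  by the involution \<open>flip J\<close> in a space of matrices.\<close>
definition sqmat :: "'n set \<Rightarrow> real^'n \<Rightarrow> real^'n^'n" where
  "sqmat J x = (\<chi> i j. if i \<in> J \<and> j \<in> J then x$i * x$j else if i = j then x$i else 0)"

lemma sqmat_nth: "sqmat J x $ i $ j = (if i \<in> J \<and> j \<in> J then x$i * x$j else if i = j then x$i else 0)"
  by (simp add: sqmat_def)

lemma sqmat_flip [simp]: "sqmat J (flip J x) = sqmat J x"
  by (simp add: sqmat_def flip_def vec_eq_iff)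

text \<open>A nonzero coordinate in \<open>J\<close> is known up to sign from its square, and its
  products with the other coordinates in \<open>J\<close> pass this one sign on to all of
  them.\<close>

lemma sqmat_eqD:
  assumes eq: "sqmat J x = sqmat J y"
  shows "y = x \<or> y = flip J x"
proof -
  have nJ: "x$k = y$k" if "k \<notin> J" for k
    using arg_cong[OF eq, of "\<lambda>M. M$k$k"] that by (simp add: sqmat_nth)
  have J: "x$i * x$k = y$i * y$k" if "i \<in> J" "k \<in> J" for i k
    using arg_cong[OF eq, of "\<lambda>M. M$i$k"] that by (simp add: sqmat_nth)
  show ?thesis
  proof (cases "\<exists>i\<in>J. x$i \<noteq> 0")
    case True
    then obtain i where i: "i \<in> J" "x$i \<noteq> 0" by blast
    have "y$i = x$i \<or> y$i = - x$i" using J[OF i(1) i(1)] by (metis square_eq_iff)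
    then show ?thesis
    proof
      assume y: "y$i = x$i"
      have "y$k = x$k" for k
      proof (cases "k \<in> J")
        case True
        have "x$i * (x$k - y$k) = 0" using J[OF i(1) True] y by (simp add: right_diff_distrib)
        then show ?thesis using i(2) by simp
      qed (simp add: nJ)
      then show ?thesis by (simp add: vec_eq_iff)
    next
      assume y: "y$i = - x$i"
      have "y$k = - x$k" if "k \<in> J" for k
      proof -
        have "x$i * x$k = - (x$i * y$k)" using J[OF i(1) that] y by simp
        then have "x$i * (x$k + y$k) = 0" by (simp add: distrib_left)
        then show ?thesis using i(2) by simp
      qed
      then show ?thesis using nJ by (simp add: vec_eq_iff flip_def)
    qed
  next
    case False
    have "y$k = x$k" for k
    proof (cases "k \<in> J")
      case True
      then show ?thesis using J[of k k] False by simp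
    qed (simp add: nJ)
    then show ?thesis by (simp add: vec_eq_iff)
  qed
qed

lemma continuous_on_sqmat: "continuous_on S (sqmat J)"
proof -
  have "continuous_on S (\<lambda>x. if i \<in> J \<and> j \<in> J then x$i * x$j else if i = j then x$i else 0)" for i j
    by (cases "i \<in> J \<and> j \<in> J"; cases "i = j") (auto intro!: continuous_intros)
  then show ?thesis
    unfolding sqmat_def by (auto intro!: continuous_on_vec_lambda)
qed

text \<open>Where the diagonal entry of some \<open>i\<close> in \<open>J\<close> is nonzero, the
  sign of coordinate \<open>i\<close> separates the two sheets.\<close>

lemma covering_space_sqmat:
  fixes J :: "'n::finite set"
  defines "C \<equiv> {x::real^'n. \<exists>i\<in>J. x$i \<noteq> 0}"
  shows "covering_space C (sqmat J) (sqmat J ` C)"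
proof
  show "continuous_on C (sqmat J)" by (rule continuous_on_sqmat)
  fix b assume "b \<in> sqmat J ` C"
  then obtain x i where x: "x \<in> C" "b = sqmat J x" "i \<in> J" "x$i \<noteq> 0"
    by (auto simp: C_def)
  define T where "T = {M \<in> sqmat J ` C. M$i$i \<noteq> 0}"
  define u where "u e = {y::real^'n. e * y$i > 0}" for e :: real
  \<comment> \<open>On \<open>J\<close>, row \<open>i\<close> of the matrix is \<open>x$i\<close>
    times \<open>x\<close>; dividing by the root of the diagonal entry and multiplying by
    \<open>e\<close> recovers the preimage whose coordinate \<open>i\<close> has sign
    \<open>e\<close>.\<close>
  define q :: "real \<Rightarrow> real^'n^'n \<Rightarrow> real^'n"
    where "q e M = (\<chi> k. if k \<in> J then e * M$i$k / sqrt (M$i$i) else M$k$k)" for e M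
  have T: "M \<in> T \<longleftrightarrow> (\<exists>y. M = sqmat J y \<and> y$i \<noteq> 0)" for M
    using x(3) by (auto simp: T_def C_def sqmat_nth)
  have u: "openin (top_of_set C) (u e)" if "e \<in> {1,-1}" for e
  proof -
    have "open (u e)" unfolding u_def by (intro open_Collect_less continuous_intros)
    moreover have "u e \<subseteq> C" using x(3) by (force simp: u_def C_def)
    ultimately show ?thesis by (simp add: open_subset)
  qed
  have hom: "homeomorphism (u e) T (sqmat J) (q e)" if e: "e \<in> {1,-1}" for e
  proof -
    have qs: "q e (sqmat J y) = y" if "y \<in> u e" for y
    proof -
      have "y$i \<noteq> 0" "\<bar>y$i\<bar> = e * y$i" using that e by (auto simp: u_def)
      then show ?thesis
        using e x(3) by (auto simp: q_def vec_eq_iff sqmat_nth)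
    qed
    have im: "\<exists>y\<in>u e. M = sqmat J y" if M: "M \<in> T" for M
    proof -
      obtain y where y: "M = sqmat J y" "y$i \<noteq> 0" using M T by blast
      have "y \<in> u e \<or> flip J y \<in> u e"
        using y(2) e x(3) by (auto simp: u_def flip_def)
      then show ?thesis using y(1) sqmat_flip by metis
    qed
    have uT: "sqmat J y \<in> T" if "y \<in> u e" for y
      using that T by (auto simp: u_def)
    have qc: "continuous_on T (q e)"
    proof -
      have "continuous_on T (\<lambda>M. if k \<in> J then e * M$i$k / sqrt (M$i$i) else M$k$k)" for k
        by (cases "k \<in> J") (auto simp: T_def intro!: continuous_intros)
      then show ?thesis unfolding q_def by (auto intro!: continuous_on_vec_lambda)
    qed
    show ?thesis
      unfolding homeomorphism_def
    proof (intro conjI ballI)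
      show "sqmat J ` u e = T" using im uT by blast
      show "q e ` T = u e" 
      proof (intro subset_antisym subsetI)
        fix y assume "y \<in> q e ` T" then show "y \<in> u e" using im qs by fastforce
      next
        fix y assume "y \<in> u e" then show "y \<in> q e ` T" using qs uT by (intro image_eqI[of _ _ "sqmat J y"]) auto
      qed
      show "sqmat J (q e y) = y" if "y \<in> T" for y using im[OF that] qs by auto
    qed (use qs qc continuous_on_sqmat in auto)
  qed
  show "\<exists>T. b \<in> T \<and> openin (top_of_set (sqmat J ` C)) T \<and>
           (\<exists>v. \<Union>v = C \<inter> sqmat J -` T \<and> (\<forall>u\<in>v. openin (top_of_set C) u) \<and>
                pairwise disjnt v \<and> (\<forall>u\<in>v. \<exists>q. homeomorphism u T (sqmat J) q))"
  proof (intro exI[of _ T] conjI exI[of _ "{u 1, u (-1)}"])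
    show "b \<in> T" using x T by blast
    have "open {M::real^'n^'n. M$i$i \<noteq> 0}"
      by (intro open_Collect_neq continuous_intros)
    then show "openin (top_of_set (sqmat J ` C)) T"
      unfolding T_def by (metis (no_types) Collect_conj_eq Collect_mem_eq openin_open_Int)
    show "\<Union> {u 1, u (-1)} = C \<inter> sqmat J -` T"
    proof -
      have "y \<in> C \<and> sqmat J y \<in> T" if "y$i \<noteq> 0" for y
        using T that x(3) by (auto simp: C_def intro!: bexI[of _ i])
      moreover have "y$i \<noteq> 0" if "sqmat J y \<in> T" for y
        using that x(3) by (auto simp: T_def sqmat_nth)
      ultimately have "C \<inter> sqmat J -` T = {y. y$i \<noteq> 0}" by blast
      moreover have "\<Union> {u 1, u (-1)} = {y. y$i \<noteq> 0}" by (auto simp: u_def)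
      ultimately show ?thesis by simp
    qed
    show "pairwise disjnt {u 1, u (-1)}"
      by (auto simp: pairwise_def disjnt_def u_def)
    show "\<forall>w\<in>{u 1, u (-1)}. openin (top_of_set C) w" using u by simp
    show "\<forall>w\<in>{u 1, u (-1)}. \<exists>q. homeomorphism w T (sqmat J) q"
      using hom[of 1] hom[of "-1"] by blast
  qed
qed simp

section \<open>The action of the walls\<close>

type_synonym 'n bmat = "'n \<Rightarrow> 'n \<Rightarrow> bool"

text \<open>\<open>-1\<close> to the power of the entry in column \<open>k\<close> of the sum of the rows \<open>g\<close> of \<open>A + I\<close>.\<close>
definition sg :: "'n bmat \<Rightarrow> 'n set \<Rightarrow> 'n \<Rightarrow> real" where
  "sg A g k = (\<Prod>i\<in>g. if i = k \<or> A i k then -1 else 1)"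

definition act :: "'n::finite bmat \<Rightarrow> 'n set \<Rightarrow> real^'n \<Rightarrow> real^'n" where
  "act A g x = (\<chi> k. sg A g k * x$k)"

definition walls :: "real^'n \<Rightarrow> 'n set" where
  "walls x = {i. \<bar>x$i\<bar> = 1/4}"

lemma sg_empty [simp]: "sg A {} k = 1"
  by (simp add: sg_def)

lemma sg_cases: "sg A g k = 1 \<or> sg A g k = -1"
  unfolding sg_def by (induction g rule: infinite_finite_induct) auto

lemma sg_mult_self [simp]: "sg A g k * sg A g k = 1" "sg A g k * (sg A g k * r) = r"
  using sg_cases[of A g k] by auto

lemma sg_neq_0 [simp]: "sg A g k \<noteq> 0"
  using sg_cases[of A g k] by auto

lemma abs_sg [simp]: "\<bar>sg A g k\<bar> = 1"
  using sg_cases[of A g k] by auto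

lemma sg_Un:
  fixes g :: "'n::finite set"
  assumes "g \<inter> h = {}"
  shows "sg A (g \<union> h) k = sg A g k * sg A h k"
  unfolding sg_def by (rule prod.union_disjoint) (use assms in auto)

lemma sg_symdiff:
  fixes g :: "'n::finite set"
  shows "sg A (sym_diff g h) k = sg A g k * sg A h k"
proof -
  have "sg A g k = sg A (g - h) k * sg A (g \<inter> h) k"
  proof -
    have "g = (g - h) \<union> (g \<inter> h)" "(g - h) \<inter> (g \<inter> h) = {}" by blast+
    then show ?thesis using sg_Un[of "g - h" "g \<inter> h" A k] by simp
  qed
  moreover have "sg A h k = sg A (h - g) k * sg A (g \<inter> h) k"
  proof -
    have "h = (h - g) \<union> (g \<inter> h)" "(h - g) \<inter> (g \<inter> h) = {}" by blast+
    then show ?thesis using sg_Un[of "h - g" "g \<inter> h" A k] by simp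
  qed
  moreover have "sg A (sym_diff g h) k = sg A (g - h) k * sg A (h - g) k"
    by (rule sg_Un) auto
  ultimately show ?thesis by (simp add: mult.left_commute mult.assoc)
qed

lemma act_nth [simp]: "act A g x $ k = sg A g k * x $ k"
  by (simp add: act_def)

lemma act_empty [simp]: "act A {} x = x"
  by (simp add: vec_eq_iff)

lemma act_act: "act A g (act A h x) = act A (sym_diff g h) x"
  by (simp add: vec_eq_iff sg_symdiff mult.assoc)

lemma act_self [simp]: "act A g (act A g x) = x"
  by (simp add: vec_eq_iff)

lemma abs_act_nth: "\<bar>act A g x $ k\<bar> = \<bar>x $ k\<bar>"
  by (simp add: abs_mult)

lemma walls_act [simp]: "walls (act A g x) = walls x"
  by (simp add: walls_def abs_mult)

lemma cube_iff: "x \<in> cube \<longleftrightarrow> (\<forall>k. \<bar>x$k\<bar> \<le> 1/4)"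
  unfolding cube_def mem_Collect_eq by (rule iff_allI) linarith

lemma act_in_cube [simp]: "act A g x \<in> cube \<longleftrightarrow> x \<in> cube"
  by (simp add: cube_iff abs_mult)

lemma continuous_on_act [continuous_intros]: "continuous_on S f \<Longrightarrow> continuous_on S (\<lambda>x. act A g (f x))"
  unfolding act_def by (intro continuous_intros)

lemma dist_act: "dist (act A g x) (act A g y) = dist x y"
proof -
  have "sg A g k * x$k - sg A g k * y$k = sg A g k * (x$k - y$k)" for k
    by (simp add: right_diff_distrib)
  then show ?thesis
    by (simp add: dist_norm norm_vec_def abs_mult L2_set_def power_mult_distrib power2_eq_square flip: mult.assoc)
qed

lemma tau_eq_act: "tau A j = act A {fst j}"
  by (auto simp: fun_eq_iff vec_eq_iff tau_def sg_def)

lemma facet_walls: "x \<in> facet j \<Longrightarrow> x \<in> cube \<and> fst j \<in> walls x"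
  by (auto simp: facet_def walls_def split: if_splits)

lemma in_facetI: "x \<in> cube \<Longrightarrow> i \<in> walls x \<Longrightarrow> x \<in> facet (i, x$i > 0)"
  by (auto simp: facet_def walls_def abs_if split: if_splits)

lemma seal_step_iff:
  assumes "x \<in> cube"
  shows "seal_step A x y \<longleftrightarrow> (\<exists>i\<in>walls x. y = act A {i} x)"
  unfolding seal_step_def tau_eq_act using assms facet_walls in_facetI by fastforce

text \<open>Reflections in walls keep all absolute values, hence the set of walls. They commute and
  are involutions, so a chain of steps collapses to the set of walls used an odd number of
  times.\<close>

lemma seal_rel_iff:
  assumes x: "x \<in> cube"
  shows "seal_rel A x y \<longleftrightarrow> (\<exists>g \<subseteq> walls x. y = act A g x)"
proof
  assume "seal_rel A x y"
  then show "\<exists>g \<subseteq> walls x. y = act A g x"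
    unfolding seal_rel_def
  proof (induction rule: rtranclp_induct)
    case base
    then show ?case by (metis act_empty empty_subsetI)
  next
    case (step y z)
    then obtain g where g: "g \<subseteq> walls x" "y = act A g x" by blast
    then have y: "y \<in> cube" "walls y = walls x" using x by auto
    obtain i where i: "i \<in> walls x" "z = act A {i} y"
    proof (cases "seal_step A y z")
      case True
      then show ?thesis using that y seal_step_iff[OF y(1)] by auto
    next
      case False
      then have zy: "seal_step A z y" using step by blast
      then have "z \<in> cube" using facet_walls by (auto simp: seal_step_def)
      then obtain i where "i \<in> walls z" "y = act A {i} z" using zy seal_step_iff by blast
      then show ?thesis using that y by auto
    qed
    then have "z = act A (sym_diff {i} g) x" using g by (simp add: act_act)
    moreover have "sym_diff {i} g \<subseteq> walls x" using g i by auto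
    ultimately show ?case by blast
  qed
next
  assume "\<exists>g \<subseteq> walls x. y = act A g x"
  then obtain g where g: "g \<subseteq> walls x" "y = act A g x" by blast
  have "seal_rel A x (act A g x)"
    using finite[of g] g(1)
  proof (induction g rule: finite_induct)
    case empty
    then show ?case by (simp add: seal_rel_def)
  next
    case (insert i g)
    have "act A (insert i g) x = act A {i} (act A g x)"
      using insert(2) by (simp add: act_act insert_Diff_if)
    then have "seal_step A (act A g x) (act A (insert i g) x)"
      using seal_step_iff[of "act A g x"] x insert by auto
    moreover have "seal_rel A x (act A g x)" using insert by auto
    ultimately show ?case
      unfolding seal_rel_def by (metis (mono_tags, lifting) rtranclp.simps)
  qed
  then show "seal_rel A x y" using g by simp
qed

text \<open>Exactly the nonempty \<open>h\<close> for which \<open>act A h\<close> fixes the point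
  with 1/4 on \<open>h\<close> and 0 elsewhere. In a strong structure such an action has to be the
  identity.\<close>

definition null :: "'n bmat \<Rightarrow> 'n set \<Rightarrow> bool" where
  "null A h \<longleftrightarrow> h \<noteq> {} \<and> (\<forall>j\<in>h. sg A h j = 1)"

lemma not_null_singleton: "\<not> null A {i}"
  by (simp add: null_def sg_def)

definition proj :: "'n::finite bmat \<Rightarrow> real^'n \<Rightarrow> (real^'n) set" where
  "proj A = eq_class (top_of_set cube) (seal_rel A)"

lemma proj_eq_iff:
  assumes "x \<in> cube" "y \<in> cube"
  shows "proj A x = proj A y \<longleftrightarrow> seal_rel A x y"
proof -
  have "symp (seal_rel A)"
    unfolding seal_rel_def by (rule symp_rtranclp) (auto simp: symp_def)
  moreover have "transp (seal_rel A)"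
    by (simp add: seal_rel_def transp_rtranclp)
  moreover have "seal_rel A y y"
    by (simp add: seal_rel_def)
  ultimately show ?thesis
    using assms unfolding proj_def eq_class_def by (auto dest: sympD transpD)
qed

text \<open>Stated for an arbitrary map \<open>q\<close>, so that it serves both the classes of
  \<open>quotient_top\<close> and the coded classes of \<open>qspace\<close>.\<close>

lemma quotient_map_quotient_top:
  "quotient_map X (topology (\<lambda>U. U \<subseteq> q ` topspace X \<and> openin X {x \<in> topspace X. q x \<in> U})) q"
proof -
  let ?L = "\<lambda>U. U \<subseteq> q ` topspace X \<and> openin X {x \<in> topspace X. q x \<in> U}"
  have "?L (S \<inter> T)" if "?L S" "?L T" for S T
  proof -
    have "{x \<in> topspace X. q x \<in> S \<inter> T} = {x \<in> topspace X. q x \<in> S} \<inter> {x \<in> topspace X. q x \<in> T}"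
      by auto
    then show ?thesis using that by (metis (no_types, lifting) le_infI1 openin_Int)
  qed
  moreover have "?L (\<Union>\<K>)" if K: "\<forall>K\<in>\<K>. ?L K" for \<K>
  proof -
    have "{x \<in> topspace X. q x \<in> \<Union>\<K>} = (\<Union>K\<in>\<K>. {x \<in> topspace X. q x \<in> K})"
      by auto
    then show ?thesis using K by (auto intro!: openin_Union)
  qed
  ultimately have L: "istopology ?L" unfolding istopology_def by blast
  have "{x \<in> topspace X. q x \<in> q ` topspace X} = topspace X" by auto
  then have "?L (q ` topspace X)" by simp
  then have "openin (topology ?L) (q ` topspace X)"
    by (simp add: topology_inverse'[OF L])
  moreover have "U \<subseteq> q ` topspace X" if "openin (topology ?L) U" for U
    using that by (simp add: topology_inverse'[OF L])
  ultimately have "topspace (topology ?L) = q ` topspace X"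
    by (meson openin_subset openin_topspace subset_antisym)
  then show ?thesis
    unfolding quotient_map_def topology_inverse'[OF L] by auto
qed

lemma quotient_map_proj: "quotient_map (top_of_set cube) (seal_space A) (proj A)"
  unfolding seal_space_def quotient_top_def proj_def by (rule quotient_map_quotient_top)

section \<open>Strongness\<close>

definition same_row :: "'n bmat \<Rightarrow> 'n \<Rightarrow> 'n \<Rightarrow> bool" where
  "same_row A i j \<longleftrightarrow> (\<forall>k. (i = k \<or> A i k) = (j = k \<or> A j k))"

text \<open>The combinatorial form in which the manifold hypothesis is used: both conclusions of the
  theorem are derived from \<open>tame A\<close>.\<close>

definition tame :: "'n bmat \<Rightarrow> bool" where
  "tame A \<longleftrightarrow> (\<forall>h. null A h \<longrightarrow> (\<exists>i\<in>h. \<exists>j\<in>h. i \<noteq> j \<and> same_row A i j))"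

lemma sg_card:
  fixes g :: "'n::finite set"
  shows "sg A g k = (-1) ^ card {i\<in>g. i = k \<or> A i k}"
  unfolding sg_def by (simp add: prod.If_cases Int_def)

lemma sg_pair: "i \<noteq> j \<Longrightarrow> sg A {i,j} k = 1 \<longleftrightarrow> (i = k \<or> A i k) = (j = k \<or> A j k)"
  by (simp add: sg_def)

text \<open>A wall reverses its own coordinate, so a null set has at least two elements. With at
  most two branch coordinates a minimal one is a pair with no reversed coordinate outside it, which
  says that the two rows agree.\<close>

lemma tame_if_minimal_null_small:
  fixes A :: "'n::finite bmat"
  assumes small: "\<And>h. null A h \<Longrightarrow> (\<And>g. g \<subset> h \<Longrightarrow> \<not> null A g) \<Longrightarrow> card (h \<union> {k. sg A h k = -1}) \<le> 2"
  shows "tame A"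
  unfolding tame_def
proof (intro allI impI)
  fix h0 assume "null A h0"
  then obtain h where h: "null A h" "h \<subseteq> h0" and min: "\<And>g. g \<subset> h \<Longrightarrow> \<not> null A g"
    using finite_has_minimal2[of "{h. null A h}" h0] by (auto simp: psubset_eq)
  define J where "J = h \<union> {k. sg A h k = -1}"
  have J: "card J \<le> 2" unfolding J_def by (rule small[OF h(1) min])
  have "card h \<noteq> 0" using h(1) by (auto simp: null_def)
  moreover have "card h \<noteq> 1" using h(1) not_null_singleton by (metis card_1_singletonE)
  ultimately have h2: "2 \<le> card h" by linarith
  have "h \<subseteq> J" by (auto simp: J_def)
  then have eq: "J = h" "card h = 2"
    using J h2 card_mono[of J h] card_subset_eq[of J h] by auto
  then obtain i j where ij: "h = {i,j}" "i \<noteq> j" by (meson card_2_iff)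
  have "sg A h k = 1" for k
    using sg_cases[of A h k] h(1) eq(1) by (auto simp: null_def J_def)
  then show "\<exists>i\<in>h0. \<exists>j\<in>h0. i \<noteq> j \<and> same_row A i j"
    using ij h(2) sg_pair[OF ij(2)] by (intro bexI[of _ i] bexI[of _ j]) (auto simp: same_row_def)
qed

text \<open>Two equal rows cancel in the sum, so removing such a pair leaves a smaller set that is
  empty or again null.\<close>

lemma null_imp_trivial:
  fixes A :: "'n::finite bmat"
  assumes tame: "tame A"
  shows "null A h \<Longrightarrow> sg A h k = 1"
proof (induction "card h" arbitrary: h rule: less_induct)
  case less
  obtain i j where ij: "i \<in> h" "j \<in> h" "i \<noteq> j" "same_row A i j"
    using tame less.prems unfolding tame_def by blast
  have split: "sg A h l = sg A (h - {i,j}) l" for l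
  proof -
    have "h = (h - {i,j}) \<union> {i,j}" using ij by auto
    then have "sg A h l = sg A (h - {i,j}) l * sg A {i,j} l"
      using sg_Un[of "h - {i,j}" "{i,j}" A l] by auto
    moreover have "sg A {i,j} l = 1" using sg_pair[OF ij(3)] ij(4) by (simp add: same_row_def)
    ultimately show ?thesis by simp
  qed
  show ?case
  proof (cases "h - {i,j} = {}")
    case True
    show ?thesis using split[of k] unfolding True by simp
  next
    case False
    then have "null A (h - {i,j})"
      using less.prems split by (auto simp: null_def)
    moreover have "card (h - {i,j}) < card h"
      using ij by (intro psubset_card_mono) auto
    ultimately show ?thesis using less.hyps split by simp
  qed
qed

lemma trivial_on_self_imp_trivial:
  fixes A :: "'n::finite bmat"
  assumes "tame A" "\<And>j. j \<in> h \<Longrightarrow> sg A h j = 1"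
  shows "sg A h k = 1"
  using null_imp_trivial[OF assms(1), of h k] assms(2) by (cases "h = {}") (auto simp: null_def)

text \<open>Otherwise a minimal set without sink is a directed cycle without chords, which is a null set.\<close>
lemma sink_exists:
  fixes A :: "'n::finite bmat"
  assumes tame: "tame A" and D: "D \<noteq> {}"
  shows "\<exists>i\<in>D. \<forall>j\<in>D. i = j \<or> A i j \<longrightarrow> same_row A i j"
proof (rule ccontr)
  define R where "R i k \<longleftrightarrow> i = k \<or> A i k" for i k
  define N where "N D \<longleftrightarrow> D \<noteq> {} \<and> (\<forall>i\<in>D. \<exists>j\<in>D. R i j \<and> R i \<noteq> R j)" for D
  have same: "same_row A i j \<longleftrightarrow> R i = R j" for i j
    by (auto simp: same_row_def R_def fun_eq_iff)
  assume "\<not> ?thesis"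
  then have "N D" using D unfolding N_def same R_def[symmetric] by blast
  then obtain D where ND: "N D" and min: "\<And>D'. D' \<subseteq> D \<Longrightarrow> N D' \<Longrightarrow> D' = D"
    using finite_has_minimal2[of "{D. N D}" D] by (metis finite_class.finite mem_Collect_eq)
  define succ where "succ f \<longleftrightarrow> (\<forall>i\<in>D. f i \<in> D \<and> R i (f i) \<and> R i \<noteq> R (f i))" for f
  have succ: "f ` D = D" "inj_on f D" if f: "succ f" for f
  proof -
    \<comment> \<open>The image of a choice of successors again has no sink, so minimality makes
      every such choice a permutation of \<open>D\<close>.\<close>
    have "N (f ` D)" using ND f unfolding N_def succ_def by blast
    then show "f ` D = D" using min f unfolding succ_def by blast
    then show "inj_on f D" by (simp add: finite_surj_inj)
  qed
  obtain f where f: "succ f" using ND unfolding N_def succ_def by metis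
  \<comment> \<open>Rerouting \<open>i\<close> to another successor \<open>j\<close> gives a
    permutation too. It attains the old value \<open>f i\<close> at some \<open>l\<close> other than
    \<open>i\<close>, where it agrees with \<open>f\<close>, against injectivity of
    \<open>f\<close>.\<close>
  have uniq: "j = f i" if "i \<in> D" "j \<in> D" "R i j" "R i \<noteq> R j" for i j
  proof (rule ccontr)
    assume ne: "j \<noteq> f i"
    have "succ (f(i := j))" using f that by (auto simp: succ_def)
    then have "(f(i := j)) ` D = D" by (rule succ)
    moreover have "f i \<in> D" using f that by (auto simp: succ_def)
    ultimately obtain l where l: "l \<in> D" "f i = (f(i := j)) l" by blast
    then have "l \<noteq> i" "f l = f i" using ne by (auto split: if_splits)
    then show False using succ(2)[OF f] l(1) that(1) by (auto dest: inj_onD)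
  qed
  \<comment> \<open>Equal rows have the same successors, so injectivity of \<open>f\<close> forbids
    two of them.\<close>
  have rows: "i = j" if "i \<in> D" "j \<in> D" "R i = R j" for i j
  proof -
    have "f i = f j" using uniq[of j "f i"] f that by (auto simp: succ_def)
    then show ?thesis using succ(2)[OF f] that by (auto dest: inj_onD)
  qed
  have "sg A D j = 1" if j: "j \<in> D" for j
  proof -
    have "j \<in> f ` D" using succ(1)[OF f] j by simp
    then obtain l where l: "l \<in> D" "f l = j" by blast
    have "l \<noteq> j" "R l j" using f l by (auto simp: succ_def)
    \<comment> \<open>Within \<open>D\<close>, column \<open>j\<close> contains just the diagonal
      entry and the entry of the predecessor of \<open>j\<close>, so its sum is even.\<close>
    have "{i\<in>D. R i j} = {j, l}"
    proof (intro Set.set_eqI iffI)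
      fix i assume "i \<in> {i\<in>D. R i j}"
      then have i: "i \<in> D" "R i j" by auto
      show "i \<in> {j,l}"
      proof (cases "R i = R j")
        case True then show ?thesis using rows[OF i(1) j] by simp
      next
        case False
        then have "f i = f l" using uniq[OF i(1) j i(2)] l by simp
        then show ?thesis using succ(2)[OF f] l(1) i(1) by (auto dest: inj_onD)
      qed
    next
      fix i assume "i \<in> {j,l}"
      then show "i \<in> {i\<in>D. R i j}" using j l \<open>R l j\<close> by (auto simp: R_def)
    qed
    then show ?thesis using \<open>l \<noteq> j\<close> by (simp add: sg_card flip: R_def)
  qed
  then have "null A D" using ND by (auto simp: null_def N_def)
  then obtain i j where "i \<in> D" "j \<in> D" "i \<noteq> j" "R i = R j"
    using tame unfolding tame_def same by blast
  then show False using rows by blast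
qed

section \<open>Valid compositions as sets of walls\<close>

fun parity :: "('n \<times> bool) list \<Rightarrow> 'n set" where
  "parity [] = {}"
| "parity (k # ks) = sym_diff (parity ks) {fst k}"

text \<open>Both facets of one coordinate carry the same linear map, so only the coordinates crossed
  an odd number of times matter.\<close>

lemma comp_tau_eq_act: "comp_tau A ks = act A (parity ks)"
  by (induction ks) (auto simp: fun_eq_iff act_act tau_eq_act)

lemma facet_act_preimage:
  assumes "act A g ` f \<subseteq> facet (i, b)" "f \<subseteq> cube"
  shows "\<exists>b'. f \<subseteq> facet (i, b')"
proof (cases "sg A g i = 1")
  case True
  then have "f \<subseteq> facet (i, b)" using assms by (auto simp: facet_def image_subset_iff)
  then show ?thesis by blast
next
  case False
  then have "sg A g i = -1" using sg_cases[of A g i] by simp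
  have "x \<in> facet (i, \<not> b)" if "x \<in> f" for x
  proof -
    have "act A g x \<in> facet (i, b)" "x \<in> cube" using assms that by auto
    then show ?thesis using \<open>sg A g i = -1\<close> by (auto simp: facet_def split: if_splits)
  qed
  then have "f \<subseteq> facet (i, \<not> b)" by blast
  then show ?thesis by blast
qed

text \<open>Only signs change along a valid composition, so a face that lies in a facet of
  coordinate \<open>i\<close> at a later stage lay in one from the start.\<close>

lemma parity_facet:
  assumes "valid_comp A f ks" "f \<subseteq> cube" "i \<in> parity ks"
  shows "\<exists>b. f \<subseteq> facet (i, b)"
  using assms
proof (induction ks arbitrary: f)
  case (Cons k ks)
  show ?case
  proof (cases "i = fst k")
    case True
    then show ?thesis using Cons.prems by (metis prod.collapse valid_comp.simps(2))
  next
    case False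
    then have "i \<in> parity ks" using Cons.prems by auto
    moreover have "tau A k ` f \<subseteq> cube" using Cons.prems by (auto simp: tau_eq_act)
    ultimately obtain b where "tau A k ` f \<subseteq> facet (i, b)"
      using Cons.IH[of "tau A k ` f"] Cons.prems(1) by auto
    then show ?thesis using facet_act_preimage Cons.prems(2) unfolding tau_eq_act by blast
  qed
qed simp

text \<open>Provides the uniqueness behind the \<open>THE\<close> in \<open>Psi\<close>: a facet of
  another coordinate is determined by its trace on \<open>facet k\<close>.\<close>

lemma facet_point:
  fixes k j :: "'n::finite \<times> bool"
  assumes "fst k \<noteq> fst j" "facet G \<inter> facet k = facet j \<inter> facet k"
  shows "G = j"
proof -
  \<comment> \<open>\<open>p True\<close> is the centre of the intersection of the facets
    \<open>j\<close> and \<open>k\<close>, \<open>p False\<close> the centre of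
    \<open>facet k\<close>; they differ in the coordinate of \<open>j\<close> only.\<close>
  define p :: "bool \<Rightarrow> real^'n" where
    "p b = (\<chi> l. if l = fst k then (if snd k then 1/4 else -(1/4))
                 else if b \<and> l = fst j then (if snd j then 1/4 else -(1/4)) else 0)" for b
  have p: "p b \<in> cube" for b by (auto simp: p_def cube_iff)
  have "p True \<in> facet j \<inter> facet k" "p False \<notin> facet j" "p False \<in> facet k"
    using assms(1) p by (auto simp: facet_def p_def)
  then have G: "p True \<in> facet G" "p False \<notin> facet G" using assms(2) by blast+
  have "fst G = fst j"
  proof (rule ccontr)
    assume "fst G \<noteq> fst j"
    then have "p True $ fst G = p False $ fst G" by (simp add: p_def)
    then show False using G p by (simp add: facet_def)
  qed
  moreover have "snd G = snd j"
    using G(1) calculation assms(1) by (auto simp: facet_def p_def split: if_splits)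
  ultimately show ?thesis by (simp add: prod_eq_iff)
qed

text \<open>Turns \<open>Psi\<close> into a sign rule. On the coordinate of \<open>k\<close> itself
  the nonempty face forces the label to be \<open>k\<close>, which is negated in accordance with the
  sign -1 of a wall on its own coordinate.\<close>

lemma Psi_eq:
  assumes f: "f \<noteq> {}" "f \<subseteq> facet k" "f \<subseteq> facet (j, b)"
  shows "Psi A k (j, b) = (j, b = (sg A {fst k} j = 1))"
proof (cases "j = fst k")
  case True
  obtain x where "x \<in> f" using f(1) by blast
  then have "x \<in> facet k" "x \<in> facet (j, b)" using f by auto
  then have "b = snd k" using True by (auto simp: facet_def split: if_splits)
  then show ?thesis using True by (auto simp: Psi_def neg_label_def sg_def prod_eq_iff)
next
  case False
  let ?G = "(j, b = (sg A {fst k} j = 1))"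
  have eq: "facet ?G \<inter> facet (neg_label k) = tau A k ` (facet (j, b) \<inter> facet k)"
  proof -
    have *: "act A {fst k} y \<in> facet ?G \<inter> facet (neg_label k)" if "y \<in> facet (j, b) \<inter> facet k" for y
      using that sg_cases[of A "{fst k}" j] by (auto simp: facet_def neg_label_def sg_def split: if_splits)
    have **: "act A {fst k} y \<in> facet (j, b) \<inter> facet k" if "y \<in> facet ?G \<inter> facet (neg_label k)" for y
      using that sg_cases[of A "{fst k}" j] by (auto simp: facet_def neg_label_def sg_def split: if_splits)
    have "y \<in> tau A k ` (facet (j, b) \<inter> facet k)" if "y \<in> facet ?G \<inter> facet (neg_label k)" for y
      using **[OF that] by (intro image_eqI[of _ _ "act A {fst k} y"]) (auto simp: tau_eq_act)
    then show ?thesis using * by (auto simp: tau_eq_act)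
  qed
  have "(THE G. facet G \<inter> facet (neg_label k) = tau A k ` (facet (j, b) \<inter> facet k)) = ?G"
  proof (rule the_equality, rule eq)
    fix G assume "facet G \<inter> facet (neg_label k) = tau A k ` (facet (j, b) \<inter> facet k)"
    then show "G = ?G" unfolding eq[symmetric] using False by (intro facet_point[of "neg_label k"]) (auto simp: neg_label_def)
  qed
  then show ?thesis using False by (auto simp: Psi_def)
qed

lemma comp_Psi_eq:
  assumes "valid_comp A f ks" "f \<noteq> {}" "f \<subseteq> facet (j, b)"
  shows "comp_Psi A ks (j, b) = (j, b = (sg A (parity ks) j = 1))"
  using assms
proof (induction ks arbitrary: f b)
  case (Cons k ks)
  let ?b = "b = (sg A {fst k} j = 1)"
  have "tau A k ` f \<subseteq> facet (j, ?b)"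
    using Cons.prems(3) sg_cases[of A "{fst k}" j] by (auto simp: facet_def tau_eq_act image_subset_iff)
  then have "comp_Psi A ks (j, ?b) = (j, ?b = (sg A (parity ks) j = 1))"
    using Cons.IH[of "tau A k ` f" ?b] Cons.prems by auto
  moreover have "Psi A k (j, b) = (j, ?b)"
    using Psi_eq[of f k j b A] Cons.prems by simp
  moreover have "sg A (parity (k # ks)) j = sg A (parity ks) j * sg A {fst k} j"
    by (simp only: parity.simps sg_symdiff)
  ultimately show ?case
    using sg_cases[of A "{fst k}" j] sg_cases[of A "parity ks" j] by auto
qed simp

text \<open>The walls in which two compositions differ all contain \<open>f\<close>, and on their
  coordinates both must give the same sign, because the image faces agree. The difference is
  therefore trivial on itself, hence trivial everywhere by tameness, and it affects neither points
  nor labels.\<close>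

lemma tame_imp_strong_pairing:
  fixes A :: "'n::finite bmat"
  assumes "tame A"
  shows "strong_pairing A"
  unfolding strong_pairing_def
proof (intro allI impI, elim conjE)
  fix f ks ks'
  assume f: "proper_face f" and v: "valid_comp A f ks" "valid_comp A f ks'"
    and im: "comp_tau A ks ` f = comp_tau A ks' ` f"
  have fc: "f \<subseteq> cube" "f \<noteq> {}" using f by (auto simp: proper_face_def face_of_def)
  obtain x where x: "x \<in> f" using fc by blast
  have "sg A (sym_diff (parity ks) (parity ks')) i = 1"
    if i: "i \<in> sym_diff (parity ks) (parity ks')" for i
  proof -
    obtain b where b: "f \<subseteq> facet (i, b)"
      using i parity_facet[OF v(1) fc(1)] parity_facet[OF v(2) fc(1)] by blast
    \<comment> \<open>Only the images of \<open>f\<close> as sets are known to agree, but coordinate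
      \<open>i\<close> is constant and nonzero on \<open>f\<close>, so any \<open>y\<close> in
      \<open>f\<close> reveals the sign.\<close>
    have "act A (parity ks) x \<in> act A (parity ks') ` f"
      using im x unfolding comp_tau_eq_act by blast
    then obtain y where y: "y \<in> f" "act A (parity ks) x = act A (parity ks') y" by blast
    have "x \<in> facet (i, b)" "y \<in> facet (i, b)" using b x y(1) by auto
    then have "x$i = y$i" "x$i \<noteq> 0" by (auto simp: facet_def split: if_splits)
    moreover have "sg A (parity ks) i * x$i = sg A (parity ks') i * y$i"
      using arg_cong[OF y(2), of "\<lambda>z. z$i"] by simp
    ultimately have "sg A (parity ks) i = sg A (parity ks') i" by simp
    then show ?thesis by (simp add: sg_symdiff)
  qed
  then have "sg A (sym_diff (parity ks) (parity ks')) k = 1" for k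
    by (rule trivial_on_self_imp_trivial[OF assms])
  then have eq: "sg A (parity ks) k = sg A (parity ks') k" for k
    using sg_cases[of A "parity ks" k] sg_cases[of A "parity ks'" k] unfolding sg_symdiff
    by (metis mult.left_neutral mult.right_neutral)
  have "comp_tau A ks x = comp_tau A ks' x" for x
    by (simp add: comp_tau_eq_act vec_eq_iff eq)
  moreover have "comp_Psi A ks F = comp_Psi A ks' F" if "F \<in> Xi f" for F
  proof -
    have "f \<subseteq> facet (fst F, snd F)" using that by (simp add: Xi_def)
    from comp_Psi_eq[OF v(1) fc(2) this] comp_Psi_eq[OF v(2) fc(2) this] show ?thesis
      by (simp add: eq)
  qed
  ultimately show "(\<forall>x\<in>f. comp_tau A ks x = comp_tau A ks' x) \<and> (\<forall>F\<in>Xi f. comp_Psi A ks F = comp_Psi A ks' F)"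
    by blast
qed

section \<open>Seal spaces that are manifolds\<close>

lemma proj_eqE:
  assumes "proj A x = proj A y" "x \<in> cube" "y \<in> cube"
  obtains g where "g \<subseteq> walls x" "y = act A g x"
  using assms proj_eq_iff[OF assms(2,3), of A] seal_rel_iff[OF assms(2), of A y] by auto

lemma proj_act [simp]:
  assumes "x \<in> cube" "g \<subseteq> walls x"
  shows "proj A (act A g x) = proj A x"
  using assms proj_eq_iff[of x "act A g x" A] seal_rel_iff[of x A "act A g x"] by auto

section \<open>Comparing dimensions\<close>

lemma openin_Euclidean_space_subspace:
  assumes "openin (Euclidean_space n) G" "G \<subseteq> topspace (Euclidean_space d)" "d < n"
  shows "G = {}"
proof (rule ccontr)
  assume "G \<noteq> {}"
  then obtain v where v: "v \<in> G" by blast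
  have v0: "v d = 0" "\<And>i. i \<ge> n \<Longrightarrow> v i = 0" using v assms by (auto simp: topspace_Euclidean_space)
  \<comment> \<open>The line through \<open>v\<close> in the direction of coordinate
    \<open>d\<close>; it would meet the open set \<open>G\<close> in a single point.\<close>
  define \<phi> :: "real \<Rightarrow> nat \<Rightarrow> real" where "\<phi> s = (\<lambda>i. if i < n then (if i = d then s else v i) else 0)" for s
  have "continuous_map euclideanreal (Euclidean_space n) \<phi>"
    unfolding \<phi>_def continuous_map_componentwise_Euclidean_space
  proof (intro allI impI)
    fix i show "continuous_map euclideanreal euclideanreal (\<lambda>x. if i = d then x else v i)"
      by (cases "i = d") auto
  qed
  from openin_continuous_map_preimage[OF this assms(1)]
  have "open {s. \<phi> s \<in> G}" by simp
  moreover have "{s. \<phi> s \<in> G} = {0}"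
  proof -
    have "s = 0" if "\<phi> s \<in> G" for s
    proof -
      have "\<phi> s d = 0" using that assms(2) by (auto simp: topspace_Euclidean_space)
      then show ?thesis using assms(3) by (simp add: \<phi>_def)
    qed
    moreover have "\<phi> 0 = v" using v0 by (auto simp: \<phi>_def fun_eq_iff)
    ultimately show ?thesis using v by auto
  qed
  ultimately show False using not_open_singleton[of "0::real"] by simp
qed

lemma continuous_map_Euclidean_space_mono:
  assumes "continuous_map X (Euclidean_space d) g" "d \<le> n"
  shows "continuous_map X (Euclidean_space n) g"
proof -
  have "continuous_map X (powertop_real UNIV) g" "g \<in> topspace X \<rightarrow> {x. \<forall>i\<ge>d. x i = 0}"
    using assms(1) by (auto simp: Euclidean_space_def continuous_map_in_subtopology)
  then show ?thesis
    using assms(2) by (auto simp: Euclidean_space_def continuous_map_in_subtopology Pi_iff)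
qed

text \<open>If \<open>d\<close> were smaller, the injection could be read as a map into the space of
  the full dimension, where invariance of domain makes its image open although it lies in a proper
  coordinate subspace.\<close>

lemma open_injection_dim_le:
  fixes O' :: "'a::euclidean_space set"
  assumes "open O'" "O' \<noteq> {}" "continuous_map (top_of_set O') (Euclidean_space d) g" "inj_on g O'"
  shows "DIM('a) \<le> d"
proof (rule ccontr)
  assume "\<not> DIM('a) \<le> d"
  then have dn: "d < DIM('a)" by simp
  let ?E = "Euclidean_space (DIM('a))"
  obtain f :: "(nat \<Rightarrow> real) \<Rightarrow> 'a" and f' where f: "homeomorphic_maps ?E euclidean f f'"
    using homeomorphic_maps_Euclidean_space_euclidean by blast
  have cf: "continuous_map ?E euclidean f" "\<And>x. x \<in> topspace ?E \<Longrightarrow> f' (f x) = x"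
    "\<And>y. f (f' y) = y" "\<And>y. f' y \<in> topspace ?E"
    using f by (auto simp: homeomorphic_maps_def continuous_map_def)
  define U where "U = {z \<in> topspace ?E. f z \<in> O'}"
  have U: "openin ?E U"
    unfolding U_def by (rule openin_continuous_map_preimage[OF cf(1)]) (use assms in simp)
  have "continuous_map (subtopology ?E U) (top_of_set O') f"
    using cf(1) by (auto simp: continuous_map_in_subtopology U_def continuous_map_from_subtopology)
  then have gf: "continuous_map (subtopology ?E U) (Euclidean_space d) (g \<circ> f)"
    using assms(3) continuous_map_compose by blast
  have inj: "inj_on (g \<circ> f) U"
    by (rule comp_inj_on) (use cf(2) assms(4) in \<open>auto simp: U_def intro!: inj_on_inverseI[of _ f'] elim: inj_on_subset\<close>)
  have "continuous_map (subtopology ?E U) ?E (g \<circ> f)"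
    using continuous_map_Euclidean_space_mono[OF gf] dn by simp
  then have "openin ?E ((g \<circ> f) ` U)"
    using invariance_of_domain_Euclidean_space[OF U _ inj] by blast
  moreover have "(g \<circ> f) ` U \<subseteq> topspace (Euclidean_space d)"
    using continuous_map_image_subset_topspace[OF gf] openin_subset[OF U] by auto
  ultimately have "(g \<circ> f) ` U = {}"
    using openin_Euclidean_space_subspace dn by blast
  moreover obtain y where "y \<in> O'" using assms(2) by blast
  then have "f' y \<in> U" using cf by (simp add: U_def)
  ultimately show False by blast
qed

lemma chart_restrict:
  assumes U: "openin X U" and V: "openin E V"
    and hom: "subtopology X U homeomorphic_space subtopology E V"
    and U1: "openin X U1" "U1 \<subseteq> U"
  obtains V1 where "openin E V1" "subtopology X U1 homeomorphic_space subtopology E V1"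
proof -
  obtain h where h: "homeomorphic_map (subtopology X U) (subtopology E V) h"
    using hom homeomorphic_space by blast
  have top: "topspace (subtopology X U) = U" using openin_subset[OF U] by auto
  have "openin (subtopology X U) U1" using U1 U by (simp add: openin_open_subtopology)
  then have "openin (subtopology E V) (h ` U1)"
    using homeomorphic_imp_open_map[OF h] by (simp add: open_map_def)
  then have V1: "openin E (h ` U1)" "h ` U1 \<subseteq> V" using V by (simp_all add: openin_open_subtopology)
  have "homeomorphic_map (subtopology (subtopology X U) U1) (subtopology (subtopology E V) (h ` U1)) h"
  proof (rule homeomorphic_map_subtopologies_alt[OF h])
    fix x assume "x \<in> topspace (subtopology X U)"
    then show "h x \<in> h ` U1 \<longleftrightarrow> x \<in> U1"
      using homeomorphic_imp_injective_map[OF h] U1(2) inj_on_image_mem_iff[of h U x U1]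
      unfolding top by blast
  qed
  then have "subtopology X U1 homeomorphic_space subtopology E (h ` U1)"
    using U1(2) V1(2) by (simp add: subtopology_subtopology Int_absorb1 homeomorphic_map_imp_homeomorphic_space)
  then show thesis using that V1(1) by blast
qed

text \<open>Around the point with coordinates \<open>1/4\<close> on \<open>h\<close> and \<open>0\<close> elsewhere the seal space unfolds:
  in the orthant indexed by \<open>g\<close> the coordinates below are the depths behind the walls in \<open>h\<close>,
  signed by membership in \<open>g\<close>, and the remaining coordinates moved by \<open>g\<close>.\<close>
definition unfold_at :: "'n::finite bmat \<Rightarrow> 'n set \<Rightarrow> 'n set \<Rightarrow> real^'n \<Rightarrow> real^'n" where
  "unfold_at A h g y = (\<chi> i. if i \<in> h then (if i \<in> g then -1 else 1) * (1/4 - \<bar>y$i\<bar>) else sg A g i * y$i)"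

text \<open>The condition on \<open>h\<close> asks for the signs of \<open>act A g\<close> applied
  to the point with 1/4 on \<open>h\<close> and 0 elsewhere; all these points represent the same
  point of the seal space.\<close>

definition orthant :: "'n::finite bmat \<Rightarrow> 'n set \<Rightarrow> 'n set \<Rightarrow> (real^'n) set" where
  "orthant A h g = {y \<in> cube. (\<forall>i\<in>h. sg A g i * y$i > 0) \<and> (\<forall>k. k \<notin> h \<longrightarrow> \<bar>y$k\<bar> < 1/4)}"

text \<open>The coordinates that change sign when a point near the branch point is unfolded through
  \<open>h - g\<close> instead of \<open>g\<close>.\<close>

definition branch_coords :: "'n::finite bmat \<Rightarrow> 'n set \<Rightarrow> 'n set" where
  "branch_coords A h = h \<union> {k. sg A h k = -1}"

lemma openin_orthant: "openin (top_of_set cube) (orthant A h g)"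
proof -
  let ?O = "(\<Inter>i\<in>h. {y::real^'a. sg A g i * y$i > 0}) \<inter> (\<Inter>k\<in>-h. {y. \<bar>y$k\<bar> < 1/4})"
  have "open ?O" by (auto intro!: open_Int open_INT open_Collect_less continuous_intros)
  then have "openin (top_of_set cube) (cube \<inter> ?O)" by (rule openin_open_Int)
  also have "cube \<inter> ?O = orthant A h g" by (auto simp: orthant_def)
  finally show ?thesis .
qed

text \<open>Minimality enters here: on a common point the signs of both actions agree along
  \<open>h\<close>, so the symmetric difference is empty or null, and a null one can only be
  \<open>h\<close>.\<close>

lemma orthant_cases:
  assumes min: "\<And>g. g \<subset> h \<Longrightarrow> \<not> null A g"
    and y: "y \<in> orthant A h g" "y \<in> orthant A h g'" and g: "g \<subseteq> h" "g' \<subseteq> h"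
  shows "g' = g \<or> g' = h - g"
proof -
  let ?d = "sym_diff g g'"
  have "sg A ?d i = 1" if "i \<in> h" for i
  proof -
    have "sg A g i * y$i > 0" "sg A g' i * y$i > 0" using y that by (auto simp: orthant_def)
    then have "sg A g i = sg A g' i"
      using sg_cases[of A g i] sg_cases[of A g' i] by auto
    then show ?thesis by (simp add: sg_symdiff)
  qed
  then have "?d = {} \<or> null A ?d" using g by (auto simp: null_def)
  then have "?d = {} \<or> ?d = h" using min[of ?d] g by blast
  then show ?thesis using g by blast
qed

lemma sg_compl:
  fixes g :: "'n::finite set"
  assumes "g \<subseteq> h"
  shows "sg A (h - g) k = sg A h k * sg A g k"
  using sg_symdiff[of A h g k] assms by (simp add: Diff_eq_empty_iff[THEN iffD2])

lemma orthant_compl: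
  assumes "null A h" "g \<subseteq> h" "y \<in> orthant A h g"
  shows "y \<in> orthant A h (h - g)"
  using assms by (auto simp: orthant_def sg_compl null_def)

lemma unfold_at_compl:
  assumes "null A h" "g \<subseteq> h"
  shows "unfold_at A h (h - g) y = flip (branch_coords A h) (unfold_at A h g y)"
proof -
  have "unfold_at A h (h - g) y $ k = flip (branch_coords A h) (unfold_at A h g y) $ k" for k
    using assms sg_cases[of A h k] by (auto simp: unfold_at_def flip_def branch_coords_def sg_compl)
  then show ?thesis by (simp add: vec_eq_iff)
qed

text \<open>Unfolding is blind to the identifications: a crossed wall has depth 0, so its change of
  sign is invisible, and the other coordinates are moved back.\<close>

lemma orthant_act:
  assumes y: "y \<in> orthant A h g" and g0: "g0 \<subseteq> walls y"
  shows "g0 \<subseteq> h" "act A g0 y \<in> orthant A h (sym_diff g g0)"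
    "unfold_at A h (sym_diff g g0) (act A g0 y) = unfold_at A h g y"
proof -
  show g0h: "g0 \<subseteq> h" using y g0 by (force simp: orthant_def walls_def)
  have "sg A (sym_diff g g0) k * (sg A g0 k * r) = sg A g k * r" for k r
    unfolding sg_symdiff by (simp add: mult.assoc)
  note * = this
  show "act A g0 y \<in> orthant A h (sym_diff g g0)"
    using y by (simp add: orthant_def * abs_mult)
  have "unfold_at A h (sym_diff g g0) (act A g0 y) $ k = unfold_at A h g y $ k" for k
  proof (cases "k \<in> h")
    case True
    show ?thesis
    proof (cases "k \<in> g0")
      case True
      then have "\<bar>y$k\<bar> = 1/4" using g0 by (auto simp: walls_def)
      then show ?thesis using \<open>k \<in> h\<close> by (simp add: unfold_at_def abs_mult)
    next
      case False
      then show ?thesis using \<open>k \<in> h\<close> by (simp add: unfold_at_def abs_mult)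
    qed
  qed (simp add: unfold_at_def *)
  then show "unfold_at A h (sym_diff g g0) (act A g0 y) = unfold_at A h g y"
    by (simp add: vec_eq_iff)
qed

text \<open>Along \<open>sym_diff g g'\<close> the signed depths have opposite signs, hence vanish.
  These coordinates are thus walls, and reflecting in them carries one point to the other.\<close>

lemma unfold_at_inj:
  assumes y: "y \<in> orthant A h g" "y' \<in> orthant A h g'" and g: "g \<subseteq> h" "g' \<subseteq> h"
    and eq: "unfold_at A h g y = unfold_at A h g' y'"
  shows "seal_rel A y y'"
proof -
  let ?d = "sym_diff g g'"
  have k: "unfold_at A h g y $ k = unfold_at A h g' y' $ k" for k using eq by simp
  have le: "\<bar>y$k\<bar> \<le> 1/4" "\<bar>y'$k\<bar> \<le> 1/4" for k using y by (auto simp: orthant_def cube_iff)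
  have d: "\<bar>y$i\<bar> = 1/4 \<and> \<bar>y'$i\<bar> = 1/4" if "i \<in> ?d" for i
  proof -
    have "i \<in> h" using that g by auto
    then show ?thesis
      using k[of i] that le[of i] by (auto simp: unfold_at_def)
  qed
  have "y'$i = sg A ?d i * y$i" for i
  proof (cases "i \<in> h")
    case True
    have ab: "\<bar>y$i\<bar> = \<bar>y'$i\<bar>"
    proof (cases "i \<in> ?d")
      case True
      then show ?thesis using d[OF True] by simp
    next
      case False
      then have "(i \<in> g) = (i \<in> g')" by auto
      then show ?thesis using k[of i] \<open>i \<in> h\<close> by (auto simp: unfold_at_def split: if_splits)
    qed
    have "sg A g i * y$i > 0" "sg A g' i * y'$i > 0" using y True by (auto simp: orthant_def)
    then have "sg A g i * y$i = \<bar>y$i\<bar>" "sg A g' i * y'$i = \<bar>y'$i\<bar>"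
      using sg_cases[of A g i] sg_cases[of A g' i] by auto
    then have "sg A g' i * (sg A g' i * y'$i) = sg A g' i * (sg A g i * y$i)" using ab by simp
    then show ?thesis by (simp add: sg_symdiff mult_ac)
  next
    case False
    then have "sg A g i * y$i = sg A g' i * y'$i" using k[of i] by (simp add: unfold_at_def)
    then have "sg A g' i * (sg A g' i * y'$i) = sg A g' i * (sg A g i * y$i)" by simp
    then show ?thesis by (simp add: sg_symdiff mult_ac)
  qed
  then have "y' = act A ?d y" by (simp add: vec_eq_iff)
  moreover have "?d \<subseteq> walls y" using d by (auto simp: walls_def)
  moreover have "y \<in> cube" using y by (simp add: orthant_def)
  ultimately show ?thesis using seal_rel_iff by blast
qed

lemma continuous_on_unfold_at: "continuous_on S (unfold_at A h g)"
proof -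
  have "continuous_on S (\<lambda>y. if i \<in> h then (if i \<in> g then -1 else 1) * (1/4 - \<bar>y$i\<bar>) else sg A g i * y$i)" for i
    by (cases "i \<in> h"; cases "i \<in> g") (auto intro!: continuous_intros)
  then show ?thesis unfolding unfold_at_def by (auto intro!: continuous_on_vec_lambda)
qed

text \<open>The local formulas on the orthants glue and descend to the seal space once
  \<open>sqmat\<close> has removed the ambiguity of one flip; nothing else is forgotten, which gives
  injectivity.\<close>

lemma seal_space_unfolding:
  fixes A :: "'n::finite bmat"
  assumes h: "null A h" and min: "\<And>g. g \<subset> h \<Longrightarrow> \<not> null A g"
  defines "D \<equiv> \<Union>g\<in>Pow h. orthant A h g"
  obtains N where "openin (seal_space A) (proj A ` D)"
    "continuous_map (subtopology (seal_space A) (proj A ` D)) euclidean N"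
    "\<And>g y. g \<subseteq> h \<Longrightarrow> y \<in> orthant A h g \<Longrightarrow> N (proj A y) = sqmat (branch_coords A h) (unfold_at A h g y)"
    "inj_on N (proj A ` D)"
proof -
  let ?J = "branch_coords A h" and ?c = "top_of_set (cube :: (real^'n) set)" and ?Q = "seal_space A"
  note q = quotient_map_proj[of A]
  have Dc: "D \<subseteq> cube" by (auto simp: D_def orthant_def)
  have D: "openin ?c D" unfolding D_def by (intro openin_Union) (auto simp: openin_orthant)
  have sat: "y' \<in> D" if y: "y \<in> D" "y' \<in> cube" "proj A y = proj A y'" for y y'
  proof -
    obtain g where g: "g \<subseteq> h" "y \<in> orthant A h g" using \<open>y \<in> D\<close> by (auto simp: D_def)
    have "y \<in> cube" using \<open>y \<in> D\<close> Dc by blast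
    then obtain g0 where g0: "g0 \<subseteq> walls y" "y' = act A g0 y"
      using proj_eqE[OF y(3)] y(2) by blast
    have "sym_diff g g0 \<subseteq> h" using g(1) orthant_act(1)[OF g(2) g0(1)] by blast
    then show ?thesis
      using orthant_act(2)[OF g(2) g0(1)] g0(2) unfolding D_def by blast
  qed
  have pre: "{x \<in> topspace ?c. proj A x \<in> proj A ` D} = D"
  proof (intro Set.set_eqI iffI)
    fix x assume "x \<in> {x \<in> topspace ?c. proj A x \<in> proj A ` D}"
    then obtain y where "y \<in> D" "proj A x = proj A y" "x \<in> cube" by auto
    then show "x \<in> D" using sat[of y x] by simp
  qed (use Dc in auto)
  have U: "openin ?Q (proj A ` D)"
  proof -
    have "proj A ` D \<subseteq> topspace ?Q" using Dc quotient_imp_surjective_map[OF q] by auto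
    then have "openin ?c {x \<in> topspace ?c. proj A x \<in> proj A ` D} \<longleftrightarrow> openin ?Q (proj A ` D)"
      using q unfolding quotient_map_def by blast
    then show ?thesis using D unfolding pre by simp
  qed
  have q': "quotient_map (subtopology ?c D) (subtopology ?Q (proj A ` D)) (proj A)"
    by (rule quotient_map_restriction[OF q pre]) (use U in blast)
  have tD: "topspace (subtopology ?c D) = D" using Dc by auto
  \<comment> \<open>Overlapping orthants are equal or complementary, and complementary ones unfold
    to points exchanged by the flip.\<close>
  have wd: "sqmat ?J (unfold_at A h g y) = sqmat ?J (unfold_at A h g' y)"
    if "g \<subseteq> h" "g' \<subseteq> h" "y \<in> orthant A h g" "y \<in> orthant A h g'" for g g' y
    using orthant_cases[OF min that(3,4,1,2)] unfold_at_compl[OF h that(1)] by auto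
  have p1: "topspace (subtopology ?c D) \<subseteq> (\<Union>g\<in>Pow h. orthant A h g)" by (auto simp: D_def)
  have p2: "openin (subtopology ?c D) (orthant A h g)" if "g \<in> Pow h" for g
  proof -
    have "orthant A h g \<subseteq> D" using that unfolding D_def by blast
    then show ?thesis unfolding openin_open_subtopology[OF D] using openin_orthant by blast
  qed
  have p3: "continuous_map (subtopology (subtopology ?c D) (orthant A h g)) euclidean (\<lambda>y. sqmat ?J (unfold_at A h g y))" for g
    unfolding subtopology_subtopology continuous_map_iff_continuous
    by (rule continuous_on_compose2[OF continuous_on_sqmat[of UNIV] continuous_on_unfold_at]) simp
  have p4: "sqmat ?J (unfold_at A h g y) = sqmat ?J (unfold_at A h g' y)"
    if "g \<in> Pow h" "g' \<in> Pow h" "y \<in> topspace (subtopology ?c D) \<inter> orthant A h g \<inter> orthant A h g'" for g g' y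
    using wd[of g g' y] that by simp
  obtain n where n: "continuous_map (subtopology ?c D) euclidean n"
    "\<And>y g. g \<in> Pow h \<Longrightarrow> y \<in> topspace (subtopology ?c D) \<inter> orthant A h g \<Longrightarrow> n y = sqmat ?J (unfold_at A h g y)"
    by (rule pasting_lemma_exists[OF p1 p2 p3 p4]) blast+
  obtain N where N: "continuous_map (subtopology ?Q (proj A ` D)) euclidean N"
    "\<And>y. y \<in> topspace (subtopology ?c D) \<Longrightarrow> N (proj A y) = n y"
  proof (rule quotient_map_lift_exists[OF q' n(1)])
    fix y y' assume y: "y \<in> topspace (subtopology ?c D)" "y' \<in> topspace (subtopology ?c D)" "proj A y = proj A y'"
    then have yc: "y \<in> cube" "y' \<in> cube" "y \<in> D" using tD Dc by auto
    obtain g where g: "g \<subseteq> h" "y \<in> orthant A h g" using \<open>y \<in> D\<close> by (auto simp: D_def)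
    obtain g0 where g0: "g0 \<subseteq> walls y" "y' = act A g0 y"
      using proj_eqE[OF y(3)] yc by blast
    have "sym_diff g g0 \<subseteq> h" using g(1) orthant_act(1)[OF g(2) g0(1)] by blast
    then have "n y' = sqmat ?J (unfold_at A h (sym_diff g g0) (act A g0 y))"
      using n(2) y(2) orthant_act(2)[OF g(2) g0(1)] g0(2) by auto
    also have "\<dots> = n y"
      using n(2) y(1) g orthant_act(3)[OF g(2) g0(1)] by auto
    finally show "n y = n y'" by simp
  qed blast
  have Neq: "N (proj A y) = sqmat ?J (unfold_at A h g y)" if "g \<subseteq> h" "y \<in> orthant A h g" for g y
  proof -
    have "y \<in> D" using that by (auto simp: D_def)
    then have y: "y \<in> topspace (subtopology ?c D)" unfolding tD .
    then show ?thesis using N(2)[OF y] n(2)[of g y] that by simp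
  qed
  show thesis
  proof (rule that[OF U N(1) Neq])
    show "inj_on N (proj A ` D)"
    proof (rule inj_onI, clarify)
      fix y y' assume y: "y \<in> D" "y' \<in> D" and e: "N (proj A y) = N (proj A y')"
      obtain g where g: "g \<subseteq> h" "y \<in> orthant A h g" using y by (auto simp: D_def)
      obtain g' where g': "g' \<subseteq> h" "y' \<in> orthant A h g'" using y by (auto simp: D_def)
      have "sqmat ?J (unfold_at A h g' y') = sqmat ?J (unfold_at A h g y)"
        using e Neq[OF g] Neq[OF g'] by simp
      then have "unfold_at A h g y = unfold_at A h g' y' \<or> unfold_at A h g y = flip ?J (unfold_at A h g' y')"
        by (rule sqmat_eqD)
      then have "seal_rel A y y'"
      proof
        assume "unfold_at A h g y = unfold_at A h g' y'"
        then show ?thesis using unfold_at_inj[OF g(2) g'(2) g(1) g'(1)] by blast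
      next
        assume "unfold_at A h g y = flip ?J (unfold_at A h g' y')"
        then have "unfold_at A h g y = unfold_at A h (h - g') y'"
          using unfold_at_compl[OF h g'(1)] by simp
        then show ?thesis
          using unfold_at_inj[OF g(2) orthant_compl[OF h g'] g(1)] by blast
      qed
      then show "proj A y = proj A y'" using proj_eq_iff y Dc by blast
    qed
  qed
qed

text \<open>Every open set of the seal space contains an open piece of the interior of the cube, on
  which \<open>proj A\<close> is injective.\<close>

lemma seal_space_Euclidean_dim:
  fixes A :: "'n::finite bmat"
  assumes U: "openin (seal_space A) U" "proj A x0 \<in> U" "x0 \<in> cube"
    and V: "openin (Euclidean_space d) V"
    and hom: "subtopology (seal_space A) U homeomorphic_space subtopology (Euclidean_space d) V"
  shows "CARD('n) \<le> d"
proof -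
  let ?c = "top_of_set (cube :: (real^'n) set)"
  have cp: "continuous_map ?c (seal_space A) (proj A)"
    using quotient_map_proj quotient_imp_continuous_map by blast
  obtain h where h: "homeomorphic_map (subtopology (seal_space A) U) (subtopology (Euclidean_space d) V) h"
    using hom homeomorphic_space by blast
  have topU: "topspace (subtopology (seal_space A) U) = U" using openin_subset[OF U(1)] by auto
  have "openin ?c {x \<in> cube. proj A x \<in> U}"
    using openin_continuous_map_preimage[OF cp U(1)] by simp
  then obtain W where W: "open W" "{x \<in> cube. proj A x \<in> U} = cube \<inter> W"
    by (auto simp: openin_open)
  define P :: "(real^'n) set" where "P = (\<Inter>k. {x. \<bar>x$k\<bar> < 1/4})"
  have P: "open P" unfolding P_def by (auto intro!: open_INT open_Collect_less continuous_intros)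
  have Plt: "\<bar>x$k\<bar> < 1/4" if "x \<in> P" for x k
  proof -
    have "x \<in> {x. \<bar>x$k\<bar> < 1/4}" using that unfolding P_def by blast
    then show ?thesis by simp
  qed
  then have Pc: "P \<subseteq> cube" unfolding cube_iff subset_iff by (meson less_imp_le)
  \<comment> \<open>\<open>x0\<close> may lie on the boundary; moving it slightly towards the centre
    keeps it in \<open>W\<close> and reaches the interior.\<close>
  have "open ((\<lambda>s::real. (1 - s) *\<^sub>R x0) -` W)"
    by (intro open_vimage W(1) continuous_intros)
  moreover have "0 \<in> (\<lambda>s::real. (1 - s) *\<^sub>R x0) -` W" using U W by auto
  ultimately obtain r where r: "r > 0" "ball 0 r \<subseteq> (\<lambda>s::real. (1 - s) *\<^sub>R x0) -` W"
    using open_contains_ball by blast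
  define s where "s = min 1 (r / 2)"
  have s: "0 < s" "s \<le> 1" "s \<in> ball 0 r" using r(1) by (auto simp: s_def)
  let ?y = "(1 - s) *\<^sub>R x0"
  have "?y \<in> P"
  proof -
    have "\<bar>(1 - s) * x0$k\<bar> < 1/4" for k
    proof -
      have "\<bar>(1 - s) * x0$k\<bar> = (1 - s) * \<bar>x0$k\<bar>" using s by (simp add: abs_mult)
      also have "\<dots> \<le> (1 - s) * (1/4)" using s U(3) by (intro mult_left_mono) (auto simp: cube_iff)
      also have "\<dots> < 1/4" using s by simp
      finally show ?thesis .
    qed
    then show ?thesis by (simp add: P_def)
  qed
  moreover have "?y \<in> W" using r(2) s(3) by blast
  ultimately have ne: "P \<inter> W \<noteq> {}" by blast
  have inU: "proj A x \<in> U" if "x \<in> P \<inter> W" for x using that W(2) Pc by blast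
  have inj: "inj_on (proj A) (P \<inter> W)"
  proof (rule inj_onI)
    fix x y assume xy: "x \<in> P \<inter> W" "y \<in> P \<inter> W" "proj A x = proj A y"
    have "\<bar>x$k\<bar> \<noteq> 1/4" for k using Plt[of x k] xy(1) by auto
    then have "walls x = {}" by (simp add: walls_def)
    then show "x = y" using proj_eqE[OF xy(3)] xy Pc by auto
  qed
  have cpPW: "continuous_map (top_of_set (P \<inter> W)) (subtopology (seal_space A) U) (proj A)"
  proof -
    have "continuous_map (top_of_set (P \<inter> W)) (seal_space A) (proj A)"
    proof -
      have "subtopology ?c (P \<inter> W) = top_of_set (P \<inter> W)"
        using Pc by (simp add: subtopology_subtopology Int_absorb1 le_infI1)
      then show ?thesis using continuous_map_from_subtopology[OF cp, of "P \<inter> W"] by simp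
    qed
    then show ?thesis using inU by (auto simp: continuous_map_in_subtopology)
  qed
  have ch: "continuous_map (subtopology (seal_space A) U) (Euclidean_space d) h"
    using homeomorphic_imp_continuous_map[OF h] by (simp add: continuous_map_in_subtopology)
  have "inj_on (h \<circ> proj A) (P \<inter> W)"
    by (rule comp_inj_on[OF inj inj_on_subset[OF homeomorphic_imp_injective_map[OF h]]])
       (use inU topU in auto)
  then have "DIM(real^'n) \<le> d"
    using open_injection_dim_le[OF _ ne continuous_map_compose[OF cpPW ch]] P W(1) by blast
  then show ?thesis by simp
qed

lemma minimal_null_small:
  fixes A :: "'n::finite bmat"
  assumes man: "closed_manifold (seal_space A)"
    and h: "null A h" and min: "\<And>g. g \<subset> h \<Longrightarrow> \<not> null A g"
  shows "card (branch_coords A h) \<le> 2"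
proof (rule ccontr)
  define J where "J = branch_coords A h"
  assume "\<not> card (branch_coords A h) \<le> 2"
  then have J3: "3 \<le> card J" by (simp add: J_def)
  let ?c = "top_of_set (cube :: (real^'n) set)" and ?Q = "seal_space A"
  let ?C = "{x::real^'n. \<exists>i\<in>J. x$i \<noteq> 0}"
  have cp: "continuous_map ?c ?Q (proj A)"
    using quotient_map_proj quotient_imp_continuous_map by blast
  have hJ: "h \<subseteq> J" by (auto simp: J_def branch_coords_def)
  define D where "D = (\<Union>g\<in>Pow h. orthant A h g)"
  have Dc: "D \<subseteq> cube" by (auto simp: D_def orthant_def)
  obtain N where oD: "openin ?Q (proj A ` D)"
    and N: "continuous_map (subtopology ?Q (proj A ` D)) euclidean N"
    "\<And>g y. g \<subseteq> h \<Longrightarrow> y \<in> orthant A h g \<Longrightarrow> N (proj A y) = sqmat J (unfold_at A h g y)"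
    and injN: "inj_on N (proj A ` D)"
    using seal_space_unfolding[OF h min] unfolding D_def J_def by metis
  define x0 :: "real^'n" where "x0 = (\<chi> k. if k \<in> h then 1/4 else 0)"
  have x0: "x0 \<in> cube" "x0 \<in> orthant A h {}"
    by (auto simp: x0_def cube_iff orthant_def)
  then have x0D: "x0 \<in> D" by (auto simp: D_def)
  have "proj A x0 \<in> topspace ?Q" using oD openin_subset x0D by blast
  then obtain d U0 V0 where U0: "openin ?Q U0" "proj A x0 \<in> U0" "openin (Euclidean_space d) V0"
    "subtopology ?Q U0 homeomorphic_space subtopology (Euclidean_space d) V0"
    using man unfolding closed_manifold_def by metis
  define U where "U = U0 \<inter> proj A ` D"
  have U: "openin ?Q U" "proj A x0 \<in> U" using U0 oD x0D by (auto simp: U_def)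
  obtain V where V: "openin (Euclidean_space d) V" "subtopology ?Q U homeomorphic_space subtopology (Euclidean_space d) V"
    using chart_restrict[OF U0(1,3,4) U(1)] by (auto simp: U_def)
  have nd: "CARD('n) \<le> d" by (rule seal_space_Euclidean_dim[OF U x0(1) V])
  have NU: "continuous_map (subtopology ?Q U) euclidean N"
    using continuous_map_from_subtopology_mono[OF N(1)] by (simp add: U_def)
  have Nij: "continuous_map (subtopology ?Q U) euclideanreal (\<lambda>x. N x $ i $ j)" for i j
    using continuous_map_compose[OF NU, of euclideanreal "\<lambda>M. M $ i $ j"]
    by (simp add: o_def continuous_intros)
  \<comment> \<open>The diagonal entries on \<open>J\<close> are squares of unfolded coordinates, so
    \<open>S\<close> is the image of the fixed points of the flip.\<close>
  define S where "S = {x \<in> topspace (subtopology ?Q U). \<forall>i\<in>J. N x $ i $ i \<in> {0}}"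
  have topU: "topspace (subtopology ?Q U) = U" using openin_subset[OF U(1)] by auto
  have S: "closedin (subtopology ?Q U) S"
  proof -
    have J: "J \<noteq> {}" using J3 by auto
    then have "S = (\<Inter>i\<in>J. {x \<in> topspace (subtopology ?Q U). N x $ i $ i \<in> {0}})"
      unfolding S_def by blast
    moreover have "closedin (subtopology ?Q U) {x \<in> topspace (subtopology ?Q U). N x $ i $ i \<in> {0}}" for i
      by (rule closedin_continuous_map_preimage[OF Nij]) simp
    ultimately show ?thesis using J by (simp only:) (rule closedin_Inter, auto)
  qed
  define m where "m = card (- J)"
  have md: "m + 3 \<le> d"
    using J3 nd card_Un_disjoint[of J "- J"] by (simp add: m_def Compl_partition)
  obtain e where e: "bij_betw e {..<m} (- J)"
    using ex_bij_betw_nat_finite[of "- J"] by (auto simp: m_def atLeast0LessThan)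
  define f where "f x = (\<lambda>i. if i < m then N x $ e i $ e i else 0)" for x
  have SU: "S \<subseteq> U" by (auto simp: S_def topU)
  have f: "continuous_map (subtopology ?Q S) (Euclidean_space m) f"
    unfolding f_def continuous_map_componentwise_Euclidean_space
    using continuous_map_from_subtopology_mono[OF Nij SU] by blast
  have Uimg: "\<exists>g y. g \<subseteq> h \<and> y \<in> orthant A h g \<and> x = proj A y" if "x \<in> U" for x
    using that by (auto simp: U_def D_def)
  have injf: "inj_on f S"
  proof (rule inj_onI)
    fix x x' assume x: "x \<in> S" "x' \<in> S" "f x = f x'"
    have diag: "N z $ i $ j = (if i = j \<and> i \<notin> J then N z $ i $ i else 0)" if "z \<in> S" for z i j
    proof -
      have "z \<in> U" using that SU by blast
      then obtain g y where "g \<subseteq> h" "y \<in> orthant A h g" "z = proj A y" using Uimg by blast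
      then have z: "N z = sqmat J (unfold_at A h g y)" using N(2) by simp
      have "N z $ i $ i = 0" if "i \<in> J" for i using \<open>z \<in> S\<close> that by (auto simp: S_def)
      then have "unfold_at A h g y $ i = 0" if "i \<in> J" for i using that by (simp add: z sqmat_nth)
      then show ?thesis by (simp add: z sqmat_nth)
    qed
    have "N x $ i $ i = N x' $ i $ i" if "i \<notin> J" for i
    proof -
      have "i \<in> e ` {..<m}" using that e by (simp add: bij_betw_def)
      then obtain l where "l < m" "e l = i" by auto
      then show ?thesis using fun_cong[OF x(3), of l] by (simp add: f_def)
    qed
    then have "N x $ i $ j = N x' $ i $ j" for i j
      using diag[OF x(1), of i j] diag[OF x(2), of i j] by auto
    then have "N x = N x'" by (simp add: vec_eq_iff)
    moreover have "x \<in> proj A ` D" "x' \<in> proj A ` D" using x SU by (auto simp: U_def)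
    ultimately show "x = x'" using injN by (auto dest: inj_onD)
  qed
  have NB: "N x \<in> sqmat J ` ?C" if x: "x \<in> U - S" for x
  proof -
    obtain g y where y: "g \<subseteq> h" "y \<in> orthant A h g" "x = proj A y" using x Uimg by blast
    then have z: "N x = sqmat J (unfold_at A h g y)" using N(2) by simp
    have "x \<in> topspace (subtopology ?Q U)" "x \<notin> S" using x topU by blast+
    then obtain i where i: "i \<in> J" "N x $ i $ i \<noteq> 0" unfolding S_def by blast
    then have "unfold_at A h g y $ i \<noteq> 0" by (simp add: z sqmat_nth)
    then have "unfold_at A h g y \<in> ?C" using i(1) by blast
    then show ?thesis unfolding z by blast
  qed
  have two: "x = y \<or> y = z \<or> x = z" if "sqmat J x = sqmat J y" "sqmat J y = sqmat J z" for x y z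
    using sqmat_eqD[OF that(1)] sqmat_eqD[of J x z] that by auto
  have "card h \<noteq> 0" using h by (auto simp: null_def)
  moreover have "card h \<noteq> 1" using h not_null_singleton by (metis card_1_singletonE)
  ultimately have "\<not> card h \<le> Suc 0" by linarith
  then obtain i j where ij: "i \<in> h" "j \<in> h" "i \<noteq> j"
    using card_le_Suc0_iff_eq[of h] by auto
  have loop: "\<exists>\<gamma> t. continuous_map (top_of_set {0..1::real}) (subtopology ?Q (W - S)) \<gamma> \<and> \<gamma> 0 = \<gamma> 1 \<and>
         continuous_on {0..1} t \<and> t \<in> {0..1} \<rightarrow> ?C \<and> (\<forall>s\<in>{0..1}. sqmat J (t s) = N (\<gamma> s)) \<and> t 0 \<noteq> t 1"
    if W: "openin ?Q W" "proj A x0 \<in> W" "W \<subseteq> U" for W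
  proof -
    have nbhd: "\<exists>\<delta>>0. \<forall>y\<in>cube. dist y (act A g x0) < \<delta> \<longrightarrow> proj A y \<in> W" if "g \<subseteq> h" for g
    proof -
      have "openin ?c {y \<in> topspace ?c. proj A y \<in> W}"
        by (rule openin_continuous_map_preimage[OF cp W(1)])
      moreover have "h \<subseteq> walls x0" by (auto simp: x0_def walls_def)
      then have "proj A (act A g x0) = proj A x0" using that x0 by simp
      then have "act A g x0 \<in> {y \<in> topspace ?c. proj A y \<in> W}" using x0 W(2) by simp
      ultimately show ?thesis unfolding openin_euclidean_subtopology_iff by (metis (no_types, lifting) mem_Collect_eq)
    qed
    obtain \<delta>1 where d1: "\<delta>1 > 0" "\<And>y. y \<in> cube \<Longrightarrow> dist y (act A {} x0) < \<delta>1 \<Longrightarrow> proj A y \<in> W"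
      using nbhd[of "{}"] by auto
    obtain \<delta>2 where d2: "\<delta>2 > 0" "\<And>y. y \<in> cube \<Longrightarrow> dist y (act A {i} x0) < \<delta>2 \<Longrightarrow> proj A y \<in> W"
      using nbhd[of "{i}"] ij by auto
    \<comment> \<open>Only coordinates \<open>i\<close> and \<open>j\<close> will move, each by at
      most \<epsilon>, so twice \<epsilon> bounds the displacement; the bound 1/8 keeps the
      coordinates of \<open>z\<close> in \<open>h\<close> positive.\<close>
    define \<epsilon> where "\<epsilon> = min (1/8) (min \<delta>1 \<delta>2 / 4)"
    have \<epsilon>: "\<epsilon> > 0" "\<epsilon> \<le> 1/8" "2 * \<epsilon> < \<delta>1" "2 * \<epsilon> < \<delta>2" using d1 d2 by (auto simp: \<epsilon>_def min_def)
    \<comment> \<open>In unfolded coordinates the path is half a turn in the plane of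
      \<open>i\<close> and \<open>j\<close>: \<open>a\<close> runs from \<epsilon> to -\<epsilon>
      while \<open>b\<close> is positive in between. It avoids the branch set and joins two
      antipodal points.\<close>
    define a where "a s = \<epsilon> * (1 - 2 * s)" for s :: real
    define b where "b s = \<epsilon> * min s (1 - s)" for s :: real
    have ab: "\<bar>a s\<bar> \<le> \<epsilon>" "0 \<le> b s" "b s \<le> \<epsilon>" if "s \<in> {0..1}" for s
    proof -
      have "\<bar>1 - 2 * s\<bar> \<le> 1" "0 \<le> min s (1 - s)" "min s (1 - s) \<le> 1" using that by auto
      then show "\<bar>a s\<bar> \<le> \<epsilon>" "0 \<le> b s" "b s \<le> \<epsilon>"
        using \<epsilon>(1) unfolding a_def b_def abs_mult by (simp_all add: mult_le_cancel_left1)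
    qed
    define z :: "real \<Rightarrow> real^'n" where
      "z s = (\<chi> k. if k = i then 1/4 - \<bar>a s\<bar> else if k = j then 1/4 - b s else x0 $ k)" for s
    define t :: "real \<Rightarrow> real^'n" where
      "t s = (\<chi> k. if k = i then a s else if k = j then b s else 0)" for s
    \<comment> \<open>At s = 1/2 the depth behind wall \<open>i\<close> is 0, and the path passes
      through this wall into the orthant of \<open>{i}\<close>.\<close>
    define G where "G s = (if s \<le> 1/2 then {} else {i})" for s :: real
    have Gh: "G s \<subseteq> h" for s using ij by (auto simp: G_def)
    have zpos: "z s $ k > 0" if "k \<in> h" "s \<in> {0..1}" for k s
      using ab[OF that(2)] \<epsilon>(2) that(1) by (auto simp: z_def x0_def)
    have zoff: "z s $ k = 0" if "k \<notin> h" for k s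
      using that ij by (auto simp: z_def x0_def)
    have zc: "z s \<in> cube" if "s \<in> {0..1}" for s
      using ab[OF that] \<epsilon>(2) by (auto simp: z_def x0_def cube_iff)
    have zorth: "act A (G s) (z s) \<in> orthant A h (G s)" if "s \<in> {0..1}" for s
      using zc[OF that] zpos[OF _ that] zoff by (auto simp: orthant_def)
    have unf: "unfold_at A h (G s) (act A (G s) (z s)) = t s" if s: "s \<in> {0..1}" for s
    proof -
      have "(if i \<in> G s then -1 else 1) * \<bar>a s\<bar> = a s"
        using \<epsilon>(1) by (auto simp: G_def a_def abs_mult abs_if mult_less_0_iff)
      moreover have "j \<notin> G s" "k \<noteq> i \<Longrightarrow> k \<notin> G s" for k using ij by (auto simp: G_def)
      ultimately have "unfold_at A h (G s) (act A (G s) (z s)) $ k = t s $ k" for k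
        using ij zpos[OF _ s] zoff ab[OF s] \<epsilon>(2)
        by (cases "k = i"; cases "k = j"; cases "k \<in> h") (auto simp: unfold_at_def t_def z_def x0_def abs_mult)
      then show ?thesis by (simp add: vec_eq_iff)
    qed
    define \<gamma> where "\<gamma> s = proj A (act A (G s) (z s))" for s
    have N\<gamma>: "N (\<gamma> s) = sqmat J (t s)" if "s \<in> {0..1}" for s
      unfolding \<gamma>_def using N(2)[OF Gh zorth[OF that]] unf[OF that] by simp
    have tC: "t s \<in> ?C" if "s \<in> {0..1}" for s
    proof (cases "s = 1/2")
      case True
      then have "t s $ j \<noteq> 0" using ij \<epsilon>(1) by (simp add: t_def b_def)
      then show ?thesis using ij hJ by auto
    next
      case False
      then have "t s $ i \<noteq> 0" using \<epsilon>(1) by (simp add: t_def a_def)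
      then show ?thesis using ij hJ by auto
    qed
    have cz: "continuous_on {0..1} z"
    proof -
      have "continuous_on {0..1} (\<lambda>s. if k = i then 1/4 - \<bar>a s\<bar> else if k = j then 1/4 - b s else x0 $ k)" for k
        by (cases "k = i"; cases "k = j") (auto simp: a_def b_def intro!: continuous_intros)
      then show ?thesis unfolding z_def by (auto intro!: continuous_on_vec_lambda)
    qed
    have ct: "continuous_on {0..1} t"
    proof -
      have "continuous_on {0..1} (\<lambda>s. if k = i then a s else if k = j then b s else 0)" for k
        by (cases "k = i"; cases "k = j") (auto simp: a_def b_def intro!: continuous_intros)
      then show ?thesis unfolding t_def by (auto intro!: continuous_on_vec_lambda)
    qed
    have \<gamma>W: "\<gamma> s \<in> W" if s: "s \<in> {0..1}" for s
    proof -
      have "norm (z s - x0) \<le> (\<Sum>k\<in>UNIV. \<bar>(z s - x0) $ k\<bar>)" by (rule norm_le_l1_cart)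
      also have "\<dots> = (\<Sum>k\<in>{i,j}. \<bar>(z s - x0) $ k\<bar>)"
        by (rule sum.mono_neutral_right) (auto simp: z_def)
      also have "\<dots> \<le> 2 * \<epsilon>" using ij ab[OF s] by (simp add: z_def x0_def)
      finally have dz: "dist (act A g (z s)) (act A g x0) \<le> 2 * \<epsilon>" for g
        unfolding dist_act by (simp add: dist_norm)
      show ?thesis
        using d1(2)[of "act A {} (z s)"] d2(2)[of "act A {i} (z s)"] dz[of "{}"] dz[of "{i}"] zc[OF s] \<epsilon>
        by (auto simp: \<gamma>_def G_def)
    qed
    have \<gamma>S: "\<gamma> s \<notin> S" if s: "s \<in> {0..1}" for s
    proof
      assume "\<gamma> s \<in> S"
      then have "N (\<gamma> s) $ k $ k = 0" if "k \<in> J" for k using that by (auto simp: S_def)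
      then have "t s $ k = 0" if "k \<in> J" for k using that by (simp add: N\<gamma>[OF s] sqmat_nth)
      then show False using tC[OF s] by auto
    qed
    have c\<gamma>: "continuous_map (top_of_set {0..1}) ?Q \<gamma>"
    proof -
      have piece: "continuous_map (subtopology (top_of_set {0..1}) T) ?Q (\<lambda>s. proj A (act A g (z s)))" for T g
      proof -
        have "continuous_map (subtopology (top_of_set {0..1}) T) ?c (\<lambda>s. act A g (z s))"
          using zc by (auto simp: subtopology_subtopology continuous_map_in_subtopology
              intro!: continuous_on_act continuous_on_subset[OF cz])
        from continuous_map_compose[OF this cp] show ?thesis by (simp add: o_def)
      qed
      have "continuous_map (top_of_set {0..1}) ?Q
          (\<lambda>s. if s \<le> 1/2 then proj A (act A {} (z s)) else proj A (act A {i} (z s)))"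
      proof (rule continuous_map_cases_le)
        fix s :: real assume s: "s \<in> topspace (top_of_set {0..1})" "s = 1/2"
        have "a s = 0" unfolding s(2) a_def by simp
        then have "i \<in> walls (z s)" by (simp add: walls_def z_def)
        then show "proj A (act A {} (z s)) = proj A (act A {i} (z s))"
          using zc[of s] s(1) by simp
      next
        show "continuous_map (subtopology (top_of_set {0..1}) {s \<in> topspace (top_of_set {0..1}). s \<le> 1/2}) ?Q (\<lambda>s. proj A (act A {} (z s)))"
          by (rule piece)
        show "continuous_map (subtopology (top_of_set {0..1}) {s \<in> topspace (top_of_set {0..1}). 1/2 \<le> s}) ?Q (\<lambda>s. proj A (act A {i} (z s)))"
          by (rule piece)
      qed auto
      moreover have "\<gamma> = (\<lambda>s. if s \<le> 1/2 then proj A (act A {} (z s)) else proj A (act A {i} (z s)))"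
      proof
        fix s show "\<gamma> s = (if s \<le> 1/2 then proj A (act A {} (z s)) else proj A (act A {i} (z s)))"
          unfolding \<gamma>_def G_def by (cases "s \<le> 1/2") (simp_all only: if_True if_False)
      qed
      ultimately show ?thesis by simp
    qed
    \<comment> \<open>At the ends \<open>i\<close> is off its wall, but the remaining walls of
      \<open>h\<close> act on \<open>z 0\<close> just as \<open>{i}\<close> does, since
      \<open>h\<close> is null and \<open>z 0\<close> vanishes off \<open>h\<close>.\<close>
    have \<gamma>01: "\<gamma> 0 = \<gamma> 1"
    proof -
      have z01: "z 1 = z 0" by (simp add: z_def vec_eq_iff a_def b_def)
      have "act A {i} (z 0) = act A (h - {i}) (z 0)"
      proof -
        have "sg A {i} k * z 0 $ k = sg A (h - {i}) k * z 0 $ k" for k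
          using h zoff[of k 0] ij by (cases "k \<in> h") (auto simp: sg_compl null_def)
        then show ?thesis by (simp add: vec_eq_iff)
      qed
      moreover have "h - {i} \<subseteq> walls (z 0)" by (auto simp: walls_def z_def x0_def b_def)
      ultimately have "proj A (act A {i} (z 0)) = proj A (z 0)" using zc[of 0] by simp
      then show ?thesis by (simp add: \<gamma>_def G_def z01)
    qed
    have "t 0 $ i \<noteq> t 1 $ i" using \<epsilon>(1) by (simp add: t_def a_def)
    then have "t 0 \<noteq> t 1" by auto
    moreover have "continuous_map (top_of_set {0..1}) (subtopology ?Q (W - S)) \<gamma>"
      using c\<gamma> \<gamma>W \<gamma>S by (auto simp: continuous_map_in_subtopology)
    ultimately show ?thesis using \<gamma>01 ct tC N\<gamma>
      by (intro exI[of _ \<gamma>] exI[of _ t]) auto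
  qed
  show False
    by (rule no_chart_at_branch_point[OF covering_space_sqmat[of J] two U V NU NB S f injf md loop]) auto
qed

lemma closed_manifold_imp_tame:
  assumes "closed_manifold (seal_space A)"
  shows "tame A"
  by (rule tame_if_minimal_null_small)
     (use minimal_null_small[OF assms] in \<open>simp add: branch_coords_def\<close>)

section \<open>Quotients on the real numbers and line bundles\<close>

text \<open>Quotient spaces carried by real numbers: each class is coded by an injection of the ambient
  space into the reals, applied to a chosen representative.\<close>

definition code :: "'a::{second_countable_topology,t2_space} \<Rightarrow> real" where
  "code = (SOME f. inj f)"

definition decode :: "real \<Rightarrow> 'a::{second_countable_topology,t2_space}" where
  "decode = inv_into UNIV code"

text \<open>A point is determined by the basic open sets around it, that is by a set of natural
  numbers, and such sets inject into the reals.\<close>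

lemma inj_code: "inj (code :: 'a::{second_countable_topology,t2_space} \<Rightarrow> real)"
proof -
  obtain B :: "'a set set" where B: "countable B" "topological_basis B"
    using ex_countable_basis by blast
  define f where "f x = to_nat_on B ` {b \<in> B. x \<in> b}" for x :: 'a
  have "inj f"
  proof (rule injI, rule ccontr)
    fix x y :: 'a assume eq: "f x = f y" and ne: "x \<noteq> y"
    then obtain U where "open U" "x \<in> U" "y \<notin> U" using t1_space by blast
    then obtain b where b: "b \<in> B" "x \<in> b" "b \<subseteq> U"
      using topological_basisE[OF B(2)] by metis
    then have "to_nat_on B b \<in> f y" using eq by (auto simp: f_def)
    then obtain b' where "b' \<in> B" "y \<in> b'" "to_nat_on B b' = to_nat_on B b" by (auto simp: f_def)
    then have "b' = b" using b(1) B(1) inj_on_to_nat_on by (metis inj_onD)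
    then show False using \<open>y \<in> b'\<close> b(3) \<open>y \<notin> U\<close> by blast
  qed
  moreover obtain g :: "nat set \<Rightarrow> real" where "inj g"
    using nat_sets_eqpoll_reals unfolding eqpoll_def bij_betw_def by blast
  ultimately have "inj (g \<circ> f)" by (simp add: inj_compose)
  then show ?thesis unfolding code_def by (rule someI[of inj])
qed

lemma decode_code [simp]: "decode (code x) = x"
  by (simp add: decode_def inj_code)

definition qmap :: "('a::{second_countable_topology,t2_space} \<Rightarrow> 'a \<Rightarrow> bool) \<Rightarrow> 'a \<Rightarrow> real" where
  "qmap R x = code (SOME y. R x y)"

definition qspace :: "'a::{second_countable_topology,t2_space} set \<Rightarrow> ('a \<Rightarrow> 'a \<Rightarrow> bool) \<Rightarrow> real topology" where
  "qspace S R = topology (\<lambda>U. U \<subseteq> qmap R ` topspace (top_of_set S) \<and>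
     openin (top_of_set S) {x \<in> topspace (top_of_set S). qmap R x \<in> U})"

lemma quotient_map_qmap: "quotient_map (top_of_set S) (qspace S R) (qmap R)"
  unfolding qspace_def by (rule quotient_map_quotient_top)

lemma topspace_qspace: "topspace (qspace S R) = qmap R ` S"
  using quotient_imp_surjective_map[OF quotient_map_qmap[of S R]] by simp

lemma continuous_map_qmap: "continuous_map (top_of_set S) (qspace S R) (qmap R)"
  using quotient_map_qmap quotient_imp_continuous_map by blast

lemma qmap_rep:
  assumes "equivp R"
  shows "R x (decode (qmap R x))"
  unfolding qmap_def decode_code by (rule someI[of _ x]) (simp add: equivp_reflp assms)

lemma qmap_eq_iff:
  assumes "equivp R"
  shows "qmap R x = qmap R y \<longleftrightarrow> R x y"
proof
  assume "qmap R x = qmap R y"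
  then have "R x (decode (qmap R x))" "R y (decode (qmap R x))" using qmap_rep[OF assms] by metis+
  then show "R x y" using assms by (meson equivp_symp equivp_transp)
next
  assume "R x y"
  then have "R x = R y" using assms by (simp add: equivp_def)
  then show "qmap R x = qmap R y" by (simp add: qmap_def)
qed

text \<open>The saturation of a closed set is a finite union of closed sets, one for each partial
  map \<open>a g\<close> with closed domain.\<close>

lemma closed_map_qmap:
  fixes G :: "'g::finite set" and W :: "'g \<Rightarrow> 'a::{second_countable_topology,t2_space} set"
  assumes R: "equivp R" "\<And>x y. x \<in> S \<Longrightarrow> R x y \<longleftrightarrow> (\<exists>g\<in>G. x \<in> W g \<and> y = a g x)"
    and W: "\<And>g. closedin (top_of_set S) (S \<inter> W g)"
    and a: "\<And>g. continuous_on S (a g)" "\<And>g x. x \<in> S \<Longrightarrow> a g x \<in> S"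
  shows "closed_map (top_of_set S) (qspace S R) (qmap R)"
  unfolding closed_map_def
proof (intro allI impI)
  fix C assume C: "closedin (top_of_set S) C"
  then have CS: "C \<subseteq> S" using closedin_subset by fastforce
  have "{x \<in> S. qmap R x \<in> qmap R ` C} = (\<Union>g\<in>G. (S \<inter> W g) \<inter> {x \<in> S. a g x \<in> C})"
  proof -
    have "qmap R x \<in> qmap R ` C \<longleftrightarrow> (\<exists>y\<in>C. R x y)" for x
      using qmap_eq_iff[OF R(1)] by (auto simp: image_iff)
    moreover have "(\<exists>y\<in>C. R x y) \<longleftrightarrow> (\<exists>g\<in>G. x \<in> W g \<and> a g x \<in> C)" if "x \<in> S" for x
      unfolding R(2)[OF that] by auto
    ultimately show ?thesis by auto
  qed
  moreover have "closedin (top_of_set S) {x \<in> S. a g x \<in> C}" for g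
  proof -
    have "continuous_map (top_of_set S) (top_of_set S) (a g)"
      using a by (simp add: image_subset_iff)
    from closedin_continuous_map_preimage[OF this C] show ?thesis by simp
  qed
  ultimately have "closedin (top_of_set S) {x \<in> S. qmap R x \<in> qmap R ` C}"
    by (simp only:) (intro closedin_Union ballI closedin_Int W; auto intro!: closedin_Int W)
  moreover have "qmap R ` C \<subseteq> qmap R ` S" using CS by blast
  ultimately show "closedin (qspace S R) (qmap R ` C)"
    using quotient_map_qmap[of S R] unfolding quotient_map_closedin
    by (simp add: topspace_qspace)
qed

lemma quotient_maps_homeomorphic:
  assumes f: "quotient_map X Y f" and g: "quotient_map X Z g"
    and eq: "\<And>x y. x \<in> topspace X \<Longrightarrow> y \<in> topspace X \<Longrightarrow> f x = f y \<longleftrightarrow> g x = g y"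
  shows "Y homeomorphic_space Z"
proof -
  obtain u where u: "continuous_map Y Z u" "\<And>x. x \<in> topspace X \<Longrightarrow> u (f x) = g x"
    using quotient_map_lift_exists[OF f quotient_imp_continuous_map[OF g]] eq by metis
  obtain v where v: "continuous_map Z Y v" "\<And>x. x \<in> topspace X \<Longrightarrow> v (g x) = f x"
    using quotient_map_lift_exists[OF g quotient_imp_continuous_map[OF f]] eq by metis
  have "homeomorphic_maps Y Z u v"
    using u v quotient_imp_surjective_map[OF f, symmetric] quotient_imp_surjective_map[OF g, symmetric]
    by (auto simp: homeomorphic_maps_def)
  then show ?thesis by (auto simp: homeomorphic_space_def)
qed

section \<open>Line bundles given by characters of the walls\<close>

definition subcube :: "'n set \<Rightarrow> (real^'n) set" where
  "subcube D = {x \<in> cube. \<forall>k. k \<notin> D \<longrightarrow> x$k = 0}"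

definition orb :: "'n::finite bmat \<Rightarrow> real^'n \<Rightarrow> real^'n \<Rightarrow> bool" where
  "orb A x y \<longleftrightarrow> (\<exists>g\<subseteq>walls x. y = act A g x)"

text \<open>The character by which walls act on the fibre of the line bundle of a coordinate \<open>j\<close>;
  \<open>None\<close> stands for the trivial bundle.\<close>
definition chi :: "'n bmat \<Rightarrow> 'n option \<Rightarrow> 'n set \<Rightarrow> real" where
  "chi A c g = (case c of None \<Rightarrow> 1 | Some j \<Rightarrow> sg A g j)"

definition bun :: "'n::finite bmat \<Rightarrow> 'n option \<Rightarrow> (real^'n) \<times> real \<Rightarrow> (real^'n) \<times> real \<Rightarrow> bool" where
  "bun A c z z' \<longleftrightarrow> (\<exists>g\<subseteq>walls (fst z). z' = (act A g (fst z), chi A c g * snd z))"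

lemma chi_empty [simp]: "chi A c {} = 1"
  by (simp add: chi_def split: option.split)

lemma chi_None [simp]: "chi A None g = 1"
  by (simp add: chi_def)

lemma chi_Some [simp]: "chi A (Some j) g = sg A g j"
  by (simp add: chi_def)

lemma chi_mult_self [simp]: "chi A c g * chi A c g = 1" "chi A c g * (chi A c g * r) = r"
  by (simp_all add: chi_def split: option.split)

lemma abs_chi [simp]: "\<bar>chi A c g\<bar> = 1"
  by (simp add: chi_def split: option.split)

lemma chi_neq_0 [simp]: "chi A c g \<noteq> 0"
  by (simp add: chi_def split: option.split)

lemma chi_symdiff:
  fixes g :: "'n::finite set"
  shows "chi A c (sym_diff g h) = chi A c g * chi A c h"
  by (cases c) (simp_all add: sg_symdiff)

lemma equivp_orb: "equivp (orb A)"
proof (rule equivpI)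
  show "reflp (orb A)" unfolding orb_def by (rule reflpI) (metis act_empty empty_subsetI)
  show "symp (orb A)" unfolding orb_def by (rule sympI) (metis act_self walls_act)
  show "transp (orb A)"
  proof (rule transpI)
    fix x y z assume "orb A x y" "orb A y z"
    then obtain g h where "g \<subseteq> walls x" "h \<subseteq> walls x" "y = act A g x" "z = act A h y"
      by (auto simp: orb_def)
    then have "z = act A (sym_diff h g) x" "sym_diff h g \<subseteq> walls x" by (auto simp: act_act)
    then show "orb A x z" unfolding orb_def by blast
  qed
qed

lemma equivp_bun: "equivp (bun A c)"
proof (rule equivpI)
  show "reflp (bun A c)" unfolding bun_def
    by (rule reflpI, rule exI[of _ "{}"]) simp
  show "symp (bun A c)" unfolding bun_def
  proof (rule sympI, elim exE conjE)
    fix z z' :: "(real^'a) \<times> real" and g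
    assume "g \<subseteq> walls (fst z)" "z' = (act A g (fst z), chi A c g * snd z)"
    then show "\<exists>g\<subseteq>walls (fst z'). z = (act A g (fst z'), chi A c g * snd z')"
      by (intro exI[of _ g]) simp
  qed
  show "transp (bun A c)"
  proof (rule transpI)
    fix x y z assume "bun A c x y" "bun A c y z"
    then obtain g h where gh: "g \<subseteq> walls (fst x)" "h \<subseteq> walls (fst x)"
      "y = (act A g (fst x), chi A c g * snd x)" "z = (act A h (fst y), chi A c h * snd y)"
      by (auto simp: bun_def)
    then have "z = (act A (sym_diff h g) (fst x), chi A c (sym_diff h g) * snd x)"
      by (simp add: act_act chi_symdiff)
    moreover have "sym_diff h g \<subseteq> walls (fst x)" using gh by blast
    ultimately show "bun A c x z" unfolding bun_def by blast
  qed
qed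

abbreviation base_map :: "'n::finite bmat \<Rightarrow> real^'n \<Rightarrow> real" where
  "base_map A \<equiv> qmap (orb A)"
text \<open>A stage of the tower: the coordinates outside \<open>D\<close> are frozen at 0, so that
  all stages are quotients of slices of one cube.\<close>

abbreviation base_space :: "'n::finite bmat \<Rightarrow> 'n set \<Rightarrow> real topology" where
  "base_space A D \<equiv> qspace (subcube D) (orb A)"
abbreviation tot_map :: "'n::finite bmat \<Rightarrow> 'n option \<Rightarrow> (real^'n) \<times> real \<Rightarrow> real" where
  "tot_map A c \<equiv> qmap (bun A c)"
abbreviation tot_space :: "'n::finite bmat \<Rightarrow> 'n set \<Rightarrow> 'n option \<Rightarrow> real topology" where
  "tot_space A D c \<equiv> qspace (subcube D \<times> UNIV) (bun A c)"

definition bproj :: "'n::finite bmat \<Rightarrow> real \<Rightarrow> real" where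
  "bproj A e = base_map A (fst (decode e :: (real^'n) \<times> real))"

definition bscale :: "'n::finite bmat \<Rightarrow> 'n option \<Rightarrow> real \<Rightarrow> real \<Rightarrow> real" where
  "bscale A c r e = (let z = decode e :: (real^'n) \<times> real in tot_map A c (fst z, r * snd z))"

text \<open>The two codes may decode to vectors over different representatives, so \<open>e'\<close>
  is first rewritten over the representative of \<open>e\<close>.\<close>

definition badd :: "'n::finite bmat \<Rightarrow> 'n option \<Rightarrow> real \<Rightarrow> real \<Rightarrow> real" where
  "badd A c e e' = (let z = decode e :: (real^'n) \<times> real
     in tot_map A c (fst z, snd z + (THE w. tot_map A c (fst z, w) = e')))"

lemma tot_map_decode:
  obtains g where "g \<subseteq> walls x" "decode (tot_map A c (x, v)) = (act A g x, chi A c g * v)"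
  using qmap_rep[OF equivp_bun, of A c "(x, v)"] by (auto simp: bun_def)

lemma base_map_decode:
  obtains g where "g \<subseteq> walls x" "decode (base_map A x) = act A g x"
  using qmap_rep[OF equivp_orb, of A x] by (auto simp: orb_def)

lemma base_map_act [simp]: "g \<subseteq> walls x \<Longrightarrow> base_map A (act A g x) = base_map A x"
  unfolding qmap_eq_iff[OF equivp_orb] orb_def by (intro exI[of _ g]) simp

lemma tot_map_act [simp]:
  "g \<subseteq> walls x \<Longrightarrow> tot_map A c (act A g x, chi A c g * v) = tot_map A c (x, v)"
  unfolding qmap_eq_iff[OF equivp_bun] bun_def by (intro exI[of _ g]) simp

lemma bproj_tot_map [simp]: "bproj A (tot_map A c (x, v)) = base_map A x"
  by (rule tot_map_decode[where x=x and A=A and c=c and v=v]) (simp add: bproj_def)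

lemma bscale_tot_map [simp]: "bscale A c r (tot_map A c (x, v)) = tot_map A c (x, r * v)"
proof -
  obtain g where "g \<subseteq> walls x" "decode (tot_map A c (x, v)) = (act A g x, chi A c g * v)"
    by (rule tot_map_decode)
  then show ?thesis using tot_map_act[of g x A c "r * v"] by (simp add: bscale_def mult.left_commute)
qed

lemma subcube_act [simp]: "act A g x \<in> subcube D \<longleftrightarrow> x \<in> subcube D"
  by (auto simp: subcube_def)

lemma walls_subcube: "x \<in> subcube D \<Longrightarrow> walls x \<subseteq> D"
  by (force simp: subcube_def walls_def)

text \<open>The sets \<open>g\<close> and \<open>g'\<close> differ by walls of \<open>x\<close>
  only, and their difference is trivial on these. Tameness makes it trivial on every coordinate,
  hence on every fibre.\<close>

lemma chi_eq_if_act_eq: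
  fixes A :: "'n::finite bmat"
  assumes tame: "tame A" and g: "g \<subseteq> walls x" "g' \<subseteq> walls x"
    and eq: "\<And>i. i \<in> walls x \<Longrightarrow> sg A g i = sg A g' i"
  shows "chi A c g = chi A c g'"
proof -
  have "sg A (sym_diff g g') k = 1" for k
  proof (rule trivial_on_self_imp_trivial[OF tame])
    fix i assume "i \<in> sym_diff g g'"
    then have "i \<in> walls x" using g by auto
    then show "sg A (sym_diff g g') i = 1" using eq by (simp add: sg_symdiff)
  qed
  then have "chi A c (sym_diff g g') = 1" by (cases c) auto
  then have "chi A c g * chi A c g' = 1" by (simp only: chi_symdiff)
  then show ?thesis by (metis chi_mult_self(2) mult.right_neutral)
qed

lemma sg_eq_if_act_eq:
  assumes "act A g x = act A g' x" "i \<in> walls x"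
  shows "sg A g i = sg A g' i"
proof -
  have "sg A g i * x$i = sg A g' i * x$i" using arg_cong[OF assms(1), of "\<lambda>z. z$i"] by simp
  moreover have "x$i \<noteq> 0" using assms(2) by (auto simp: walls_def)
  ultimately show ?thesis by simp
qed

text \<open>A stabiliser of \<open>x\<close> acts trivially on the fibre; otherwise \<open>v\<close>
  and \<open>-v\<close> would be identified and the fibre would be a half-line.\<close>

lemma tot_map_eq_iff:
  assumes "tame A"
  shows "tot_map A c (x, v) = tot_map A c (x, w) \<longleftrightarrow> v = w"
proof
  assume "tot_map A c (x, v) = tot_map A c (x, w)"
  then obtain g where g: "g \<subseteq> walls x" "x = act A g x" "w = chi A c g * v"
    unfolding qmap_eq_iff[OF equivp_bun] by (auto simp: bun_def)
  have "chi A c g = chi A c {}"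
    by (rule chi_eq_if_act_eq[OF assms g(1)]) (use sg_eq_if_act_eq[of A g x "{}"] g(2) in auto)
  then show "v = w" using g(3) by simp
qed simp

lemma badd_tot_map:
  assumes "tame A"
  shows "badd A c (tot_map A c (x, v)) (tot_map A c (x, w)) = tot_map A c (x, v + w)"
proof -
  obtain g where g: "g \<subseteq> walls x" "decode (tot_map A c (x, v)) = (act A g x, chi A c g * v)"
    by (rule tot_map_decode)
  have "(THE w'. tot_map A c (act A g x, w') = tot_map A c (x, w)) = chi A c g * w"
  proof (rule the_equality)
    show "tot_map A c (act A g x, chi A c g * w) = tot_map A c (x, w)" using g(1) by simp
    fix w' assume "tot_map A c (act A g x, w') = tot_map A c (x, w)"
    then have "tot_map A c (act A g x, w') = tot_map A c (act A g x, chi A c g * w)" using g(1) by simp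
    then show "w' = chi A c g * w" using tot_map_eq_iff[OF assms] by blast
  qed
  then have "badd A c (tot_map A c (x, v)) (tot_map A c (x, w))
      = tot_map A c (act A g x, chi A c g * (v + w))"
    by (simp add: badd_def g(2) distrib_left)
  then show ?thesis using g(1) by simp
qed

lemma tot_spaceE:
  assumes "e \<in> topspace (tot_space A D c)"
  obtains x v where "x \<in> subcube D" "e = tot_map A c (x, v)"
  using assms by (auto simp: topspace_qspace)

lemma same_fibreE:
  assumes "e \<in> topspace (tot_space A D c)" "bproj A e = base_map A x"
  obtains v where "e = tot_map A c (x, v)"
proof -
  obtain y v where y: "e = tot_map A c (y, v)" using assms(1) by (rule tot_spaceE)
  then have "orb A y x" using assms(2) by (simp add: qmap_eq_iff[OF equivp_orb])
  then obtain g where "g \<subseteq> walls y" "x = act A g y" by (auto simp: orb_def)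
  then show thesis using that[of "chi A c g * v"] y by simp
qed

lemma continuous_map_bproj: "continuous_map (tot_space A D c) (base_space A D) (bproj A)"
proof (rule continuous_compose_quotient_map[OF quotient_map_qmap])
  have "continuous_map (top_of_set (subcube D \<times> UNIV)) (top_of_set (subcube D)) (fst :: (real^'a) \<times> real \<Rightarrow> _)"
    by (auto simp: continuous_map_in_subtopology intro!: continuous_intros)
  from continuous_map_compose[OF this continuous_map_qmap]
  have "continuous_map (top_of_set (subcube D \<times> (UNIV :: real set))) (base_space A D) (base_map A \<circ> fst)" .
  moreover have "bproj A \<circ> tot_map A c = base_map A \<circ> fst"
    by (auto simp: fun_eq_iff)
  ultimately show "continuous_map (top_of_set (subcube D \<times> UNIV)) (base_space A D) (bproj A \<circ> tot_map A c)"
    by metis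
qed

text \<open>Neighbourhoods of the orbit of \<open>x0\<close> in which the signs of the coordinates on the walls of
  \<open>x0\<close> determine the character.\<close>
definition sector :: "'n::finite bmat \<Rightarrow> 'n set \<Rightarrow> real^'n \<Rightarrow> 'n set \<Rightarrow> (real^'n) set" where
  "sector A D x0 g = {x \<in> subcube D. (\<forall>i\<in>walls x0. x$i * (sg A g i * x0$i) > 0) \<and> (\<forall>k. k \<notin> walls x0 \<longrightarrow> \<bar>x$k\<bar> < 1/4)}"

definition star :: "'n::finite bmat \<Rightarrow> 'n set \<Rightarrow> real^'n \<Rightarrow> (real^'n) set" where
  "star A D x0 = (\<Union>g\<in>Pow (walls x0). sector A D x0 g)"

text \<open>The trivialising factor: by \<open>star_act\<close> it changes under walls exactly as
  the fibre coordinate does, so the product of the two is invariant. The choice of \<open>g\<close>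
  is immaterial by \<open>star_sign_eq\<close>.\<close>

definition star_sign :: "'n::finite bmat \<Rightarrow> 'n option \<Rightarrow> 'n set \<Rightarrow> real^'n \<Rightarrow> real^'n \<Rightarrow> real" where
  "star_sign A c D x0 x = chi A c (SOME g. g \<subseteq> walls x0 \<and> x \<in> sector A D x0 g)"

lemma openin_sector: "openin (top_of_set (subcube D)) (sector A D x0 g)"
proof -
  let ?O = "(\<Inter>i\<in>walls x0. {x::real^'a. x$i * (sg A g i * x0$i) > 0}) \<inter> (\<Inter>k\<in>-walls x0. {x::real^'a. \<bar>x$k\<bar> < 1/4})"
  have "open ?O"
    by (intro open_Int open_INT ballI open_Collect_less continuous_intros) auto
  then have "openin (top_of_set (subcube D)) (subcube D \<inter> ?O)"
    by (rule openin_open_Int)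
  also have "subcube D \<inter> ?O = sector A D x0 g"
    by (auto simp: sector_def)
  finally show ?thesis .
qed

lemma openin_star: "openin (top_of_set (subcube D)) (star A D x0)"
  unfolding star_def by (intro openin_Union) (auto simp: openin_sector)

lemma star_subset: "star A D x0 \<subseteq> subcube D"
  by (auto simp: star_def sector_def)

lemma star_sign_eq:
  fixes A :: "'n::finite bmat"
  assumes tame: "tame A" and x: "g \<subseteq> walls x0" "x \<in> sector A D x0 g"
  shows "star_sign A c D x0 x = chi A c g"
proof -
  define g' where "g' = (SOME g. g \<subseteq> walls x0 \<and> x \<in> sector A D x0 g)"
  have g': "g' \<subseteq> walls x0" "x \<in> sector A D x0 g'"
    using someI[of "\<lambda>g. g \<subseteq> walls x0 \<and> x \<in> sector A D x0 g" g] x unfolding g'_def by auto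
  have "chi A c g' = chi A c g"
  proof (rule chi_eq_if_act_eq[OF tame g'(1) x(1)])
    fix i assume "i \<in> walls x0"
    then have "x$i * (sg A g i * x0$i) > 0" "x$i * (sg A g' i * x0$i) > 0"
      using x g' by (auto simp: sector_def)
    then show "sg A g' i = sg A g i"
      using sg_cases[of A g i] sg_cases[of A g' i] by auto
  qed
  then show ?thesis by (simp add: star_sign_def g'_def)
qed

lemma sector_act:
  fixes A :: "'n::finite bmat"
  assumes x: "x \<in> sector A D x0 g" and h: "h \<subseteq> walls x"
  shows "h \<subseteq> walls x0" "act A h x \<in> sector A D x0 (sym_diff h g)"
proof -
  show "h \<subseteq> walls x0" using assms by (force simp: sector_def walls_def)
  have "act A h x$i * (sg A (sym_diff h g) i * x0$i) > 0" if "i \<in> walls x0" for i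
  proof -
    have "act A h x$i * (sg A (sym_diff h g) i * x0$i) = x$i * (sg A g i * x0$i)"
      unfolding sg_symdiff act_nth by (simp add: mult_ac)
    also have "\<dots> > 0" using x that by (simp add: sector_def)
    finally show ?thesis .
  qed
  moreover have "\<bar>act A h x$k\<bar> < 1/4" if "k \<notin> walls x0" for k
    unfolding abs_act_nth using x that by (simp add: sector_def)
  moreover have "act A h x \<in> subcube D" using x by (simp add: sector_def)
  ultimately show "act A h x \<in> sector A D x0 (sym_diff h g)"
    unfolding sector_def by blast
qed

lemma star_act:
  fixes A :: "'n::finite bmat"
  assumes tame: "tame A" and x: "x \<in> star A D x0" and h: "h \<subseteq> walls x"
  shows "act A h x \<in> star A D x0" "star_sign A c D x0 (act A h x) = chi A c h * star_sign A c D x0 x"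
proof -
  obtain g where g: "g \<subseteq> walls x0" "x \<in> sector A D x0 g" using x by (auto simp: star_def)
  have g': "sym_diff h g \<subseteq> walls x0" using sector_act(1)[OF g(2) h] g(1) by blast
  then show "act A h x \<in> star A D x0"
    using sector_act(2)[OF g(2) h] unfolding star_def by blast
  show "star_sign A c D x0 (act A h x) = chi A c h * star_sign A c D x0 x"
    using star_sign_eq[OF tame g' sector_act(2)[OF g(2) h]] star_sign_eq[OF tame g]
    by (simp only: chi_symdiff)
qed

lemma star_sign_mult_self:
  "star_sign A c D x0 x * (star_sign A c D x0 x * r) = r"
  by (simp add: star_sign_def)

lemma continuous_on_star_sign:
  fixes A :: "'n::finite bmat"
  assumes tame: "tame A"
  shows "continuous_on (star A D x0) (star_sign A c D x0)"
proof -
  let ?X = "top_of_set (star A D x0)"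
  have "continuous_map ?X euclideanreal (star_sign A c D x0)"
  proof (rule pasting_lemma[where I="Pow (walls x0)" and T="sector A D x0" and f="\<lambda>g x. chi A c g"])
    fix g assume g: "g \<in> Pow (walls x0)"
    have "sector A D x0 g \<subseteq> star A D x0" using g unfolding star_def by blast
    moreover have "openin (top_of_set (subcube D)) (sector A D x0 g)" by (rule openin_sector)
    ultimately show "openin ?X (sector A D x0 g)"
      using star_subset by (metis openin_subset_trans)
  next
    fix g g' x assume "g \<in> Pow (walls x0)" "g' \<in> Pow (walls x0)"
      "x \<in> topspace ?X \<inter> sector A D x0 g \<inter> sector A D x0 g'"
    then show "chi A c g = chi A c g'"
      using star_sign_eq[OF tame, of g x0 x D c] star_sign_eq[OF tame, of g' x0 x D c] by auto
  next
    fix x assume "x \<in> topspace ?X"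
    then obtain g where "g \<in> Pow (walls x0)" "x \<in> sector A D x0 g" by (auto simp: star_def)
    then show "\<exists>g. g \<in> Pow (walls x0) \<and> x \<in> sector A D x0 g \<and> star_sign A c D x0 x = chi A c g"
      using star_sign_eq[OF tame] by blast
  qed simp
  then show ?thesis by simp
qed

lemma qmap_saturated_openin:
  assumes R: "equivp R" and T: "openin (top_of_set S) T" "\<And>x y. x \<in> T \<Longrightarrow> y \<in> S \<Longrightarrow> R x y \<Longrightarrow> y \<in> T"
  shows "openin (qspace S R) (qmap R ` T)" "{x \<in> S. qmap R x \<in> qmap R ` T} = T"
    "quotient_map (top_of_set T) (subtopology (qspace S R) (qmap R ` T)) (qmap R)"
proof -
  have TS: "T \<subseteq> S" using openin_subset[OF T(1)] by simp
  show pre: "{x \<in> S. qmap R x \<in> qmap R ` T} = T"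
  proof (intro Set.set_eqI iffI)
    fix x assume "x \<in> {x \<in> S. qmap R x \<in> qmap R ` T}"
    then obtain y where "y \<in> T" "R y x" "x \<in> S" using qmap_eq_iff[OF R] by (metis (mono_tags, lifting) imageE mem_Collect_eq)
    then show "x \<in> T" using T(2) by blast
  qed (use TS in auto)
  have "qmap R ` T \<subseteq> topspace (qspace S R)" using TS by (auto simp: topspace_qspace)
  moreover have "openin (top_of_set S) {x \<in> topspace (top_of_set S). qmap R x \<in> qmap R ` T}"
    using pre T(1) by simp
  ultimately show op: "openin (qspace S R) (qmap R ` T)"
    using quotient_map_qmap[of S R] unfolding quotient_map_def by blast
  have "quotient_map (subtopology (top_of_set S) T) (subtopology (qspace S R) (qmap R ` T)) (qmap R)"
    by (rule quotient_map_restriction[OF quotient_map_qmap]) (use pre op in auto)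
  moreover have "subtopology (top_of_set S) T = top_of_set T"
    using TS by (simp add: subtopology_subtopology Int_absorb1)
  ultimately show "quotient_map (top_of_set T) (subtopology (qspace S R) (qmap R ` T)) (qmap R)" by metis
qed

lemma real_line_bundle_tot_space:
  fixes A :: "'n::finite bmat"
  assumes tame: "tame A"
  shows "real_line_bundle (base_space A D) (tot_space A D c) (bproj A) (badd A c) (bscale A c)"
proof -
  let ?B = "base_space A D" and ?E = "tot_space A D c"
  let ?triv = "\<lambda>b. \<exists>U. openin ?B U \<and> b \<in> U \<and>
        (\<exists>\<phi>. homeomorphic_map (subtopology ?E {e \<in> topspace ?E. bproj A e \<in> U})
                 (prod_topology (subtopology ?B U) euclideanreal) \<phi> \<and>
             (\<forall>e\<in>topspace ?E. bproj A e \<in> U \<longrightarrow>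
                 fst (\<phi> e) = bproj A e \<and>
                 (\<forall>r. snd (\<phi> (bscale A c r e)) = r * snd (\<phi> e)) \<and>
                 (\<forall>e'\<in>topspace ?E. bproj A e' = bproj A e \<longrightarrow> snd (\<phi> (badd A c e e')) = snd (\<phi> e) + snd (\<phi> e'))))"
  have triv: "?triv (base_map A x0)"
    if x0: "x0 \<in> subcube D" for x0
  proof -
    let ?T = "star A D x0" and ?\<theta> = "star_sign A c D x0"
    let ?U = "base_map A ` ?T"
    let ?EU = "tot_map A c ` (?T \<times> UNIV)"
    have satB: "y \<in> ?T" if "x \<in> ?T" "y \<in> subcube D" "orb A x y" for x y
      using that star_act(1)[OF tame] by (auto simp: orb_def)
    have B: "openin ?B ?U" "{x \<in> subcube D. base_map A x \<in> ?U} = ?T"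
      "quotient_map (top_of_set ?T) (subtopology ?B ?U) (base_map A)"
      by (rule qmap_saturated_openin[OF equivp_orb openin_star]; use satB in blast)+
    have oT: "openin (top_of_set (subcube D \<times> (UNIV::real set))) (?T \<times> UNIV)"
      by (intro openin_Times openin_star openin_subtopology_self)
    have satE: "z' \<in> ?T \<times> UNIV" if "z \<in> ?T \<times> UNIV" "z' \<in> subcube D \<times> UNIV" "bun A c z z'" for z z'
      using that star_act(1)[OF tame] by (auto simp: bun_def)
    have E: "quotient_map (top_of_set (?T \<times> UNIV)) (subtopology ?E ?EU) (tot_map A c)"
      by (rule qmap_saturated_openin[OF equivp_bun oT]; use satE in blast)
    have EU: "{e \<in> topspace ?E. bproj A e \<in> ?U} = ?EU"
    proof (intro Set.set_eqI iffI)
      fix e assume "e \<in> {e \<in> topspace ?E. bproj A e \<in> ?U}"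
      then have e: "e \<in> topspace ?E" "bproj A e \<in> ?U" by auto
      obtain x v where x: "x \<in> subcube D" "e = tot_map A c (x, v)" using e(1) by (rule tot_spaceE)
      then have "x \<in> {x \<in> subcube D. base_map A x \<in> ?U}" using e(2) by simp
      then have "x \<in> ?T" using B(2) by blast
      then show "e \<in> ?EU" using x by blast
    next
      fix e assume "e \<in> ?EU"
      then obtain x v where "x \<in> ?T" "e = tot_map A c (x, v)" by auto
      then show "e \<in> {e \<in> topspace ?E. bproj A e \<in> ?U}"
        using star_subset[of A D x0] by (auto simp: topspace_qspace)
    qed
    define \<phi> where "\<phi> e = (let z = decode e :: (real^'n) \<times> real in (bproj A e, ?\<theta> (fst z) * snd z))" for e
    define \<psi> where "\<psi> = (\<lambda>(b, w). let x = decode b :: real^'n in tot_map A c (x, ?\<theta> x * w))"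
    have \<phi>: "\<phi> (tot_map A c (x, v)) = (base_map A x, ?\<theta> x * v)" if x: "x \<in> ?T" for x v
    proof -
      obtain g where g: "g \<subseteq> walls x" "decode (tot_map A c (x, v)) = (act A g x, chi A c g * v)"
        by (rule tot_map_decode)
      show ?thesis using star_act(2)[OF tame x g(1), of c] by (simp add: \<phi>_def g(2) mult_ac)
    qed
    have \<psi>: "\<psi> (base_map A x, w) = tot_map A c (x, ?\<theta> x * w)" if x: "x \<in> ?T" for x w
    proof -
      obtain g where g: "g \<subseteq> walls x" "decode (base_map A x) = act A g x"
        by (rule base_map_decode)
      show ?thesis
        using star_act(2)[OF tame x g(1), of c] tot_map_act[OF g(1), of A c "?\<theta> x * w"]
        by (simp add: \<psi>_def g(2) mult.assoc)
    qed
    have c\<phi>: "continuous_map (subtopology ?E ?EU) (prod_topology (subtopology ?B ?U) euclideanreal) \<phi>"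
    proof (rule continuous_compose_quotient_map[OF E])
      have "continuous_map (top_of_set (?T \<times> (UNIV::real set))) (top_of_set ?T) fst"
        by (auto simp: continuous_map_in_subtopology intro!: continuous_intros)
      from continuous_map_compose[OF this quotient_imp_continuous_map[OF B(3)]]
      have 1: "continuous_map (top_of_set (?T \<times> (UNIV::real set))) (subtopology ?B ?U) (\<lambda>z. base_map A (fst z))"
        by (simp add: o_def)
      have "continuous_on (?T \<times> (UNIV::real set)) (\<lambda>z. ?\<theta> (fst z) * snd z)"
        by (intro continuous_intros continuous_on_compose2[OF continuous_on_star_sign[OF tame]]) auto
      then have 2: "continuous_map (top_of_set (?T \<times> (UNIV::real set))) euclideanreal (\<lambda>z. ?\<theta> (fst z) * snd z)"
        by simp
      have "continuous_map (top_of_set (?T \<times> (UNIV::real set))) (prod_topology (subtopology ?B ?U) euclideanreal)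
          (\<lambda>z. (base_map A (fst z), ?\<theta> (fst z) * snd z))"
        using 1 2 by (simp add: continuous_map_pairwise o_def)
      then show "continuous_map (top_of_set (?T \<times> UNIV)) (prod_topology (subtopology ?B ?U) euclideanreal) (\<phi> \<circ> tot_map A c)"
        by (rule continuous_map_eq) (auto simp: \<phi>)
    qed
    have c\<psi>: "continuous_map (prod_topology (subtopology ?B ?U) euclideanreal) (subtopology ?E ?EU) \<psi>"
    proof (rule continuous_compose_quotient_map)
      \<comment> \<open>The line is locally compact Hausdorff, so the product of a quotient map with
        its identity is again a quotient map; this makes the inverse trivialisation
        continuous.\<close>
      show "quotient_map (prod_topology (top_of_set ?T) euclideanreal) (prod_topology (subtopology ?B ?U) euclideanreal) (\<lambda>(x, w). (base_map A x, w))"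
        by (rule quotient_map_prod_left[OF _ _ B(3)]) (auto simp: locally_compact_space_euclidean Hausdorff_space_euclidean)
      have "continuous_on (?T \<times> (UNIV::real set)) (\<lambda>z. (fst z, ?\<theta> (fst z) * snd z))"
        by (intro continuous_intros continuous_on_compose2[OF continuous_on_star_sign[OF tame]]) auto
      then have "continuous_map (top_of_set (?T \<times> (UNIV::real set))) (top_of_set (?T \<times> UNIV)) (\<lambda>z. (fst z, ?\<theta> (fst z) * snd z))"
        by (auto simp: continuous_map_in_subtopology)
      from continuous_map_compose[OF this quotient_imp_continuous_map[OF E]]
      have "continuous_map (top_of_set (?T \<times> (UNIV::real set))) (subtopology ?E ?EU) (\<lambda>z. tot_map A c (fst z, ?\<theta> (fst z) * snd z))"
        by (simp add: o_def)
      moreover have "prod_topology (top_of_set ?T) euclideanreal = top_of_set (?T \<times> UNIV)"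
        by (metis euclidean_product_topology prod_topology_subtopology(1) subtopology_UNIV prod_topology_subtopology_eu)
      ultimately have "continuous_map (prod_topology (top_of_set ?T) euclideanreal) (subtopology ?E ?EU) (\<lambda>z. tot_map A c (fst z, ?\<theta> (fst z) * snd z))"
        by simp
      then show "continuous_map (prod_topology (top_of_set ?T) euclideanreal) (subtopology ?E ?EU) (\<psi> \<circ> (\<lambda>(x, w). (base_map A x, w)))"
        by (rule continuous_map_eq) (auto simp: \<psi>)
    qed
    have "homeomorphic_maps (subtopology ?E ?EU) (prod_topology (subtopology ?B ?U) euclideanreal) \<phi> \<psi>"
      unfolding homeomorphic_maps_def
    proof (intro conjI ballI)
      fix e assume "e \<in> topspace (subtopology ?E ?EU)"
      then obtain x v where "x \<in> ?T" "e = tot_map A c (x, v)" by auto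
      then show "\<psi> (\<phi> e) = e" by (simp add: \<phi> \<psi> star_sign_mult_self)
    next
      fix z assume "z \<in> topspace (prod_topology (subtopology ?B ?U) euclideanreal)"
      then obtain x w where "x \<in> ?T" "z = (base_map A x, w)" by auto
      then show "\<phi> (\<psi> z) = z" by (simp add: \<phi> \<psi> star_sign_mult_self)
    qed (rule c\<phi> c\<psi>)+
    then have hom: "homeomorphic_map (subtopology ?E {e \<in> topspace ?E. bproj A e \<in> ?U}) (prod_topology (subtopology ?B ?U) euclideanreal) \<phi>"
      unfolding EU using homeomorphic_map_maps by blast
    have "x0 \<in> sector A D x0 {}"
    proof -
      have "\<bar>x0$k\<bar> < 1/4" if "k \<notin> walls x0" for k
      proof -
        have "\<bar>x0$k\<bar> \<le> 1/4" using x0 by (auto simp: subcube_def cube_iff)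
        then show ?thesis using that by (simp add: walls_def)
      qed
      moreover have "x0$k * x0$k > 0" if "k \<in> walls x0" for k
        using that by (auto simp: walls_def zero_less_mult_iff)
      ultimately show ?thesis using x0 by (simp add: sector_def)
    qed
    then have b: "base_map A x0 \<in> ?U" by (auto simp: star_def)
    have lin: "fst (\<phi> e) = bproj A e \<and> (\<forall>r. snd (\<phi> (bscale A c r e)) = r * snd (\<phi> e)) \<and>
         (\<forall>e'\<in>topspace ?E. bproj A e' = bproj A e \<longrightarrow> snd (\<phi> (badd A c e e')) = snd (\<phi> e) + snd (\<phi> e'))"
      if e: "e \<in> topspace ?E" "bproj A e \<in> ?U" for e
    proof -
      have "e \<in> ?EU" using e EU by blast
      then obtain x v where x: "x \<in> ?T" "e = tot_map A c (x, v)" by auto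
      have "snd (\<phi> (badd A c e e')) = snd (\<phi> e) + snd (\<phi> e')"
        if e': "e' \<in> topspace ?E" "bproj A e' = bproj A e" for e'
      proof -
        have "bproj A e' = base_map A x" using e'(2) x by simp
        then obtain w where "e' = tot_map A c (x, w)" using same_fibreE[OF e'(1)] by blast
        then show ?thesis using x by (simp add: \<phi> badd_tot_map[OF tame] distrib_left)
      qed
      then show ?thesis using x by (simp add: \<phi> mult.left_commute)
    qed
    show ?thesis
      using B(1) b hom lin by (intro exI[of _ ?U] exI[of _ \<phi>] conjI) auto
  qed
  have tot: "tot_map A c (x, v) \<in> topspace ?E" if "x \<in> subcube D" for x v
    using that by (auto simp: topspace_qspace)
  show ?thesis
    unfolding real_line_bundle_def
  proof (intro conjI)
    show "continuous_map ?E ?B (bproj A)" by (rule continuous_map_bproj)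
    show "bproj A ` topspace ?E = topspace ?B"
    proof (intro subset_antisym subsetI)
      fix b assume "b \<in> topspace ?B"
      then obtain x where "x \<in> subcube D" "b = base_map A x" by (auto simp: topspace_qspace)
      then show "b \<in> bproj A ` topspace ?E" using tot[of x 0] by (intro image_eqI[of _ _ "tot_map A c (x, 0)"]) auto
    qed (use continuous_map_image_subset_topspace[OF continuous_map_bproj] in blast)
    show "\<forall>e\<in>topspace ?E. \<forall>e'\<in>topspace ?E. bproj A e = bproj A e' \<longrightarrow>
        badd A c e e' \<in> topspace ?E \<and> bproj A (badd A c e e') = bproj A e"
    proof (intro ballI impI)
      fix e e' assume e: "e \<in> topspace ?E" "e' \<in> topspace ?E" "bproj A e = bproj A e'"
      obtain x v where x: "x \<in> subcube D" "e = tot_map A c (x, v)" using e(1) by (rule tot_spaceE)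
      have "bproj A e' = base_map A x" using e(3) x by simp
      then obtain w where w: "e' = tot_map A c (x, w)" using same_fibreE[OF e(2)] by blast
      show "badd A c e e' \<in> topspace ?E \<and> bproj A (badd A c e e') = bproj A e"
        using x tot by (simp add: w badd_tot_map[OF tame])
    qed
    show "\<forall>e\<in>topspace ?E. \<forall>r. bscale A c r e \<in> topspace ?E \<and> bproj A (bscale A c r e) = bproj A e"
      using tot by (auto elim!: tot_spaceE)
    show "\<forall>b\<in>topspace ?B. ?triv b"
      using triv by (auto simp: topspace_qspace)
  qed
qed

section \<open>Projectivization\<close>

primrec mx :: "nat \<Rightarrow> (nat \<Rightarrow> real) \<Rightarrow> real" where
  "mx 0 u = 0"
| "mx (Suc n) u = max (mx n u) \<bar>u n\<bar>"

lemma mx_nonneg: "0 \<le> mx n u"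
  by (induction n) auto

lemma mx_ge: "l < n \<Longrightarrow> \<bar>u l\<bar> \<le> mx n u"
  by (induction n) (auto simp: less_Suc_eq)

lemma mx_le: "(\<And>l. l < n \<Longrightarrow> \<bar>u l\<bar> \<le> r) \<Longrightarrow> 0 \<le> r \<Longrightarrow> mx n u \<le> r"
  by (induction n) auto

lemma mx_attained: "mx n u \<noteq> 0 \<Longrightarrow> \<exists>l<n. \<bar>u l\<bar> = mx n u"
  by (induction n) (auto simp: max_def less_Suc_eq)

lemma mx_cong: "(\<And>l. l < n \<Longrightarrow> \<bar>u l\<bar> = \<bar>w l\<bar>) \<Longrightarrow> mx n u = mx n w"
  by (induction n) auto

lemma mx_mult: "mx n (\<lambda>l. r * u l) = \<bar>r\<bar> * mx n u"
  by (induction n) (auto simp: abs_mult max_mult_distrib_left)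

lemma continuous_map_mx:
  "(\<And>l. l < n \<Longrightarrow> continuous_map X euclideanreal (\<lambda>x. f x l)) \<Longrightarrow> continuous_map X euclideanreal (\<lambda>x. mx n (f x))"
  by (induction n) (auto intro!: continuous_map_real_max continuous_map_real_abs)

text \<open>Chosen so that the vectors of size 1/4 with nonnegative last entry form the graph of the
  depth \<open>1/4 - mx n u\<close> over the cube; \<open>hom_coord\<close> lands on this half of
  the sphere.\<close>

definition nrm :: "nat \<Rightarrow> (nat \<Rightarrow> real) \<Rightarrow> real" where
  "nrm n u = mx n u + \<bar>u n\<bar>"

lemma nrm_cong: "(\<And>l. l < Suc n \<Longrightarrow> \<bar>u l\<bar> = \<bar>w l\<bar>) \<Longrightarrow> nrm n u = nrm n w"
  using mx_cong[of n u w] by (simp add: nrm_def)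

lemma nrm_mult: "nrm n (\<lambda>l. r * u l) = \<bar>r\<bar> * nrm n u"
  by (simp add: nrm_def mx_mult abs_mult distrib_left)

lemma nrm_pos: "l < Suc n \<Longrightarrow> u l \<noteq> 0 \<Longrightarrow> 0 < nrm n u"
  using mx_ge[of l n u] mx_nonneg[of n u] by (auto simp: nrm_def less_Suc_eq)

definition lab :: "(nat \<Rightarrow> 'n) \<Rightarrow> nat \<Rightarrow> nat \<Rightarrow> 'n option" where
  "lab e n l = (if l < n then Some (e l) else None)"

text \<open>The vector over \<open>x\<close> with fibre coordinates \<open>u\<close>;
  \<open>undefined\<close> beyond index \<open>n\<close> makes it extensional, as points of a
  product topology are.\<close>

definition wvec :: "'n::finite bmat \<Rightarrow> (nat \<Rightarrow> 'n) \<Rightarrow> nat \<Rightarrow> real^'n \<Rightarrow> (nat \<Rightarrow> real) \<Rightarrow> nat \<Rightarrow> real" where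
  "wvec A e n x u = (\<lambda>l. if l < Suc n then tot_map A (lab e n l) (x, u l) else undefined)"

definition wscale :: "'n::finite bmat \<Rightarrow> (nat \<Rightarrow> 'n) \<Rightarrow> nat \<Rightarrow> real \<Rightarrow> (nat \<Rightarrow> real) \<Rightarrow> nat \<Rightarrow> real" where
  "wscale A e n r f = (\<lambda>l. if l < Suc n then bscale A (lab e n l) r (f l) else undefined)"

abbreviation wspace :: "'n::finite bmat \<Rightarrow> 'n set \<Rightarrow> (nat \<Rightarrow> 'n) \<Rightarrow> nat \<Rightarrow> (nat \<Rightarrow> real) topology" where
  "wspace A D e n \<equiv> whitney_sum (base_space A D) (Suc n) (\<lambda>l. tot_space A D (lab e n l)) (\<lambda>l. bproj A)"

abbreviation wnonzero :: "'n::finite bmat \<Rightarrow> 'n set \<Rightarrow> (nat \<Rightarrow> 'n) \<Rightarrow> nat \<Rightarrow> (nat \<Rightarrow> real) topology" where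
  "wnonzero A D e n \<equiv> subtopology (wspace A D e n) {f. \<exists>l<Suc n. f l \<noteq> bscale A (lab e n l) 0 (f l)}"

lemma wscale_wvec [simp]: "wscale A e n r (wvec A e n x u) = wvec A e n x (\<lambda>l. r * u l)"
  by (simp add: wscale_def wvec_def fun_eq_iff)

lemma wvec_cong: "(\<And>l. l < Suc n \<Longrightarrow> u l = u' l) \<Longrightarrow> wvec A e n x u = wvec A e n x u'"
  by (simp add: wvec_def fun_eq_iff)

text \<open>Each component supplies its own set of walls, but all of them move \<open>x\<close> to
  the same point, so by \<open>chi_eq_if_act_eq\<close> one set serves every component.\<close>

lemma wvec_eq_iff:
  fixes A :: "'n::finite bmat"
  assumes tame: "tame A"
  shows "wvec A e n x u = wvec A e n x' u' \<longleftrightarrow>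
    (\<exists>g\<subseteq>walls x. x' = act A g x \<and> (\<forall>l<Suc n. u' l = chi A (lab e n l) g * u l))"
proof
  assume eq: "wvec A e n x u = wvec A e n x' u'"
  have ex: "\<exists>g\<subseteq>walls x. x' = act A g x \<and> u' l = chi A (lab e n l) g * u l" if "l < Suc n" for l
  proof -
    have "tot_map A (lab e n l) (x, u l) = tot_map A (lab e n l) (x', u' l)"
      using fun_cong[OF eq, of l] that by (simp add: wvec_def)
    then show ?thesis unfolding qmap_eq_iff[OF equivp_bun] by (simp add: bun_def)
  qed
  obtain g where g: "g \<subseteq> walls x" "x' = act A g x" using ex[of 0] by auto
  have "u' l = chi A (lab e n l) g * u l" if l: "l < Suc n" for l
  proof -
    obtain g' where g': "g' \<subseteq> walls x" "x' = act A g' x" "u' l = chi A (lab e n l) g' * u l"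
      using ex[OF l] by blast
    have "chi A (lab e n l) g' = chi A (lab e n l) g"
      by (rule chi_eq_if_act_eq[OF tame g'(1) g(1)]) (use sg_eq_if_act_eq[of A g' x g] g(2) g'(2) in auto)
    then show ?thesis using g'(3) by simp
  qed
  then show "\<exists>g\<subseteq>walls x. x' = act A g x \<and> (\<forall>l<Suc n. u' l = chi A (lab e n l) g * u l)"
    using g by blast
next
  assume "\<exists>g\<subseteq>walls x. x' = act A g x \<and> (\<forall>l<Suc n. u' l = chi A (lab e n l) g * u l)"
  then show "wvec A e n x u = wvec A e n x' u'"
    by (auto simp: wvec_def fun_eq_iff)
qed

lemma wvec_in_wspace:
  assumes "x \<in> subcube D"
  shows "wvec A e n x u \<in> topspace (wspace A D e n)"
  using assms by (auto simp: whitney_sum_def wvec_def topspace_qspace PiE_iff extensional_def intro!: bexI[of _ "base_map A x"])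

lemma wspaceE:
  assumes "f \<in> topspace (wspace A D e n)"
  obtains x u where "x \<in> subcube D" "f = wvec A e n x u"
proof -
  have f: "f \<in> extensional {..<Suc n}" "\<And>l. l < Suc n \<Longrightarrow> f l \<in> topspace (tot_space A D (lab e n l))"
    and "\<exists>b\<in>topspace (base_space A D). \<forall>l<Suc n. bproj A (f l) = b"
    using assms by (auto simp: whitney_sum_def PiE_iff)
  then obtain x where x: "x \<in> subcube D" "\<And>l. l < Suc n \<Longrightarrow> bproj A (f l) = base_map A x"
    by (auto simp: topspace_qspace)
  have "\<exists>v. f l = tot_map A (lab e n l) (x, v)" if "l < Suc n" for l
    using same_fibreE[OF f(2)[OF that] x(2)[OF that]] by metis
  then obtain u where "\<And>l. l < Suc n \<Longrightarrow> f l = tot_map A (lab e n l) (x, u l)" by metis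
  then have "f = wvec A e n x u" using f(1) by (auto simp: wvec_def fun_eq_iff extensional_def)
  then show thesis using that x(1) by blast
qed

lemma wvec_nonzero_iff:
  assumes "tame A"
  shows "(\<exists>l<Suc n. wvec A e n x u l \<noteq> bscale A (lab e n l) 0 (wvec A e n x u l)) \<longleftrightarrow> (\<exists>l<Suc n. u l \<noteq> 0)"
  using tot_map_eq_iff[OF assms] by (auto simp: wvec_def)

lemma wvec_in_wnonzero:
  assumes "tame A" "x \<in> subcube D" "\<exists>l<Suc n. u l \<noteq> 0"
  shows "wvec A e n x u \<in> topspace (wnonzero A D e n)"
  using wvec_in_wspace[OF assms(2)] wvec_nonzero_iff[OF assms(1)] assms(3) by simp

lemma wnonzeroE:
  assumes "tame A" "f \<in> topspace (wnonzero A D e n)"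
  obtains x u where "x \<in> subcube D" "f = wvec A e n x u" "\<exists>l<Suc n. u l \<noteq> 0"
proof -
  have "f \<in> topspace (wspace A D e n)" using assms(2) by simp
  then obtain x u where x: "x \<in> subcube D" "f = wvec A e n x u" by (rule wspaceE)
  then show thesis using that assms(2) wvec_nonzero_iff[OF assms(1)] by auto
qed

text \<open>The space is a closed continuous image of a metrizable, hence normal, space. This later
  makes compact sets in the Whitney sum closed.\<close>

lemma Hausdorff_tot_space:
  fixes A :: "'n::finite bmat"
  shows "Hausdorff_space (tot_space A D c)"
proof -
  let ?S = "subcube D \<times> (UNIV :: real set)"
  have cl: "closed_map (top_of_set ?S) (tot_space A D c) (tot_map A c)"
  proof (rule closed_map_qmap[OF equivp_bun, where G = UNIV and W = "\<lambda>g. {z. g \<subseteq> walls (fst z)}"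
        and a = "\<lambda>g z. (act A g (fst z), chi A c g * snd z)"])
    show "bun A c z z' \<longleftrightarrow> (\<exists>g\<in>UNIV. z \<in> {z. g \<subseteq> walls (fst z)} \<and> z' = (act A g (fst z), chi A c g * snd z))" for z z'
      by (simp add: bun_def)
    show "closedin (top_of_set ?S) (?S \<inter> {z. g \<subseteq> walls (fst z)})" for g
    proof -
      have "closed {z::(real^'n)\<times>real. g \<subseteq> walls (fst z)}"
      proof -
        have "{z::(real^'n)\<times>real. g \<subseteq> walls (fst z)} = (\<Inter>i\<in>g. {z. \<bar>fst z $ i\<bar> = 1/4})"
          by (auto simp: walls_def)
        also have "closed \<dots>" by (intro closed_INT ballI closed_Collect_eq continuous_intros)
        finally show ?thesis .
      qed
      then show ?thesis by (rule closedin_closed_Int)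
    qed
    show "continuous_on ?S (\<lambda>z. (act A g (fst z), chi A c g * snd z))" for g
      by (intro continuous_intros)
    show "(act A g (fst z), chi A c g * snd z) \<in> ?S" if "z \<in> ?S" for g z
      using that by auto
  qed
  have "normal_space (tot_space A D c) \<and> Hausdorff_space (tot_space A D c)"
    by (rule normal_Hausdorff_space_closed_continuous_map_image[OF _ _ cl continuous_map_qmap])
      (auto simp: topspace_qspace metrizable_imp_normal_space metrizable_space_subtopology metrizable_space_euclidean Hausdorff_space_subtopology Hausdorff_space_euclidean)
  then show ?thesis by blast
qed

lemma continuous_map_bscale:
  fixes A :: "'n::finite bmat"
  assumes "continuous_map X euclideanreal r" "continuous_map X (tot_space A D c) f"
  shows "continuous_map X (tot_space A D c) (\<lambda>z. bscale A c (r z) (f z))"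
proof -
  let ?S = "subcube D \<times> (UNIV :: real set)" and ?E = "tot_space A D c"
  have "continuous_map (prod_topology euclideanreal ?E) ?E (\<lambda>(s, y). bscale A c s y)"
  proof (rule continuous_compose_quotient_map)
    show "quotient_map (prod_topology euclideanreal (top_of_set ?S)) (prod_topology euclideanreal ?E) (\<lambda>(s, z). (s, tot_map A c z))"
      by (rule quotient_map_prod_right[OF _ _ quotient_map_qmap]) (auto simp: locally_compact_space_euclidean Hausdorff_space_euclidean)
    have eq: "prod_topology euclideanreal (top_of_set ?S) = top_of_set (UNIV \<times> ?S)"
      by (metis euclidean_product_topology prod_topology_subtopology_eu subtopology_UNIV)
    have "continuous_map (top_of_set (UNIV \<times> ?S)) (top_of_set ?S) (\<lambda>z. (fst (snd z), fst z * snd (snd z)))"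
      by (auto simp: continuous_map_in_subtopology intro!: continuous_intros)
    from continuous_map_compose[OF this continuous_map_qmap]
    have "continuous_map (prod_topology euclideanreal (top_of_set ?S)) ?E (tot_map A c \<circ> (\<lambda>z. (fst (snd z), fst z * snd (snd z))))"
      unfolding eq .
    then show "continuous_map (prod_topology euclideanreal (top_of_set ?S)) ?E ((\<lambda>(s, y). bscale A c s y) \<circ> (\<lambda>(s, z). (s, tot_map A c z)))"
      by (rule continuous_map_eq) (auto simp: split_beta)
  qed
  moreover have "continuous_map X (prod_topology euclideanreal ?E) (\<lambda>z. (r z, f z))"
    using assms by (simp add: continuous_map_pairwise o_def)
  ultimately have "continuous_map X ?E ((\<lambda>(s, y). bscale A c s y) \<circ> (\<lambda>z. (r z, f z)))"
    using continuous_map_compose by blast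
  then show ?thesis by (simp add: o_def)
qed

lemma continuous_map_into_wspace:
  assumes "\<And>l. l < Suc n \<Longrightarrow> continuous_map X (tot_space A D (lab e n l)) (\<lambda>z. f z l)"
    and "\<And>z. z \<in> topspace X \<Longrightarrow> f z \<in> topspace (wspace A D e n)"
  shows "continuous_map X (wspace A D e n) f"
  unfolding whitney_sum_def continuous_map_in_subtopology continuous_map_componentwise
  using assms by (auto simp: whitney_sum_def PiE_iff)

lemma continuous_map_wspace_component:
  assumes "l < Suc n"
  shows "continuous_map (wspace A D e n) (tot_space A D (lab e n l)) (\<lambda>f. f l)"
  unfolding whitney_sum_def using assms
  by (intro continuous_map_from_subtopology continuous_map_product_projection) auto

text \<open>Independent of the decoded representative because characters are signs; the
  \<open>itself\<close> argument fixes the type of vectors to decode.\<close>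

definition fibre_abs :: "real \<Rightarrow> 'n::finite itself \<Rightarrow> real" where
  "fibre_abs y _ = \<bar>snd (decode y :: (real^'n) \<times> real)\<bar>"

lemma fibre_abs_tot_map:
  fixes A :: "'n::finite bmat"
  shows "fibre_abs (tot_map A c (x, v)) TYPE('n) = \<bar>v\<bar>"
  by (rule tot_map_decode[where x=x and A=A and c=c and v=v]) (simp add: fibre_abs_def abs_mult)

lemma continuous_map_fibre_abs:
  fixes A :: "'n::finite bmat"
  shows "continuous_map (tot_space A D c) euclideanreal (\<lambda>y. fibre_abs y TYPE('n))"
proof (rule continuous_compose_quotient_map[OF quotient_map_qmap])
  have "continuous_map (top_of_set (subcube D \<times> (UNIV::real set))) euclideanreal (\<lambda>z. \<bar>snd z\<bar>)"
    by (auto intro!: continuous_intros)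
  then show "continuous_map (top_of_set (subcube D \<times> UNIV)) euclideanreal ((\<lambda>y. fibre_abs y TYPE('n)) \<circ> tot_map A c)"
    by (rule continuous_map_eq) (auto simp: fibre_abs_tot_map)
qed

section \<open>Projective fibres over a sink class\<close>

definition cut :: "'n set \<Rightarrow> real^'n \<Rightarrow> real^'n" where
  "cut D y = (\<chi> k. if k \<in> D then y$k else 0)"

text \<open>Homogeneous coordinates: a point of the cube of the fibre is sent to the line through its
  coordinates and its depth \<open>1/4 - max\<close>, which identifies antipodal boundary points.\<close>
definition hom_coord :: "(nat \<Rightarrow> 'n) \<Rightarrow> nat \<Rightarrow> real^'n \<Rightarrow> nat \<Rightarrow> real" where
  "hom_coord e n y l = (if l < n then y $ e l else 1/4 - mx n (\<lambda>l. y $ e l))"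

lemma cut_nth [simp]: "cut D y $ k = (if k \<in> D then y$k else 0)"
  by (simp add: cut_def)

lemma cut_in_subcube: "y \<in> subcube D' \<Longrightarrow> cut D y \<in> subcube D"
  by (auto simp: subcube_def cube_iff)

lemma walls_cut: "walls (cut D y) = walls y \<inter> D"
  by (auto simp: walls_def)

lemma continuous_on_cut: "continuous_on S (cut D)"
proof -
  have "continuous_on S (\<lambda>y. if k \<in> D then y$k else 0)" for k
    by (cases "k \<in> D") (auto intro!: continuous_intros)
  then show ?thesis unfolding cut_def by (auto intro!: continuous_on_vec_lambda)
qed

lemma mx_le_quarter: "y \<in> subcube D \<Longrightarrow> mx n (\<lambda>l. y $ e l) \<le> 1/4"
  by (rule mx_le) (auto simp: subcube_def cube_iff)

lemma nrm_hom_coord: "y \<in> subcube D \<Longrightarrow> nrm n (hom_coord e n y) = 1/4"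
  using mx_le_quarter[of y D n e] mx_cong[of n "hom_coord e n y" "\<lambda>l. y $ e l"]
  by (simp add: nrm_def hom_coord_def)

lemma hom_coord_nonzero: "y \<in> subcube D \<Longrightarrow> \<exists>l<Suc n. hom_coord e n y l \<noteq> 0"
proof (rule ccontr)
  assume y: "y \<in> subcube D" and "\<not> (\<exists>l<Suc n. hom_coord e n y l \<noteq> 0)"
  then have "nrm n (hom_coord e n y) = nrm n (\<lambda>l. 0 * hom_coord e n y l)"
    by (intro nrm_cong) auto
  then show False using nrm_hom_coord[OF y, of n e] nrm_mult[of n 0] by simp
qed

lemma continuous_on_hom_coord: "continuous_on S (\<lambda>y. hom_coord e n y l)"
proof -
  have "continuous_map (top_of_set S) euclideanreal (\<lambda>y. mx n (\<lambda>l. y $ e l))"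
    by (rule continuous_map_mx) (auto intro!: continuous_intros)
  then have "continuous_on S (\<lambda>y. mx n (\<lambda>l. y $ e l))" by simp
  then show ?thesis by (cases "l < n") (auto simp: hom_coord_def intro!: continuous_intros)
qed

text \<open>A class of equal rows without arrows into the rest: walls in \<open>P\<close> leave the
  coordinates in \<open>D\<close> alone and each reverses all coordinates in
  \<open>P\<close>.\<close>

locale sink_block =
  fixes A :: "'n::finite bmat" and D P :: "'n set" and e :: "nat \<Rightarrow> 'n" and n :: nat
  assumes tame: "tame A"
    and disj: "D \<inter> P = {}"
    and out: "\<And>i j. i \<in> P \<Longrightarrow> j \<in> D \<Longrightarrow> \<not> A i j"
    and inner: "\<And>i j. i \<in> P \<Longrightarrow> j \<in> P \<Longrightarrow> i = j \<or> A i j"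
    and e: "bij_betw e {..<n} P"
begin

lemma e_P: "l < n \<Longrightarrow> e l \<in> P"
  using e by (auto simp: bij_betw_def)

lemma P_e: "j \<in> P \<Longrightarrow> \<exists>l<n. e l = j"
  using e by (auto simp: bij_betw_def)

lemma sg_block_out:
  assumes "g \<subseteq> P" "j \<in> D"
  shows "sg A g j = 1"
proof -
  have none: "{i \<in> g. i = j \<or> A i j} = {}" using assms out disj by blast
  show ?thesis unfolding sg_card none by simp
qed

lemma sg_block_in:
  assumes "g \<subseteq> P" "j \<in> P"
  shows "sg A g j = (-1) ^ card g"
proof -
  have all: "{i \<in> g. i = j \<or> A i j} = g" using assms inner by blast
  show ?thesis unfolding sg_card all by simp
qed

abbreviation G0 :: "real^'n \<Rightarrow> nat \<Rightarrow> real" where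
  "G0 y \<equiv> wvec A e n (cut D y) (hom_coord e n y)"

text \<open>Walls in \<open>D\<close> give the identifications already present in the Whitney sum,
  while walls in \<open>P\<close> amount to a common scalar sign. Conversely, equal norms force the
  scalar to be 1 or -1, and -1 is only possible on the boundary of the fibre cube, where a wall in
  \<open>P\<close> realises it.\<close>

lemma G0_fibres:
  assumes y: "y \<in> subcube (D \<union> P)" and y': "y' \<in> subcube (D \<union> P)"
  shows "(\<exists>a. a \<noteq> 0 \<and> G0 y' = wscale A e n a (G0 y)) \<longleftrightarrow> orb A y y'"
proof
  assume "orb A y y'"
  then obtain g where g: "g \<subseteq> walls y" "y' = act A g y" by (auto simp: orb_def)
  define g1 g2 where "g1 = g \<inter> D" and "g2 = g \<inter> P"
  have "g = g1 \<union> g2" "g1 \<inter> g2 = {}"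
    using g walls_subcube[OF y] disj by (auto simp: g1_def g2_def)
  then have sgg: "sg A g k = sg A g1 k * sg A g2 k" for k using sg_Un by blast
  define s where "s = (-1::real) ^ card g2"
  have g2: "g2 \<subseteq> P" by (simp add: g2_def)
  have cut: "cut D y' = act A g1 (cut D y)"
    by (simp add: vec_eq_iff g(2) sgg sg_block_out[OF g2])
  have hc: "hom_coord e n y' l = chi A (lab e n l) g1 * (s * hom_coord e n y l)" if "l < Suc n" for l
  proof (cases "l < n")
    case True
    then show ?thesis
      using sg_block_in[OF g2 e_P[OF True]] by (simp add: hom_coord_def lab_def g(2) sgg s_def)
  next
    case False
    have eq: "mx n (\<lambda>l. y' $ e l) = mx n (\<lambda>l. y $ e l)"
      by (rule mx_cong) (simp add: g(2) abs_mult)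
    \<comment> \<open>The trivial summand must not notice the sign: a crossed wall in
      \<open>P\<close> makes the maximum 1/4, so the last homogeneous coordinate is 0.\<close>
    have "s = 1 \<or> mx n (\<lambda>l. y $ e l) = 1/4"
    proof (cases "g2 = {}")
      case True
      then show ?thesis by (simp add: s_def)
    next
      case False
      then obtain i where "i \<in> g2" by blast
      then obtain l where "l < n" "\<bar>y $ e l\<bar> = 1/4" using P_e g(1) by (force simp: g2_def walls_def)
      then show ?thesis using mx_ge[of l n "\<lambda>l. y $ e l"] mx_le_quarter[OF y, of n e] by simp
    qed
    then show ?thesis using False by (auto simp: hom_coord_def lab_def eq)
  qed
  have "g1 \<subseteq> walls (cut D y)" using g(1) by (auto simp: walls_cut g1_def)
  then have "wvec A e n (cut D y) (\<lambda>l. s * hom_coord e n y l) = G0 y'"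
    unfolding wvec_eq_iff[OF tame] using cut hc by blast
  then have "G0 y' = wscale A e n s (G0 y)" by simp
  moreover have "s \<noteq> 0" by (simp add: s_def)
  ultimately show "\<exists>a. a \<noteq> 0 \<and> G0 y' = wscale A e n a (G0 y)" by blast
next
  assume "\<exists>a. a \<noteq> 0 \<and> G0 y' = wscale A e n a (G0 y)"
  then obtain a where "wvec A e n (cut D y) (\<lambda>l. a * hom_coord e n y l) = G0 y'" by force
  then obtain g where g: "g \<subseteq> walls (cut D y)" "cut D y' = act A g (cut D y)"
    and hc: "\<And>l. l < Suc n \<Longrightarrow> hom_coord e n y' l = chi A (lab e n l) g * (a * hom_coord e n y l)"
    unfolding wvec_eq_iff[OF tame] by blast
  have gD: "g \<subseteq> D" "g \<subseteq> walls y" using g(1) by (auto simp: walls_cut)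
  have yD: "y' $ j = sg A g j * y $ j" if "j \<in> D" for j
    using arg_cong[OF g(2), of "\<lambda>z. z $ j"] that by simp
  have yP: "y' $ j = sg A g j * (a * y $ j)" if "j \<in> P" for j
  proof -
    obtain l where "l < n" "e l = j" using P_e[OF \<open>j \<in> P\<close>] by blast
    then show ?thesis using hc[of l] by (simp add: hom_coord_def lab_def)
  qed
  have yO: "y $ j = 0" "y' $ j = 0" if "j \<notin> D \<union> P" for j
    using y y' that by (auto simp: subcube_def)
  have "nrm n (hom_coord e n y') = nrm n (\<lambda>l. a * hom_coord e n y l)"
    by (rule nrm_cong) (simp add: hc abs_mult)
  then have "\<bar>a\<bar> = 1"
    by (simp add: nrm_mult nrm_hom_coord[OF y] nrm_hom_coord[OF y'])
  then consider "a = 1" | "a = -1" by linarith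
  then show "orb A y y'"
  proof cases
    case 1
    have "y' $ j = sg A g j * y $ j" for j
      using yD[of j] yP[of j] yO[of j] 1 by (cases "j \<in> D"; cases "j \<in> P") auto
    then have "y' = act A g y" by (simp add: vec_eq_iff)
    then show ?thesis using gD(2) by (auto simp: orb_def)
  next
    case 2
    \<comment> \<open>Both depths are nonnegative and opposite to each other, so they vanish and
      some coordinate in \<open>P\<close> lies on a wall.\<close>
    have "1/4 - mx n (\<lambda>l. y' $ e l) = - (1/4 - mx n (\<lambda>l. y $ e l))"
      using hc[of n] 2 by (simp add: hom_coord_def lab_def)
    then have m: "mx n (\<lambda>l. y $ e l) = 1/4"
      using mx_le_quarter[OF y, of n e] mx_le_quarter[OF y', of n e] by simp
    then obtain l where l: "l < n" "\<bar>y $ e l\<bar> = 1/4" using mx_attained[of n "\<lambda>l. y $ e l"] by auto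
    let ?i = "e l"
    have i: "{?i} \<subseteq> P" "?i \<in> walls y" using l e_P by (auto simp: walls_def)
    have "g \<inter> {?i} = {}" using gD(1) i(1) disj by blast
    then have sgi: "sg A (g \<union> {?i}) j = sg A g j * sg A {?i} j" for j by (rule sg_Un)
    have "y' $ j = sg A (g \<union> {?i}) j * y $ j" for j
    proof -
      consider "j \<in> D" | "j \<in> P" | "j \<notin> D \<union> P" by blast
      then show ?thesis
      proof cases
        case 1
        then show ?thesis unfolding sgi using yD sg_block_out[OF i(1)] by simp
      next
        case 2
        then show ?thesis unfolding sgi using yP sg_block_in[OF i(1)] \<open>a = -1\<close> by simp
      next
        case 3
        then show ?thesis using yO by simp
      qed
    qed
    then have "y' = act A (g \<union> {?i}) y" by (simp add: vec_eq_iff)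
    moreover have "g \<union> {?i} \<subseteq> walls y" using gD(2) i(2) by blast
    ultimately show ?thesis unfolding orb_def by blast
  qed
qed

lemma G0_hits_lines:
  assumes x: "x \<in> subcube D" and u: "\<exists>l<Suc n. u l \<noteq> 0"
  obtains y a where "y \<in> subcube (D \<union> P)" "a \<noteq> 0" "G0 y = wvec A e n x (\<lambda>l. a * u l)"
proof -
  define N where "N = nrm n u"
  have N: "N > 0" using u nrm_pos by (auto simp: N_def)
  \<comment> \<open>Rescales to size 1/4 and makes the last entry nonnegative, so that it can be
    read as a depth.\<close>
  define a where "a = (if u n \<ge> 0 then 1 else -1) / (4 * N)"
  have a: "a \<noteq> 0" "\<bar>a\<bar> = 1 / (4 * N)" "a * u n = \<bar>u n\<bar> / (4 * N)"
    using N by (auto simp: a_def abs_if)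
  define idx where "idx = inv_into {..<n} e"
  have idx: "idx (e l) = l" if "l < n" for l
    using e that by (simp add: idx_def bij_betw_def)
  define y :: "real^'n" where "y = (\<chi> k. if k \<in> P then a * u (idx k) else x $ k)"
  have ye: "y $ e l = a * u l" if "l < n" for l
    using that e_P idx by (simp add: y_def)
  have le: "\<bar>a * u l\<bar> \<le> 1/4" if "l < n" for l
  proof -
    have "\<bar>u l\<bar> \<le> N" using mx_ge[OF that, of u] by (simp add: N_def nrm_def)
    then have "\<bar>a * u l\<bar> \<le> (1 / (4 * N)) * N"
      unfolding abs_mult a(2) using N by (intro mult_left_mono) auto
    then show ?thesis using N by simp
  qed
  have "\<bar>y $ k\<bar> \<le> 1/4" for k
  proof (cases "k \<in> P")
    case True
    then obtain l where "l < n" "e l = k" using P_e by blast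
    then show ?thesis using ye le by auto
  next
    case False
    then show ?thesis using x by (simp add: y_def subcube_def cube_iff)
  qed
  then have y: "y \<in> subcube (D \<union> P)"
    using x by (auto simp: subcube_def cube_iff y_def)
  have cut: "cut D y = x"
    using x disj by (auto simp: vec_eq_iff y_def subcube_def)
  have "hom_coord e n y l = a * u l" if "l < Suc n" for l
  proof (cases "l < n")
    case True
    then show ?thesis using ye by (simp add: hom_coord_def)
  next
    case False
    have "mx n (\<lambda>l. y $ e l) = mx n (\<lambda>l. a * u l)" by (rule mx_cong) (simp add: ye)
    also have "\<dots> = mx n u / (4 * N)" by (simp add: mx_mult a(2))
    finally have "1/4 - mx n (\<lambda>l. y $ e l) = (N - mx n u) / (4 * N)" using N by (simp add: field_simps)
    also have "\<dots> = a * u n" by (simp add: a(3) N_def nrm_def)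
    finally show ?thesis using that False by (simp add: hom_coord_def less_Suc_eq)
  qed
  then have "G0 y = wvec A e n x (\<lambda>l. a * u l)" unfolding cut by (rule wvec_cong)
  then show thesis using that y a(1) by blast
qed

lemma continuous_map_G0: "continuous_map (top_of_set (subcube (D \<union> P))) (wnonzero A D e n) G0"
proof -
  have "continuous_map (top_of_set (subcube (D \<union> P))) (wspace A D e n) G0"
  proof (rule continuous_map_into_wspace)
    fix l assume l: "l < Suc n"
    have "continuous_map (top_of_set (subcube (D \<union> P))) (top_of_set (subcube D \<times> UNIV)) (\<lambda>y. (cut D y, hom_coord e n y l))"
      using cut_in_subcube
      by (auto simp: continuous_map_in_subtopology intro!: continuous_on_Pair continuous_on_cut continuous_on_hom_coord)
    from continuous_map_compose[OF this continuous_map_qmap]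
    show "continuous_map (top_of_set (subcube (D \<union> P))) (tot_space A D (lab e n l)) (\<lambda>y. G0 y l)"
      using l by (simp add: wvec_def o_def)
  next
    fix y assume "y \<in> topspace (top_of_set (subcube (D \<union> P)))"
    then have "y \<in> subcube (D \<union> P)" by simp
    then show "G0 y \<in> topspace (wspace A D e n)" by (intro wvec_in_wspace cut_in_subcube)
  qed
  moreover have "G0 y \<in> topspace (wnonzero A D e n)" if "y \<in> subcube (D \<union> P)" for y
    by (rule wvec_in_wnonzero[OF tame cut_in_subcube[OF that] hom_coord_nonzero[OF that]])
  ultimately show ?thesis by (auto simp: continuous_map_in_subtopology)
qed

text \<open>Literally the relation inside \<open>proj_whitney_sum\<close> for this family, so that
  the two quotients coincide by unfolding.\<close>

definition line_rel :: "(nat \<Rightarrow> real) \<Rightarrow> (nat \<Rightarrow> real) \<Rightarrow> bool" where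
  "line_rel f f' \<longleftrightarrow> (\<exists>a. a \<noteq> 0 \<and> (\<forall>l<Suc n. f' l = bscale A (lab e n l) a (f l)))"

lemma line_rel_iff:
  assumes "f' \<in> topspace (wnonzero A D e n)"
  shows "line_rel f f' \<longleftrightarrow> (\<exists>a. a \<noteq> 0 \<and> f' = wscale A e n a f)"
proof -
  have "f' \<in> extensional {..<Suc n}" using assms by (auto simp: whitney_sum_def PiE_iff)
  then have "(\<forall>l<Suc n. f' l = bscale A (lab e n l) a (f l)) \<longleftrightarrow> f' = wscale A e n a f" for a
    by (auto simp: wscale_def fun_eq_iff extensional_def)
  then show ?thesis by (simp add: line_rel_def)
qed

abbreviation proj_line :: "(nat \<Rightarrow> real) \<Rightarrow> (nat \<Rightarrow> real) set" where
  "proj_line \<equiv> eq_class (wnonzero A D e n) line_rel"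

abbreviation proj_space :: "(nat \<Rightarrow> real) set topology" where
  "proj_space \<equiv> quotient_top (wnonzero A D e n) line_rel"

lemma quotient_map_proj_line: "quotient_map (wnonzero A D e n) proj_space proj_line"
  unfolding quotient_top_def by (rule quotient_map_quotient_top)

lemma proj_line_eq_iff:
  assumes f: "f \<in> topspace (wnonzero A D e n)" "f' \<in> topspace (wnonzero A D e n)"
  shows "proj_line f = proj_line f' \<longleftrightarrow> (\<exists>a. a \<noteq> 0 \<and> f' = wscale A e n a f)"
proof -
  have tr: "line_rel f1 f3" if L: "line_rel f1 f2" "line_rel f2 f3"
    and T: "f1 \<in> topspace (wnonzero A D e n)" "f2 \<in> topspace (wnonzero A D e n)" "f3 \<in> topspace (wnonzero A D e n)" for f1 f2 f3
  proof -
    obtain x u where f1: "f1 = wvec A e n x u" using T(1) by (rule wnonzeroE[OF tame])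
    obtain a b where "a \<noteq> 0" "b \<noteq> 0" "f2 = wscale A e n a f1" "f3 = wscale A e n b f2"
      using L line_rel_iff[OF T(2)] line_rel_iff[OF T(3)] by blast
    then have "b * a \<noteq> 0" "f3 = wscale A e n (b * a) f1" by (auto simp: f1 mult.assoc)
    then show ?thesis using line_rel_iff[OF T(3)] by blast
  qed
  have sy: "line_rel f2 f1" if L: "line_rel f1 f2"
    and T: "f1 \<in> topspace (wnonzero A D e n)" "f2 \<in> topspace (wnonzero A D e n)" for f1 f2
  proof -
    obtain x u where f1: "f1 = wvec A e n x u" using T(1) by (rule wnonzeroE[OF tame])
    obtain a where "a \<noteq> 0" "f2 = wscale A e n a f1" using L line_rel_iff[OF T(2)] by blast
    then have "1 / a \<noteq> 0" "f1 = wscale A e n (1 / a) f2" by (auto simp: f1)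
    then show ?thesis using line_rel_iff[OF T(1)] by blast
  qed
  have re: "line_rel f1 f1" if T: "f1 \<in> topspace (wnonzero A D e n)" for f1
  proof -
    obtain x u where f1: "f1 = wvec A e n x u" using T by (rule wnonzeroE[OF tame])
    have "f1 = wscale A e n 1 f1" by (simp add: f1)
    then show ?thesis unfolding line_rel_iff[OF T] by (intro exI[of _ 1]) simp
  qed
  have "proj_line f = proj_line f' \<longleftrightarrow> line_rel f f'"
  proof
    assume "proj_line f = proj_line f'"
    then have "f' \<in> proj_line f" using re[OF f(2)] f(2) unfolding eq_class_def by blast
    then show "line_rel f f'" by (simp add: eq_class_def)
  next
    assume "line_rel f f'"
    then show "proj_line f = proj_line f'" using f tr sy unfolding eq_class_def by blast
  qed
  then show ?thesis using line_rel_iff[OF f(2)] by simp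
qed

lemma continuous_map_wscale:
  assumes "continuous_map X (wspace A D e n) f" "continuous_map X euclideanreal r"
  shows "continuous_map X (wspace A D e n) (\<lambda>z. wscale A e n (r z) (f z))"
proof (rule continuous_map_into_wspace)
  fix l assume l: "l < Suc n"
  have "continuous_map X (tot_space A D (lab e n l)) (\<lambda>z. f z l)"
    using continuous_map_compose[OF assms(1) continuous_map_wspace_component[OF l]] by (simp add: o_def)
  then show "continuous_map X (tot_space A D (lab e n l)) (\<lambda>z. wscale A e n (r z) (f z) l)"
    using continuous_map_bscale[OF assms(2)] l by (simp add: wscale_def)
next
  fix z assume "z \<in> topspace X"
  then have "f z \<in> topspace (wspace A D e n)" using continuous_map_funspace[OF assms(1)] by blast
  then obtain x u where "x \<in> subcube D" "f z = wvec A e n x u" by (rule wspaceE)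
  then show "wscale A e n (r z) (f z) \<in> topspace (wspace A D e n)" using wvec_in_wspace by simp
qed

text \<open>Rescaling by a positive factor to size 1/4, so that a line is represented by just two
  opposite vectors.\<close>

definition normalise :: "(nat \<Rightarrow> real) \<Rightarrow> nat \<Rightarrow> real" where
  "normalise f = wscale A e n (1 / (4 * nrm n (\<lambda>l. fibre_abs (f l) TYPE('n)))) f"

lemma normalise_wvec: "normalise (wvec A e n x u) = wvec A e n x (\<lambda>l. 1 / (4 * nrm n u) * u l)"
proof -
  have "nrm n (\<lambda>l. fibre_abs (wvec A e n x u l) TYPE('n)) = nrm n u"
    by (rule nrm_cong) (simp add: wvec_def fibre_abs_tot_map)
  then show ?thesis by (simp add: normalise_def)
qed

lemma continuous_map_normalise: "continuous_map (wnonzero A D e n) (wnonzero A D e n) normalise"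
proof -
  let ?N = "wnonzero A D e n"
  let ?r = "\<lambda>f. nrm n (\<lambda>l. fibre_abs (f l) TYPE('n))"
  have rp: "?r (wvec A e n x u) = nrm n u" for x u
    by (rule nrm_cong) (simp add: wvec_def fibre_abs_tot_map)
  have comp: "continuous_map ?N euclideanreal (\<lambda>f. fibre_abs (f l) TYPE('n))" if "l < Suc n" for l
    using continuous_map_compose[OF continuous_map_wspace_component[where A=A and D=D and e=e and n=n, OF that] continuous_map_fibre_abs]
    by (simp add: o_def continuous_map_from_subtopology)
  have "continuous_map ?N euclideanreal ?r"
    unfolding nrm_def
    by (intro continuous_map_add continuous_map_mx continuous_map_real_abs comp) auto
  moreover have "?r f \<noteq> 0" if f: "f \<in> topspace ?N" for f
  proof -
    obtain x u where "f = wvec A e n x u" "\<exists>l<Suc n. u l \<noteq> 0" using f by (rule wnonzeroE[OF tame])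
    then show ?thesis using rp nrm_pos by (metis less_irrefl)
  qed
  ultimately have "continuous_map ?N euclideanreal (\<lambda>f. 1 / (4 * ?r f))"
    by (intro continuous_map_real_divide continuous_map_real_mult) auto
  then have "continuous_map ?N (wspace A D e n) normalise"
    unfolding normalise_def
    by (intro continuous_map_wscale) (simp_all add: continuous_map_from_subtopology)
  moreover have "normalise f \<in> topspace ?N" if f: "f \<in> topspace ?N" for f
  proof -
    obtain x u where x: "x \<in> subcube D" "f = wvec A e n x u" and u: "\<exists>l<Suc n. u l \<noteq> 0"
      using f by (rule wnonzeroE[OF tame])
    then have "nrm n u > 0" using nrm_pos by blast
    then show ?thesis unfolding x(2) normalise_wvec using u by (intro wvec_in_wnonzero[OF tame x(1)]) auto
  qed
  ultimately show ?thesis by (auto simp: continuous_map_in_subtopology)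
qed

lemma normalise_line:
  assumes f: "f \<in> topspace (wnonzero A D e n)" and y: "y \<in> subcube (D \<union> P)"
  shows "(\<exists>a. a \<noteq> 0 \<and> G0 y = wscale A e n a f) \<longleftrightarrow> normalise f = G0 y \<or> normalise f = wscale A e n (-1) (G0 y)"
proof -
  obtain x u where x: "x \<in> subcube D" "f = wvec A e n x u" and u: "\<exists>l<Suc n. u l \<noteq> 0"
    using f by (rule wnonzeroE[OF tame])
  have N: "nrm n u > 0" using nrm_pos u by blast
  show ?thesis
  proof
    assume "\<exists>a. a \<noteq> 0 \<and> G0 y = wscale A e n a f"
    then obtain a where a: "a \<noteq> 0" "G0 y = wvec A e n x (\<lambda>l. a * u l)" by (auto simp: x(2))
    have "\<exists>g\<subseteq>walls (cut D y). x = act A g (cut D y) \<and> (\<forall>l<Suc n. a * u l = chi A (lab e n l) g * hom_coord e n y l)"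
      using a(2) unfolding wvec_eq_iff[OF tame] .
    then obtain g where "\<And>l. l < Suc n \<Longrightarrow> a * u l = chi A (lab e n l) g * hom_coord e n y l"
      by auto
    then have "nrm n (\<lambda>l. a * u l) = nrm n (hom_coord e n y)"
      by (intro nrm_cong) (simp add: abs_mult)
    then have "\<bar>a\<bar> * nrm n u = 1/4" by (simp add: nrm_mult nrm_hom_coord[OF y])
    then have "1 / (4 * nrm n u) = \<bar>a\<bar>" using N by (simp add: field_simps)
    then have "normalise f = wvec A e n x (\<lambda>l. \<bar>a\<bar> * u l)" by (simp add: x(2) normalise_wvec)
    then show "normalise f = G0 y \<or> normalise f = wscale A e n (-1) (G0 y)"
      using a(2) by (cases "a > 0") auto
  next
    let ?r = "1 / (4 * nrm n u)"
    assume "normalise f = G0 y \<or> normalise f = wscale A e n (-1) (G0 y)"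
    then show "\<exists>a. a \<noteq> 0 \<and> G0 y = wscale A e n a f"
    proof
      assume "normalise f = G0 y"
      then show ?thesis using N by (intro exI[of _ ?r]) (simp add: x(2) normalise_wvec)
    next
      assume "normalise f = wscale A e n (-1) (G0 y)"
      then have "wscale A e n (-1) (normalise f) = G0 y" by simp
      then show ?thesis using N by (intro exI[of _ "- ?r"]) (simp add: x(2) normalise_wvec)
    qed
  qed
qed

lemma compact_subcube: "compact (subcube D' :: (real^'n) set)"
proof -
  have "subcube D' = (\<Inter>k. {x::real^'n. \<bar>x$k\<bar> \<le> 1/4}) \<inter> (\<Inter>k\<in>-D'. {x. x$k = 0})"
    by (auto simp: subcube_def cube_iff)
  then have "closed (subcube D' :: (real^'n) set)"
    by (simp only:) (intro closed_Int closed_INT ballI closed_Collect_le closed_Collect_eq continuous_intros)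
  moreover have "norm x \<le> real CARD('n) * (1/4)" if "x \<in> subcube D'" for x :: "real^'n"
  proof -
    have "norm x \<le> (\<Sum>k\<in>UNIV. \<bar>x$k\<bar>)" by (rule norm_le_l1_cart)
    also have "\<dots> \<le> (\<Sum>k\<in>(UNIV::'n set). 1/4)" using that by (intro sum_mono) (auto simp: subcube_def cube_iff)
    finally show ?thesis by simp
  qed
  then have "bounded (subcube D' :: (real^'n) set)" by (rule boundedI)
  ultimately show ?thesis by (simp add: compact_eq_bounded_closed)
qed

lemma quotient_map_G0: "quotient_map (top_of_set (subcube (D \<union> P))) proj_space (proj_line \<circ> G0)"
proof (rule continuous_closed_imp_quotient_map)
  let ?X = "top_of_set (subcube (D \<union> P))" and ?N = "wnonzero A D e n"
  note q = quotient_map_proj_line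
  show "continuous_map ?X proj_space (proj_line \<circ> G0)"
    by (rule continuous_map_compose[OF continuous_map_G0 quotient_imp_continuous_map[OF q]])
  have GN: "G0 y \<in> topspace ?N" if "y \<in> subcube (D \<union> P)" for y
    using continuous_map_funspace[OF continuous_map_G0] that by auto
  have topq: "topspace proj_space = proj_line ` topspace ?N"
    using quotient_imp_surjective_map[OF q] by simp
  show "(proj_line \<circ> G0) ` topspace ?X = topspace proj_space"
  proof (intro subset_antisym subsetI)
    fix z assume "z \<in> topspace proj_space"
    then obtain f where f: "f \<in> topspace ?N" "z = proj_line f" unfolding topq by blast
    obtain x u where x: "x \<in> subcube D" "f = wvec A e n x u" "\<exists>l<Suc n. u l \<noteq> 0"
      using f(1) by (rule wnonzeroE[OF tame])
    obtain y a where y: "y \<in> subcube (D \<union> P)" "a \<noteq> 0" "G0 y = wvec A e n x (\<lambda>l. a * u l)"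
      using G0_hits_lines[OF x(1,3)] by blast
    then have "G0 y = wscale A e n a f" by (simp add: x(2))
    then have "proj_line f = proj_line (G0 y)"
      using proj_line_eq_iff[OF f(1) GN[OF y(1)]] y(2) by blast
    then show "z \<in> (proj_line \<circ> G0) ` topspace ?X" using f(2) y(1) by auto
  qed (use GN topq in auto)
  show "closed_map ?X proj_space (proj_line \<circ> G0)"
    unfolding closed_map_def
  proof (intro allI impI)
    fix C assume C: "closedin ?X C"
    then have CS: "C \<subseteq> subcube (D \<union> P)" using closedin_subset by fastforce
    have "compact_space ?X" using compact_subcube by (simp add: compact_space_subtopology)
    then have "compactin ?X C" using C closedin_compact_space by blast
    then have K1: "compactin ?N (G0 ` C)" using image_compactin continuous_map_G0 by blast
    have "continuous_map ?N (wspace A D e n) (wscale A e n (-1))"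
      using continuous_map_wscale[of ?N "\<lambda>f. f" "\<lambda>_. -1"]
      by (simp add: continuous_map_from_subtopology)
    moreover have "wscale A e n (-1) f \<in> topspace ?N" if f: "f \<in> topspace ?N" for f
    proof -
      obtain x u where x: "x \<in> subcube D" "f = wvec A e n x u" "\<exists>l<Suc n. u l \<noteq> 0"
        using f by (rule wnonzeroE[OF tame])
      then show ?thesis by (simp only: wscale_wvec) (intro wvec_in_wnonzero[OF tame]; simp)
    qed
    ultimately have "continuous_map ?N ?N (wscale A e n (-1))" by (auto simp: continuous_map_in_subtopology)
    then have K2: "compactin ?N (wscale A e n (-1) ` G0 ` C)" using image_compactin[OF K1] by blast
    have Haus: "Hausdorff_space ?N"
      unfolding whitney_sum_def
      by (intro Hausdorff_space_subtopology) (simp add: Hausdorff_space_product_topology Hausdorff_tot_space)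
    define K where "K = G0 ` C \<union> wscale A e n (-1) ` G0 ` C"
    have "closedin ?N K"
      unfolding K_def by (intro compactin_imp_closedin[OF Haus] compactin_Un K1 K2)
    then have cl: "closedin ?N {f \<in> topspace ?N. normalise f \<in> K}"
      by (rule closedin_continuous_map_preimage[OF continuous_map_normalise])
    have "{f \<in> topspace ?N. proj_line f \<in> (proj_line \<circ> G0) ` C} = {f \<in> topspace ?N. normalise f \<in> K}"
    proof -
      have "proj_line f \<in> (proj_line \<circ> G0) ` C \<longleftrightarrow> normalise f \<in> K" if f: "f \<in> topspace ?N" for f
      proof -
        have "proj_line f \<in> (proj_line \<circ> G0) ` C \<longleftrightarrow> (\<exists>y\<in>C. proj_line f = proj_line (G0 y))" by auto
        also have "\<dots> \<longleftrightarrow> (\<exists>y\<in>C. normalise f = G0 y \<or> normalise f = wscale A e n (-1) (G0 y))"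
        proof (rule bex_cong[OF refl])
          fix y assume "y \<in> C"
          then have y: "y \<in> subcube (D \<union> P)" using CS by blast
          show "proj_line f = proj_line (G0 y) \<longleftrightarrow> normalise f = G0 y \<or> normalise f = wscale A e n (-1) (G0 y)"
            using proj_line_eq_iff[OF f GN[OF y]] normalise_line[OF f y] by simp
        qed
        also have "\<dots> \<longleftrightarrow> normalise f \<in> K" unfolding K_def by blast
        finally show ?thesis .
      qed
      then show ?thesis by blast
    qed
    then have "closedin ?N {f \<in> topspace ?N. proj_line f \<in> (proj_line \<circ> G0) ` C}" using cl by simp
    moreover have "(proj_line \<circ> G0) ` C \<subseteq> topspace proj_space" using GN CS topq by auto
    ultimately show "closedin proj_space ((proj_line \<circ> G0) ` C)"
      using q unfolding quotient_map_closedin by blast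
  qed
qed

lemma is_proj_line_sum_block: "is_proj_line_sum (base_space A (D \<union> P)) (base_space A D)"
proof -
  have "base_space A (D \<union> P) homeomorphic_space proj_space"
  proof (rule quotient_maps_homeomorphic[OF quotient_map_qmap quotient_map_G0])
    fix y y' assume "y \<in> topspace (top_of_set (subcube (D \<union> P)))" "y' \<in> topspace (top_of_set (subcube (D \<union> P)))"
    then have y: "y \<in> subcube (D \<union> P)" "y' \<in> subcube (D \<union> P)" by auto
    then have "G0 y \<in> topspace (wnonzero A D e n)" "G0 y' \<in> topspace (wnonzero A D e n)"
      using continuous_map_funspace[OF continuous_map_G0] by auto
    then show "base_map A y = base_map A y' \<longleftrightarrow> (proj_line \<circ> G0) y = (proj_line \<circ> G0) y'"
      using G0_fibres[OF y] proj_line_eq_iff by (simp add: qmap_eq_iff[OF equivp_orb])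
  qed
  moreover have "proj_space = proj_whitney_sum (base_space A D) (Suc n) (\<lambda>l. tot_space A D (lab e n l)) (\<lambda>l. bproj A) (\<lambda>l. bscale A (lab e n l))"
    unfolding proj_whitney_sum_def line_rel_def[abs_def] ..
  ultimately show ?thesis
    unfolding is_proj_line_sum_def using real_line_bundle_tot_space[OF tame]
    by (intro exI[of _ "Suc n"] exI[of _ "\<lambda>l. tot_space A D (lab e n l)"] exI[of _ "\<lambda>l. bproj A"]
        exI[of _ "\<lambda>l. badd A (lab e n l)"] exI[of _ "\<lambda>l. bscale A (lab e n l)"]) simp
qed

end

section \<open>The tower of projectivizations\<close>

lemma base_space_tower:
  fixes A :: "'n::finite bmat"
  assumes tame: "tame A"
  shows "\<exists>m B. (\<exists>b. topspace (B 0) = {b}) \<and> (\<forall>i<m. is_proj_line_sum (B (Suc i)) (B i)) \<and> B m = base_space A D"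
proof (induction "card D" arbitrary: D rule: less_induct)
  case less
  show ?case
  proof (cases "D = {}")
    case True
    have "subcube D = {0}" using True by (auto simp: subcube_def vec_eq_iff cube_iff)
    then have "topspace (base_space A D) = {base_map A 0}" by (simp add: topspace_qspace)
    then show ?thesis by (intro exI[of _ 0] exI[of _ "\<lambda>_. base_space A D"]) auto
  next
    case False
    obtain i where i: "i \<in> D" "\<And>j. j \<in> D \<Longrightarrow> i = j \<or> A i j \<Longrightarrow> same_row A i j"
      using sink_exists[OF tame False] by blast
    \<comment> \<open>\<open>P\<close> is the full class of the sink row, so that within
      \<open>D\<close> its rows are supported exactly on \<open>P\<close>.\<close>
    define P where "P = {j \<in> D. same_row A i j}"
    have "i \<in> P" using i(1) by (simp add: P_def same_row_def)
    then have "card (D - P) < card D" by (intro psubset_card_mono) (auto simp: P_def)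
    then obtain m B where B: "\<exists>b. topspace (B 0) = {b}" "\<forall>i<m. is_proj_line_sum (B (Suc i)) (B i)"
      "B m = base_space A (D - P)"
      using less.hyps by blast
    obtain e where e: "bij_betw e {..<card P} P"
      using ex_bij_betw_nat_finite[of P] by (auto simp: atLeast0LessThan)
    have row: "(k = j \<or> A k j) = (i = j \<or> A i j)" if "k \<in> P" for k j
      using that by (auto simp: P_def same_row_def)
    have "sink_block A (D - P) P e (card P)"
    proof
      fix k j assume k: "k \<in> P" "j \<in> D - P"
      show "\<not> A k j"
      proof
        assume "A k j"
        then have "i = j \<or> A i j" using row[OF k(1), of j] by blast
        then have "j \<in> P" using i(2)[of j] k(2) by (simp add: P_def)
        then show False using k(2) by blast
      qed
    next
      fix k j assume k: "k \<in> P" "j \<in> P"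
      then show "k = j \<or> A k j" using row[OF k(1), of j] row[OF k(2), of j] by blast
    qed (use tame e in auto)
    then have "is_proj_line_sum (base_space A ((D - P) \<union> P)) (base_space A (D - P))"
      by (rule sink_block.is_proj_line_sum_block)
    moreover have "(D - P) \<union> P = D" by (auto simp: P_def)
    ultimately have step: "is_proj_line_sum (base_space A D) (B m)" using B(3) by simp
    define B' where "B' = B(Suc m := base_space A D)"
    have "\<exists>b. topspace (B' 0) = {b}" using B(1) by (simp add: B'_def)
    moreover have "is_proj_line_sum (B' (Suc l)) (B' l)" if "l < Suc m" for l
      using that B(2) step by (auto simp: B'_def less_Suc_eq)
    moreover have "B' (Suc m) = base_space A D" by (simp add: B'_def)
    ultimately show ?thesis by blast
  qed
qed

lemma seal_space_homeomorphic_base_space: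
  fixes A :: "'n::finite bmat"
  shows "seal_space A homeomorphic_space base_space A UNIV"
proof (rule quotient_maps_homeomorphic[OF quotient_map_proj])
  have "subcube UNIV = (cube :: (real^'n) set)" by (auto simp: subcube_def)
  then show "quotient_map (top_of_set cube) (base_space A UNIV) (base_map A)"
    using quotient_map_qmap[of "subcube UNIV" "orb A"] by simp
  fix x y :: "real^'n" assume "x \<in> topspace (top_of_set cube)" "y \<in> topspace (top_of_set cube)"
  then show "proj A x = proj A y \<longleftrightarrow> base_map A x = base_map A y"
    by (simp add: proj_eq_iff seal_rel_iff qmap_eq_iff[OF equivp_orb] orb_def)
qed

theorem mainTheorem18:
  fixes A :: "'n::finite \<Rightarrow> 'n \<Rightarrow> bool"
  assumes "\<forall>i. \<not> A i i"
    and "closed_manifold (seal_space A)"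
  shows "strong_pairing A \<and> homeomorphic_to_gen_real_bott (seal_space A)"
proof
  have tame: "tame A" by (rule closed_manifold_imp_tame[OF assms(2)])
  show "strong_pairing A" by (rule tame_imp_strong_pairing[OF tame])
  obtain m B where "\<exists>b. topspace (B 0) = {b}" "\<forall>i<m. is_proj_line_sum (B (Suc i)) (B i)"
    "B m = base_space A UNIV"
    using base_space_tower[OF tame] by blast
  then show "homeomorphic_to_gen_real_bott (seal_space A)"
    unfolding homeomorphic_to_gen_real_bott_def
    using seal_space_homeomorphic_base_space[of A] by (intro exI[of _ m] exI[of _ B]) simp
qed

end
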